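(* Let $(E,\mu,\Gamma)$ be a Markov diffusion triple satisfying the $CD(\rho,n)$ condition with $\rho\in\mathbb{R}\setminus\{0\}$ and $n\geq1$. Then for any positive function $f\in\mathcal A$ and any $t>0$, $$\frac{4}{n\rho}\frac{LP_tf}{P_tf}<1+\frac{\pi^2}{\rho^2t^2}.$$
   Context: A Markov diffusion triple $(E,\mu,\Gamma)$ (in the sense of Bakry--Gentil--Ledoux, Analysis and Geometry of Markov Diffusion Operators, Chapter 3) consists of a nice state space $E$ equipped with a Markov diffusion semigroup $(P_t)_{t\geq 0}$ with infinitesimal generator $L$, carr\'e du champ $\Gamma$, and an invariant and reversible $\sigma$-finite measure $\mu$. There is a suitable algebra $\mathcal A$ of functions from $E$ to $\mathbb{R}$ on which, pointwise, $$\Gamma(f,g)=\tfrac12\big(L(fg)-fLg-gLf\big),\qquad \Gamma(f)=\Gamma(f,f),\qquad \Gamma_2(f)=\tfrac12\big(L\Gamma(f)-2\Gamma(f,Lf)\big).$$ The generator satisfies the diffusion property $L\phi(f)=\phi'(f)Lf+\phi''(f)\Gamma(f)$ for every smooth $\phi$ and $f\in\mathcal A$. The main example is a smooth, connected, complete weighted Riemannian manifold $M$ with $L=\Delta+\nabla V\cdot\nabla$, $d\mu=e^Vdx$, $\Gamma(f)=|\nabla f|^2$ and $\mathcal A$ the smooth bounded functions. The curvature-dimension condition $CD(\rho,n)$ means: $\Gamma_2(f)\geq\rho\,\Gamma(f)+\frac1n(Lf)^2$ for all $f\in\mathcal A$. The inequality is pointwise on $E$. *)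

theory Defs
  imports "HOL-Probability.Probability"
begin

definition smooth_real :: "(real \<Rightarrow> real) \<Rightarrow> bool"
  where "smooth_real \<phi> \<longleftrightarrow> (\<forall>k x. (deriv ^^ k) \<phi> differentiable (at x))"

definition semigroup_op :: "(real \<Rightarrow> 'a \<Rightarrow> 'a measure) \<Rightarrow> real \<Rightarrow> ('a \<Rightarrow> real) \<Rightarrow> 'a \<Rightarrow> real"
  where "semigroup_op p t f = (\<lambda>x. \<integral>y. f y \<partial>(p t x))"

definition carre_du_champ ::
    "(('a \<Rightarrow> real) \<Rightarrow> 'a \<Rightarrow> real) \<Rightarrow> ('a \<Rightarrow> real) \<Rightarrow> ('a \<Rightarrow> real) \<Rightarrow> 'a \<Rightarrow> real"
  where "carre_du_champ L f g = (\<lambda>x. (L (\<lambda>y. f y * g y) x - f x * L g x - g x * L f x) / 2)"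

definition Gamma2 :: "(('a \<Rightarrow> real) \<Rightarrow> 'a \<Rightarrow> real) \<Rightarrow> ('a \<Rightarrow> real) \<Rightarrow> 'a \<Rightarrow> real"
  where "Gamma2 L f = (\<lambda>x. (L (carre_du_champ L f f) x - 2 * carre_du_champ L f (L f) x) / 2)"

text \<open>
  The algebra on which the curvature condition is tested and on which the semigroup acts consists
  of the bounded elements of an algebra \<open>S\<close> of ``smooth'' functions.  The generator and the
  carre du champ act on \<open>S\<close>: on a non-compact manifold \<open>L f\<close> and \<open>\<Gamma>(f)\<close> are smooth but in general
  unbounded when \<open>f\<close> is smooth and bounded.
\<close>

definition bounded_algebra :: "('a \<Rightarrow> real) set \<Rightarrow> ('a \<Rightarrow> real) set"
  where "bounded_algebra S = {f \<in> S. bounded (range f)}"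

text \<open>
  Markov diffusion triples, following Bakry, Gentil and Ledoux (Analysis and Geometry of Markov
  Diffusion Operators, Chapter 3).  The state space is the whole type \<open>'a\<close>, \<open>M\<close> is the reversible
  measure, \<open>p t x\<close> (for \<open>t \<ge> 0\<close>) the transition kernels, \<open>A0\<close> is the core algebra of integrable functions and
  \<open>S\<close> the extended algebra.  On a complete weighted manifold with conservative heat semigroup,
  \<open>A0\<close> is the set of smooth compactly supported functions, \<open>S\<close> the set of all smooth functions,
  and \<open>bounded_algebra S\<close> the set of smooth bounded functions.
\<close>

locale markov_diffusion_triple = sigma_finite_measure M
  for M :: "'a measure" +
  fixes p :: "real \<Rightarrow> 'a \<Rightarrow> 'a measure"
    and A0 S :: "('a \<Rightarrow> real) set"
    and L :: "('a \<Rightarrow> real) \<Rightarrow> 'a \<Rightarrow> real"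
  assumes space_UNIV: "space M = UNIV"
    \<comment> \<open>Markov semigroup with invariant and reversible measure\<close>
    and kernel: "t \<ge> 0 \<Longrightarrow> p t \<in> M \<rightarrow>\<^sub>M prob_algebra M"
    and kernel_0: "p 0 x = return M x"
    and chapman_kolmogorov: "s \<ge> 0 \<Longrightarrow> t \<ge> 0 \<Longrightarrow> p (s + t) x = p s x \<bind> p t"
    and invariant: "t \<ge> 0 \<Longrightarrow> B \<in> sets M \<Longrightarrow> (\<integral>\<^sup>+x. emeasure (p t x) B \<partial>M) = emeasure M B"
    and reversible: "t \<ge> 0 \<Longrightarrow> B \<in> sets M \<Longrightarrow> C \<in> sets M \<Longrightarrow>
      (\<integral>\<^sup>+x. emeasure (p t x) B * indicator C x \<partial>M) = (\<integral>\<^sup>+x. emeasure (p t x) C * indicator B x \<partial>M)"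
    \<comment> \<open>the extended algebra and the operators on it\<close>
    and S_measurable: "S \<subseteq> borel_measurable M"
    and S_const: "(\<lambda>_. c) \<in> S"
    and S_add: "f \<in> S \<Longrightarrow> g \<in> S \<Longrightarrow> (\<lambda>x. f x + g x) \<in> S"
    and S_mult: "f \<in> S \<Longrightarrow> g \<in> S \<Longrightarrow> (\<lambda>x. f x * g x) \<in> S"
    and S_smooth: "smooth_real \<phi> \<Longrightarrow> f \<in> S \<Longrightarrow> (\<lambda>x. \<phi> (f x)) \<in> S"
    and L_S: "f \<in> S \<Longrightarrow> L f \<in> S"
    and L_add: "f \<in> S \<Longrightarrow> g \<in> S \<Longrightarrow> L (\<lambda>x. f x + g x) = (\<lambda>x. L f x + L g x)"
    and L_scale: "f \<in> S \<Longrightarrow> L (\<lambda>x. c * f x) = (\<lambda>x. c * L f x)"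
    and diffusion: "smooth_real \<phi> \<Longrightarrow> f \<in> S \<Longrightarrow>
      L (\<lambda>x. \<phi> (f x)) x = deriv \<phi> (f x) * L f x + deriv (deriv \<phi>) (f x) * carre_du_champ L f f x"
    and carre_nonneg: "f \<in> S \<Longrightarrow> carre_du_champ L f f x \<ge> 0"
    \<comment> \<open>the core algebra\<close>
    and A0_S: "A0 \<subseteq> S"
    and A0_bounded: "h \<in> A0 \<Longrightarrow> bounded (range h)"
    and A0_integrable: "h \<in> A0 \<Longrightarrow> integrable M h"
    and A0_add: "h \<in> A0 \<Longrightarrow> k \<in> A0 \<Longrightarrow> (\<lambda>x. h x + k x) \<in> A0"
    and A0_ideal: "f \<in> S \<Longrightarrow> h \<in> A0 \<Longrightarrow> (\<lambda>x. f x * h x) \<in> A0"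
    and A0_smooth: "smooth_real \<phi> \<Longrightarrow> \<phi> 0 = 0 \<Longrightarrow> h \<in> A0 \<Longrightarrow> (\<lambda>x. \<phi> (h x)) \<in> A0"
    and A0_L: "h \<in> A0 \<Longrightarrow> L h \<in> A0"
    and A0_dense: "q \<ge> 1 \<Longrightarrow> g \<in> borel_measurable M \<Longrightarrow> integrable M (\<lambda>x. \<bar>g x\<bar> powr q) \<Longrightarrow> e > 0 \<Longrightarrow>
      \<exists>h\<in>A0. (\<integral>x. \<bar>g x - h x\<bar> powr q \<partial>M) < e"
    and ibp_left: "f \<in> S \<Longrightarrow> h \<in> A0 \<Longrightarrow>
      (\<integral>x. carre_du_champ L f h x \<partial>M) = - (\<integral>x. h x * L f x \<partial>M)"
    and ibp_right: "f \<in> S \<Longrightarrow> h \<in> A0 \<Longrightarrow>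
      (\<integral>x. carre_du_champ L f h x \<partial>M) = - (\<integral>x. f x * L h x \<partial>M)"
    \<comment> \<open>elements of \<open>S\<close> are determined pointwise by their values against the measure\<close>
    and nonneg_weak: "f \<in> S \<Longrightarrow> (\<And>h. h \<in> A0 \<Longrightarrow> (\<And>x. h x \<ge> 0) \<Longrightarrow> (\<integral>x. h x * f x \<partial>M) \<ge> 0) \<Longrightarrow> f x \<ge> 0"
    \<comment> \<open>\<open>L\<close> is the generator of the semigroup in \<open>L\<^sup>2(M)\<close>\<close>
    and generator: "h \<in> A0 \<Longrightarrow>
      ((\<lambda>t. \<integral>x. ((semigroup_op p t h x - h x) / t - L h x)\<^sup>2 \<partial>M) \<longlongrightarrow> 0) (at_right 0)"
    and semigroup_S: "t \<ge> 0 \<Longrightarrow> f \<in> bounded_algebra S \<Longrightarrow> semigroup_op p t f \<in> S"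
    \<comment> \<open>completeness\<close>
    and complete: "\<exists>\<zeta>. (\<forall>k. \<zeta> k \<in> A0) \<and> (\<forall>k x. 0 \<le> \<zeta> k x \<and> \<zeta> k x \<le> \<zeta> (Suc k) x) \<and>
      (AE x in M. (\<lambda>k. \<zeta> k x) \<longlonglongrightarrow> 1) \<and>
      (\<forall>k x. carre_du_champ L (\<zeta> k) (\<zeta> k) x \<le> 1 / real (Suc k))"

definition curvature_dimension ::
    "('a \<Rightarrow> real) set \<Rightarrow> (('a \<Rightarrow> real) \<Rightarrow> 'a \<Rightarrow> real) \<Rightarrow> real \<Rightarrow> real \<Rightarrow> bool"
  where "curvature_dimension S L \<rho> n \<longleftrightarrow>
    (\<forall>f\<in>bounded_algebra S. \<forall>x. Gamma2 L f x \<ge> \<rho> * carre_du_champ L f f x + 1 / n * (L f x)\<^sup>2)"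

end

theory Submission
  imports Defs
begin

text \<open>
  Fix a terminal time \<open>T\<close> and follow the entropy \<open>P_s (g_s log g_s)\<close> along \<open>g_s = P_{T-s} f\<close>.
  Its derivative in \<open>s\<close> is the Fisher information \<open>\<Lambda>' = P_s (\<Gamma>(g_s) / g_s)\<close>, and its second
  derivative is \<open>2 P_s (g_s \<Gamma>_2(log g_s))\<close>.  The curvature-dimension condition applied to
  \<open>log g_s\<close>, the identity \<open>g L(log g) = L g - \<Gamma>(g) / g\<close> and the Cauchy--Schwarz inequality give
  \<open>\<Lambda>'' \<ge> 2 \<rho> \<Lambda>' + (2/n) (L P_T f - \<Lambda>')^2 / P_T f\<close>.  So \<open>y = \<Lambda>' / P_T f\<close> satisfies a Riccati
  inequality, and with \<open>D = 4 L P_T f / (n \<rho> P_T f) - 1 > 0\<close> a solution of the comparison equation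
  blows up within time \<open>\<pi> / (\<bar>\<rho>\<bar> \<surd>D)\<close>.  As \<open>y\<close> lives on the whole of \<open>[0, T]\<close>, this bounds \<open>D\<close>;
  as moreover \<open>y(0) \<ge> 0\<close>, the comparison solution does not start at its lower blow-up time, which
  leaves a gap depending only on \<open>\<rho>\<close> and \<open>T\<close> and makes the bound strict (\<open>lifetime_gap\<close>).

  The axioms of a diffusion triple give no pointwise regularity in time and no control of
  \<open>\<Gamma>\<close> at infinity, and the members of \<open>S\<close> are only determined by their integrals against the
  nonnegative elements of \<open>A0\<close>.  The argument is therefore carried out after integration against
  \<open>u \<in> A0\<close>, \<open>u \<ge> 0\<close>.  This makes \<open>y\<close> a real function, and the conclusion, being linear in
  \<open>P_T f\<close>, passes back to points.  By the same linearity \<open>f\<close> may be replaced by \<open>\<epsilon> + f_0\<close> with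
  \<open>f_0 = \<zeta>_k f \<in> A0\<close>, where \<open>\<zeta>_k\<close> are the cutoffs of the completeness axiom.  On \<open>A0\<close> the semigroup
  commutes with \<open>L\<close> (\<open>L_P_commute\<close>) and has Taylor expansions with quadratic remainder, uniformly
  on the space (\<open>uniform_remainder\<close>) and in energy (\<open>energy_remainder\<close>).

  Time derivatives of \<open>\<Gamma>(g_s) / g_s\<close> are never taken.  This expression is jointly convex in \<open>g\<close> and
  its gradient, so its increments are bounded below by linear expressions in the increment of \<open>g\<close>,
  for which the Taylor expansions suffice (\<open>evolution_step\<close>); a quadratic error in every increment
  is harmless (\<open>superlinear_growth\<close>).  The integrations by parts in space need that \<open>\<Gamma>(g_s)\<close> is
  bounded.  This follows from the same scheme for the functional \<open>\<surd>(1 + \<Gamma>(g_s)) - 1\<close>, which has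
  finite energy because of the self-improved curvature inequality
  \<open>\<Gamma>(\<Gamma>(g)) \<le> 4 \<Gamma>(g) (\<Gamma>_2(g) - \<rho> \<Gamma>(g))\<close> (\<open>curvature_improved\<close>, \<open>gradient_bound\<close>).
\<close>

section \<open>Smooth functions on the line and growth with quadratic errors\<close>

text \<open>
  The family \<open>exp (-1/(1-x)) / (1-x)^m\<close>, extended by \<open>0\<close> beyond \<open>1\<close>, is closed under derivatives
  up to linear combinations.  It provides a globally smooth positive function that is the identity
  on \<open>[1, \<infinity>)\<close>, and with it a smooth extension of the logarithm.
\<close>

definition flat_exp :: "nat \<Rightarrow> real \<Rightarrow> real"
  where "flat_exp m x = (if x < 1 then exp (- 1 / (1 - x)) / (1 - x) ^ m else 0)"

definition soft_clamp :: "real \<Rightarrow> real"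
  where "soft_clamp x = x + flat_exp 0 x * exp (1 - x)"

lemma soft_clamp_eq: "x \<ge> 1 \<Longrightarrow> soft_clamp x = x"
  by (simp add: soft_clamp_def flat_exp_def)

text \<open>
  For \<open>x \<le> 0\<close> the added term is \<open>exp (1 - x - 1/(1-x))\<close>, whose exponent is at least \<open>-x\<close>; so it
  exceeds \<open>-x\<close>.
\<close>

lemma soft_clamp_pos: "soft_clamp x > 0"
proof (cases "x > 0")
  case True
  then show ?thesis by (auto simp: soft_clamp_def flat_exp_def intro: add_pos_nonneg)
next
  case False
  have "- x \<le> 1 - x - 1 / (1 - x)" using False by (simp add: field_simps)
  then have "1 + (- x) \<le> exp (1 - x - 1 / (1 - x))"
    by (metis exp_ge_add_one_self exp_le_cancel_iff order_trans)
  then have "- x < exp (- 1 / (1 - x)) * exp (1 - x)"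
    by (simp add: mult_exp_exp algebra_simps)
  then show ?thesis using False by (simp add: soft_clamp_def flat_exp_def)
qed

lemma power_le_fact_exp:
  fixes z :: real assumes "z \<ge> 0" shows "z ^ n \<le> fact n * exp z"
proof -
  have s: "summable (\<lambda>n. z ^ n /\<^sub>R fact n)" by (rule summable_exp_generic)
  have "z ^ n /\<^sub>R fact n \<le> (\<Sum>n. z ^ n /\<^sub>R fact n)"
    using sum_le_suminf[OF s, of "{n}"] assms by simp
  then show ?thesis by (simp add: exp_def field_simps)
qed

text \<open>
  A quadratic bound at the point \<open>1\<close> suffices for the derivative there to exist and to vanish.
\<close>

lemma flat_exp_quadratic: "\<bar>flat_exp m (1 + h)\<bar> \<le> fact (m + 2) * h\<^sup>2"
proof (cases "h < 0")
  case True
  define y where "y = - h"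
  have y: "y > 0" using True by (simp add: y_def)
  have "(1 / y) ^ (m + 2) \<le> fact (m + 2) * exp (1 / y)"
    using y by (intro power_le_fact_exp) auto
  then have "exp (- 1 / y) \<le> fact (m + 2) * y ^ (m + 2)"
    using y by (simp add: exp_minus field_simps power2_eq_square del: fact_Suc)
  then have "exp (- 1 / y) / y ^ m \<le> fact (m + 2) * y\<^sup>2"
    using y by (simp add: field_simps power_add del: fact_Suc) (simp add: power2_eq_square ac_simps del: fact_Suc)
  moreover have "flat_exp m (1 + h) = exp (- 1 / y) / y ^ m" "h\<^sup>2 = y\<^sup>2"
    using True by (simp_all add: flat_exp_def y_def)
  moreover have "exp (- 1 / y) / y ^ m \<ge> 0" using y by simp
  ultimately show ?thesis by simp
qed (simp add: flat_exp_def)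

lemma flat_exp_deriv: "(flat_exp m has_real_derivative real m * flat_exp (Suc m) x - flat_exp (m + 2) x) (at x)"
proof -
  consider "x < 1" | "x = 1" | "x > 1" by linarith
  then show ?thesis
  proof cases
    case 1
    have "((\<lambda>x. exp (- 1 / (1 - x)) / (1 - x) ^ m) has_real_derivative
        (exp (- 1 / (1 - x)) * (- 1 / (1 - x)\<^sup>2) * (1 - x) ^ m
          + exp (- 1 / (1 - x)) * (real m * (1 - x) ^ (m - 1))) / ((1 - x) ^ m)\<^sup>2) (at x)"
      using 1 by (auto intro!: derivative_eq_intros simp: power2_eq_square field_simps)
    moreover have "(exp (- 1 / (1 - x)) * (- 1 / (1 - x)\<^sup>2) * (1 - x) ^ m
          + exp (- 1 / (1 - x)) * (real m * (1 - x) ^ (m - 1))) / ((1 - x) ^ m)\<^sup>2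
        = real m * flat_exp (Suc m) x - flat_exp (m + 2) x"
    proof -
      define y where "y = 1 - x"
      have "y \<noteq> 0" using 1 by (simp add: y_def)
      then show ?thesis
        using 1 unfolding flat_exp_def y_def[symmetric]
        by (cases m) (simp_all add: field_simps power2_eq_square power_add)
    qed
    ultimately have "((\<lambda>x. exp (- 1 / (1 - x)) / (1 - x) ^ m) has_real_derivative
        real m * flat_exp (Suc m) x - flat_exp (m + 2) x) (at x)" by simp
    then show ?thesis
      by (rule has_field_derivative_transform_within_open[of _ _ _ "{..<1}"])
         (use 1 in \<open>auto simp: flat_exp_def\<close>)
  next
    case 2
    have "((\<lambda>h. (flat_exp m (1 + h) - flat_exp m 1) / h) \<longlongrightarrow> 0) (at 0)"
    proof (rule Lim_null_comparison)
      show "\<forall>\<^sub>F h in at 0. norm ((flat_exp m (1 + h) - flat_exp m 1) / h) \<le> fact (m + 2) * \<bar>h\<bar>"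
        using flat_exp_quadratic[of m]
        by (auto simp: eventually_at_filter flat_exp_def[of m 1] divide_le_eq power2_eq_square
            abs_mult mult.assoc simp del: fact_Suc)
      show "((\<lambda>h::real. fact (m + 2) * \<bar>h\<bar>) \<longlongrightarrow> 0) (at 0)"
        by (auto intro!: tendsto_eq_intros)
    qed
    then show ?thesis using 2 by (simp add: DERIV_def flat_exp_def[of _ 1])
  next
    case 3
    have "((\<lambda>x. 0) has_real_derivative real m * flat_exp (Suc m) x - flat_exp (m + 2) x) (at x)"
      using 3 by (simp add: flat_exp_def)
    then show ?thesis
      by (rule has_field_derivative_transform_within_open[of _ _ _ "{1<..}"])
         (use 3 in \<open>auto simp: flat_exp_def\<close>)
  qed
qed

text \<open>
  A class of functions that contains the derivatives of its members.  It is generated by the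
  functions to which the diffusion property is applied, together with what their derivatives
  require; smoothness of every member is then one induction.
\<close>

inductive elementary :: "(real \<Rightarrow> real) \<Rightarrow> bool" where
  const: "elementary (\<lambda>_. c)"
| ident: "elementary (\<lambda>x. x)"
| add: "elementary f \<Longrightarrow> elementary g \<Longrightarrow> elementary (\<lambda>x. f x + g x)"
| mult: "elementary f \<Longrightarrow> elementary g \<Longrightarrow> elementary (\<lambda>x. f x * g x)"
| exp: "elementary f \<Longrightarrow> elementary (\<lambda>x. exp (f x))"
| sin: "elementary f \<Longrightarrow> elementary (\<lambda>x. sin (f x))"
| cos: "elementary f \<Longrightarrow> elementary (\<lambda>x. cos (f x))"
| flat_exp: "elementary (flat_exp m)"
| inv_clamp: "elementary (\<lambda>x. inverse (soft_clamp x))"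
| ln_clamp: "elementary (\<lambda>x. ln (soft_clamp x))"

lemma elementary_diff: "elementary f \<Longrightarrow> elementary g \<Longrightarrow> elementary (\<lambda>x. f x - g x)"
  using elementary.add[of f, OF _ elementary.mult[OF elementary.const[of "-1"], of g]] by simp

lemma soft_clamp_has_derivative:
  "(soft_clamp has_real_derivative 1 - flat_exp 2 x * exp (1 - x) - flat_exp 0 x * exp (1 - x)) (at x)"
  unfolding soft_clamp_def[abs_def]
  by (auto intro!: derivative_eq_intros flat_exp_deriv simp: numeral_2_eq_2)

lemma elementary_has_derivative:
  "elementary f \<Longrightarrow> \<exists>f'. elementary f' \<and> (\<forall>x. (f has_real_derivative f' x) (at x))"
proof (induction rule: elementary.induct)
  case (const c)
  then show ?case by (intro exI[of _ "\<lambda>_. 0"]) (auto intro: elementary.intros)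
next
  case ident
  then show ?case by (intro exI[of _ "\<lambda>_. 1"]) (auto intro: elementary.intros)
next
  case (add f g)
  then obtain f' g' where "elementary f'" "elementary g'"
    "\<And>x. (f has_real_derivative f' x) (at x)" "\<And>x. (g has_real_derivative g' x) (at x)" by blast
  then show ?case
    by (intro exI[of _ "\<lambda>x. f' x + g' x"]) (auto intro: elementary.intros DERIV_add)
next
  case (mult f g)
  then obtain f' g' where "elementary f'" "elementary g'"
    "\<And>x. (f has_real_derivative f' x) (at x)" "\<And>x. (g has_real_derivative g' x) (at x)" by blast
  with mult.hyps show ?case
    by (intro exI[of _ "\<lambda>x. f' x * g x + f x * g' x"])
       (auto intro!: elementary.intros derivative_eq_intros)
next
  case (exp f)
  then obtain f' where "elementary f'" "\<And>x. (f has_real_derivative f' x) (at x)" by blast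
  with exp.hyps show ?case
    by (intro exI[of _ "\<lambda>x. exp (f x) * f' x"]) (auto intro!: elementary.intros derivative_eq_intros)
next
  case (sin f)
  then obtain f' where "elementary f'" "\<And>x. (f has_real_derivative f' x) (at x)" by blast
  with sin.hyps show ?case
    by (intro exI[of _ "\<lambda>x. cos (f x) * f' x"]) (auto intro!: elementary.intros derivative_eq_intros)
next
  case (cos f)
  then obtain f' where "elementary f'" "\<And>x. (f has_real_derivative f' x) (at x)" by blast
  with cos.hyps show ?case
    using elementary.mult[OF elementary.const[of "- 1"] elementary.mult[OF elementary.sin[of f], of f']]
    by (intro exI[of _ "\<lambda>x. - 1 * (sin (f x) * f' x)"]) (auto intro!: derivative_eq_intros)
next
  case (flat_exp m)
  show ?case
    by (intro exI[of _ "\<lambda>x. real m * flat_exp (Suc m) x - flat_exp (m + 2) x"] conjI allI flat_exp_deriv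
        elementary_diff elementary.intros)
next
  case inv_clamp
  show ?case
  proof (intro exI conjI allI)
    let ?c = "\<lambda>x. 1 - flat_exp 2 x * exp (1 - x) - flat_exp 0 x * exp (1 - x)"
    show "elementary (\<lambda>x. (- 1) * ?c x * (inverse (soft_clamp x) * inverse (soft_clamp x)))"
      by (intro elementary_diff elementary.intros)
    show "((\<lambda>x. inverse (soft_clamp x)) has_real_derivative
        (- 1) * ?c x * (inverse (soft_clamp x) * inverse (soft_clamp x))) (at x)" for x
      using soft_clamp_pos[of x]
      by (auto intro!: derivative_eq_intros soft_clamp_has_derivative simp: algebra_simps)
  qed
next
  case ln_clamp
  show ?case
  proof (intro exI conjI allI)
    let ?c = "\<lambda>x. 1 - flat_exp 2 x * exp (1 - x) - flat_exp 0 x * exp (1 - x)"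
    show "elementary (\<lambda>x. ?c x * inverse (soft_clamp x))"
      by (intro elementary_diff elementary.intros)
    show "((\<lambda>x. ln (soft_clamp x)) has_real_derivative ?c x * inverse (soft_clamp x)) (at x)" for x
      using soft_clamp_pos[of x]
      by (auto intro!: derivative_eq_intros soft_clamp_has_derivative simp: field_simps)
  qed
qed

lemma elementary_DERIV: "elementary f \<Longrightarrow> (f has_real_derivative deriv f x) (at x)"
  using elementary_has_derivative by (metis DERIV_imp_deriv)

lemma elementary_deriv: assumes "elementary f" shows "elementary (deriv f)"
proof -
  obtain f' where "elementary f'" "\<And>x. (f has_real_derivative f' x) (at x)"
    using elementary_has_derivative[OF assms] by blast
  moreover then have "deriv f = f'" by (auto intro: DERIV_imp_deriv)
  ultimately show ?thesis by simp
qed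

lemma elementary_smooth_real: assumes "elementary f" shows "smooth_real f"
proof -
  have "elementary ((deriv ^^ k) f)" for k
    by (induction k) (auto intro: assms elementary_deriv)
  then show ?thesis unfolding smooth_real_def
    using elementary_DERIV real_differentiable_def by blast
qed

text \<open>
  Cutting \<open>[0, T]\<close> into \<open>N\<close> equal pieces, the quadratic errors add up to \<open>C T^2 / N\<close>.  This replaces
  differentiability: only lower bounds on increments are available below.
\<close>

lemma superlinear_growth:
  fixes \<Theta> :: "real \<Rightarrow> real"
  assumes "T \<ge> 0"
    and step: "\<And>a b. 0 \<le> a \<Longrightarrow> a \<le> b \<Longrightarrow> b \<le> T \<Longrightarrow> \<Theta> b - \<Theta> a \<ge> \<omega> * (b - a) - C * (b - a)\<^sup>2"
  shows "\<Theta> T - \<Theta> 0 \<ge> \<omega> * T"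
proof -
  have bound: "\<Theta> T - \<Theta> 0 \<ge> \<omega> * T - C * T\<^sup>2 * inverse (real (Suc N))" for N
  proof -
    let ?n = "real (Suc N)"
    define x where "x i = real i * T / ?n" for i
    have "\<omega> * (T / ?n) - C * (T / ?n)\<^sup>2 \<le> \<Theta> (x (Suc i)) - \<Theta> (x i)" if "i < Suc N" for i
    proof -
      have d: "x (Suc i) - x i = T / ?n"
        by (simp only: x_def diff_divide_distrib[symmetric] left_diff_distrib[symmetric]) simp
      have "T / ?n \<ge> 0" using \<open>T \<ge> 0\<close> by simp
      then have "x i \<le> x (Suc i)" using d by linarith
      moreover have "real (Suc i) * T \<le> real (Suc N) * T"
        using that \<open>T \<ge> 0\<close> by (intro mult_right_mono) auto
      then have "x (Suc i) \<le> T" by (simp add: x_def divide_le_eq mult.commute)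
      moreover have "0 \<le> x i" using \<open>T \<ge> 0\<close> by (simp add: x_def)
      ultimately show ?thesis using step[of "x i" "x (Suc i)"] d by simp
    qed
    then have "(\<Sum>i<Suc N. \<omega> * (T / ?n) - C * (T / ?n)\<^sup>2)
        \<le> (\<Sum>i<Suc N. \<Theta> (x (Suc i)) - \<Theta> (x i))"
      by (intro sum_mono) auto
    also have "\<dots> = \<Theta> (x (Suc N)) - \<Theta> (x 0)"
      by (rule sum_lessThan_telescope)
    also have "\<dots> = \<Theta> T - \<Theta> 0" by (simp add: x_def)
    also have "(\<Sum>i<Suc N. \<omega> * (T / ?n) - C * (T / ?n)\<^sup>2) = ?n * (\<omega> * (T / ?n) - C * (T / ?n)\<^sup>2)"
      by simp
    also have "\<dots> = \<omega> * T - C * T\<^sup>2 * inverse ?n"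
    proof -
      define n where "n = ?n"
      have "n > 0" by (simp add: n_def)
      then show ?thesis unfolding n_def[symmetric] by (simp add: field_simps power2_eq_square)
    qed
    finally show ?thesis .
  qed
  have "(\<lambda>N. \<omega> * T - C * T\<^sup>2 * inverse (real (Suc N))) \<longlonglongrightarrow> \<omega> * T - C * T\<^sup>2 * 0"
    by (intro tendsto_intros LIMSEQ_inverse_real_of_nat)
  then show ?thesis using bound by (simp add: LIMSEQ_le_const2)
qed

text \<open>
  The derivative \<open>1 / (1 + x^2)\<close> of \<open>arctan\<close> is 1-Lipschitz.
\<close>

lemma arctan_quadratic_lower:
  "arctan (u + v) \<ge> arctan u + v / (1 + u\<^sup>2) - v\<^sup>2"
proof -
  have lip: "\<bar>1 / (1 + x\<^sup>2) - 1 / (1 + u\<^sup>2)\<bar> \<le> \<bar>x - u\<bar>" for x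
  proof -
    have pos: "1 + x\<^sup>2 > 0" "1 + u\<^sup>2 > 0" by (auto simp: add_pos_nonneg)
    have "\<bar>u + x\<bar> \<le> (1 + x\<^sup>2) * (1 + u\<^sup>2)"
    proof -
      have "0 \<le> (\<bar>u\<bar> - 1)\<^sup>2 + (\<bar>x\<bar> - 1)\<^sup>2" by simp
      then have "2 * (\<bar>u\<bar> + \<bar>x\<bar>) \<le> 2 + u\<^sup>2 + x\<^sup>2" by (simp add: power2_diff)
      then show ?thesis by (simp add: algebra_simps) (smt (verit) zero_le_mult_iff zero_le_power2)
    qed
    have "1 / (1 + x\<^sup>2) - 1 / (1 + u\<^sup>2) = (u - x) * ((u + x) / ((1 + x\<^sup>2) * (1 + u\<^sup>2)))"
      using pos by (simp add: field_simps power2_eq_square)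
    also have "\<bar>\<dots>\<bar> = \<bar>x - u\<bar> * (\<bar>u + x\<bar> / ((1 + x\<^sup>2) * (1 + u\<^sup>2)))"
      using pos by (simp add: abs_mult abs_minus_commute)
    also have "\<dots> \<le> \<bar>x - u\<bar> * 1"
      using \<open>\<bar>u + x\<bar> \<le> (1 + x\<^sup>2) * (1 + u\<^sup>2)\<close> pos by (intro mult_left_mono) (auto simp: divide_le_eq)
    finally show ?thesis by simp
  qed
  consider "v = 0" | "v > 0" | "v < 0" by linarith
  then show ?thesis
  proof cases
    case 2
    obtain z where z: "u < z" "z < u + v" "arctan (u + v) - arctan u = v * inverse (1 + z\<^sup>2)"
      using MVT2[of u "u + v" arctan "\<lambda>x. inverse (1 + x\<^sup>2)"] 2 by (auto intro: DERIV_arctan)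
    have "v * (1 / (1 + u\<^sup>2) - 1 / (1 + z\<^sup>2)) \<le> v * v"
      using lip[of z] z 2 by (intro mult_left_mono) linarith+
    then show ?thesis using z by (simp add: algebra_simps power2_eq_square inverse_eq_divide)
  next
    case 3
    obtain z where z: "u + v < z" "z < u" "arctan u - arctan (u + v) = - v * inverse (1 + z\<^sup>2)"
      using MVT2[of "u + v" u arctan "\<lambda>x. inverse (1 + x\<^sup>2)"] 3 by (auto intro: DERIV_arctan)
    have "- v * (1 / (1 + z\<^sup>2) - 1 / (1 + u\<^sup>2)) \<le> - v * - v"
      using lip[of z] z 3 by (intro mult_left_mono) linarith+
    then show ?thesis using z by (simp add: algebra_simps power2_eq_square inverse_eq_divide)
  qed auto
qed

text \<open>
  Put \<open>y = \<Phi> / Y\<close>, \<open>\<xi> = X / Y\<close> and \<open>z = y - (\<xi> - n \<rho> / 2)\<close>.  Completing the square turns the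
  right-hand side into \<open>(2/n) (z^2 + c^2)\<close> with \<open>c = n \<bar>\<rho>\<bar> \<surd>D / 2\<close>, so \<open>arctan (z / c)\<close> grows at
  least at the rate \<open>2 c / n = \<bar>\<rho>\<bar> \<surd>D\<close>.  It ends below \<open>\<pi> / 2\<close> and, as \<open>y(0) \<ge> 0\<close>, starts
  no lower than \<open>- arctan (\<bar>D - 1\<bar> / (2 \<surd>D))\<close>.
\<close>

lemma riccati_lifetime:
  fixes \<Phi> :: "real \<Rightarrow> real"
  assumes "\<rho> \<noteq> 0" "n > 0" "Y > 0" "T > 0"
    and range: "\<And>s. 0 \<le> s \<Longrightarrow> s \<le> T \<Longrightarrow> 0 \<le> \<Phi> s \<and> \<Phi> s \<le> B"
    and step: "\<And>a b. 0 \<le> a \<Longrightarrow> a \<le> b \<Longrightarrow> b \<le> T \<Longrightarrow>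
      \<Phi> b - \<Phi> a \<ge> (b - a) * (2 * \<rho> * \<Phi> a + 2 / n * ((X - \<Phi> a)\<^sup>2 / Y)) - C * (b - a)\<^sup>2"
    and D: "D = 4 * X / (n * \<rho> * Y) - 1" "D > 0"
  shows "\<bar>\<rho>\<bar> * sqrt D * T \<le> pi / 2 + arctan (\<bar>D - 1\<bar> / (2 * sqrt D))"
proof -
  define c where "c = n * \<bar>\<rho>\<bar> * sqrt D / 2"
  define z where "z s = \<Phi> s / Y - n * \<rho> * (D - 1) / 4" for s
  have c: "c > 0" using assms by (simp add: c_def)
  have X: "X = n * \<rho> * Y * (D + 1) / 4" using D assms(1-3) by (simp add: field_simps)
  have c2: "c\<^sup>2 = n\<^sup>2 * \<rho>\<^sup>2 * D / 4" using D(2) by (simp add: c_def power_mult_distrib power_divide)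
  have key: "(2 * \<rho> * \<Phi> a + 2 / n * ((X - \<Phi> a)\<^sup>2 / Y)) / Y = 2 / n * ((z a)\<^sup>2 + c\<^sup>2)" for a
  proof -
    define y where "y = \<Phi> a / Y"
    have y: "\<Phi> a = y * Y" using assms(3) by (simp add: y_def)
    have "(2 * \<rho> * \<Phi> a + 2 / n * ((X - \<Phi> a)\<^sup>2 / Y)) / Y
        = 2 * \<rho> * y + 2 / n * (n * \<rho> * (D + 1) / 4 - y)\<^sup>2"
      unfolding y X using assms(2,3) by (simp add: field_simps power2_eq_square)
    also have "\<dots> = 2 / n * ((y - n * \<rho> * (D - 1) / 4)\<^sup>2 + n\<^sup>2 * \<rho>\<^sup>2 * D / 4)"
      using assms(2) by (simp add: field_simps power2_eq_square)
    finally show ?thesis by (simp add: z_def c2 y_def)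
  qed
  define Z where "Z = \<bar>B / Y\<bar> + \<bar>n * \<rho> * (D - 1) / 4\<bar>"
  have zB: "\<bar>z s\<bar> \<le> Z" if "0 \<le> s" "s \<le> T" for s
  proof -
    have "0 \<le> \<Phi> s / Y" "\<Phi> s / Y \<le> B / Y"
      using range[OF that] assms(3) by (auto intro: divide_right_mono)
    then show ?thesis unfolding z_def Z_def by linarith
  qed
  define V where "V = 2 / n * (Z\<^sup>2 + c\<^sup>2) + \<bar>C\<bar> / Y * T"
  have V0: "V \<ge> 0" unfolding V_def using assms by (intro add_nonneg_nonneg mult_nonneg_nonneg) auto
  have "arctan (z T / c) - arctan (z 0 / c) \<ge> (2 * c / n) * T"
  proof (rule superlinear_growth[where \<Theta> = "\<lambda>s. arctan (z s / c)" and C = "\<bar>C\<bar> / (Y * c) + (V / c)\<^sup>2"])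
    show "0 \<le> T" using assms by simp
    fix a b :: real assume ab: "0 \<le> a" "a \<le> b" "b \<le> T"
    define d where "d = b - a"
    have d: "0 \<le> d" "d \<le> T" using ab by (auto simp: d_def)
    define v where "v = d * (2 / n * ((z a)\<^sup>2 + c\<^sup>2)) - \<bar>C\<bar> / Y * d\<^sup>2"
    have "\<Phi> b - \<Phi> a \<ge> d * (2 * \<rho> * \<Phi> a + 2 / n * ((X - \<Phi> a)\<^sup>2 / Y)) - \<bar>C\<bar> * d\<^sup>2"
      using step[OF ab] mult_right_mono[OF abs_ge_self[of C], of "d\<^sup>2"] unfolding d_def by simp
    then have "(\<Phi> b - \<Phi> a) / Y
        \<ge> (d * (2 * \<rho> * \<Phi> a + 2 / n * ((X - \<Phi> a)\<^sup>2 / Y)) - \<bar>C\<bar> * d\<^sup>2) / Y"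
      using assms(3) by (intro divide_right_mono) auto
    also have "(d * (2 * \<rho> * \<Phi> a + 2 / n * ((X - \<Phi> a)\<^sup>2 / Y)) - \<bar>C\<bar> * d\<^sup>2) / Y = v"
      unfolding v_def key[symmetric] by (simp add: diff_divide_distrib)
    finally have zv: "z b \<ge> z a + v" by (simp add: z_def diff_divide_distrib)
    have "\<bar>z a\<bar> \<le> Z" using zB ab by auto
    then have za: "(z a)\<^sup>2 \<le> Z\<^sup>2" by (simp add: abs_le_square_iff[symmetric] Z_def)
    have "\<bar>v\<bar> \<le> \<bar>d * (2 / n * ((z a)\<^sup>2 + c\<^sup>2))\<bar> + \<bar>\<bar>C\<bar> / Y * d\<^sup>2\<bar>"
      unfolding v_def by (rule abs_triangle_ineq4)
    also have "\<dots> = d * (2 / n * ((z a)\<^sup>2 + c\<^sup>2)) + \<bar>C\<bar> / Y * d\<^sup>2"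
      using d assms(2,3) by (simp add: abs_mult)
    also have "\<dots> \<le> d * (2 / n * (Z\<^sup>2 + c\<^sup>2)) + \<bar>C\<bar> / Y * (d * T)"
      using d assms(2,3) za
      by (intro add_mono mult_left_mono) (auto simp: power2_eq_square mult_left_mono divide_right_mono)
    also have "\<dots> = d * V" by (simp add: V_def algebra_simps)
    finally have vV: "\<bar>v\<bar> \<le> d * V" .
    have "(v / c)\<^sup>2 \<le> (d * V / c)\<^sup>2"
      using vV c d V0 by (simp add: power_divide divide_right_mono abs_le_square_iff[symmetric])
    then have sq: "(v / c)\<^sup>2 \<le> (V / c)\<^sup>2 * d\<^sup>2" by (simp add: power_mult_distrib power_divide mult.commute)
    have pos: "(z a)\<^sup>2 + c\<^sup>2 > 0" using c by (simp add: add_nonneg_pos)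
    have "(v / c) / (1 + (z a / c)\<^sup>2) = c * v / ((z a)\<^sup>2 + c\<^sup>2)"
      using c pos by (simp add: field_simps power2_eq_square)
    also have "\<dots> = (2 * c / n) * d - c / ((z a)\<^sup>2 + c\<^sup>2) * (\<bar>C\<bar> / Y * d\<^sup>2)"
    proof -
      define Q E where "Q = (z a)\<^sup>2 + c\<^sup>2" and "E = \<bar>C\<bar> / Y * d\<^sup>2"
      have "Q \<noteq> 0" using pos unfolding Q_def by (rule less_imp_neq[symmetric])
      then have "c * (d * (2 / n * Q) - E) / Q = (2 * c / n) * d - c / Q * E"
        using assms(2) by (simp add: field_simps)
      then show ?thesis unfolding v_def Q_def E_def .
    qed
    also have "\<dots> \<ge> (2 * c / n) * d - 1 / c * (\<bar>C\<bar> / Y * d\<^sup>2)"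
    proof -
      have "c / ((z a)\<^sup>2 + c\<^sup>2) \<le> 1 / c" using c pos by (simp add: field_simps power2_eq_square)
      then show ?thesis using assms(3) by (intro diff_left_mono mult_right_mono) auto
    qed
    finally have lin: "(v / c) / (1 + (z a / c)\<^sup>2) \<ge> (2 * c / n) * d - 1 / c * (\<bar>C\<bar> / Y * d\<^sup>2)" .
    have "arctan (z b / c) \<ge> arctan (z a / c + v / c)"
      using zv c by (simp add: arctan_le_iff add_divide_distrib[symmetric] divide_right_mono)
    with arctan_quadratic_lower[of "z a / c" "v / c"] lin sq
    show "2 * c / n * (b - a) - (\<bar>C\<bar> / (Y * c) + (V / c)\<^sup>2) * (b - a)\<^sup>2
        \<le> arctan (z b / c) - arctan (z a / c)"
      unfolding d_def by (simp add: algebra_simps)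
  qed
  moreover have "arctan (z T / c) < pi / 2" by (rule arctan_ubound)
  moreover have "z 0 / c \<ge> - (\<bar>D - 1\<bar> / (2 * sqrt D))"
  proof -
    have "z 0 \<ge> - (n * \<bar>\<rho>\<bar> * \<bar>D - 1\<bar> / 4)"
    proof -
      have "\<Phi> 0 / Y \<ge> 0" using range[of 0] assms by simp
      moreover have "n * \<rho> * (D - 1) / 4 \<le> \<bar>n * \<rho> * (D - 1) / 4\<bar>" by simp
      moreover have "\<bar>n * \<rho> * (D - 1) / 4\<bar> = n * \<bar>\<rho>\<bar> * \<bar>D - 1\<bar> / 4"
        using assms(2) by (simp add: abs_mult)
      ultimately show ?thesis unfolding z_def by linarith
    qed
    then have "z 0 / c \<ge> - (n * \<bar>\<rho>\<bar> * \<bar>D - 1\<bar> / 4) / c" using c by (intro divide_right_mono) auto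
    also have "- (n * \<bar>\<rho>\<bar> * \<bar>D - 1\<bar> / 4) / c = - (\<bar>D - 1\<bar> / (2 * sqrt D))"
      using assms(1,2) D(2) by (simp add: c_def field_simps)
    finally show ?thesis .
  qed
  then have "arctan (z 0 / c) \<ge> - arctan (\<bar>D - 1\<bar> / (2 * sqrt D))"
    by (metis arctan_le_iff arctan_minus)
  moreover have "2 * c / n = \<bar>\<rho>\<bar> * sqrt D" using assms(2) by (simp add: c_def)
  ultimately show ?thesis by simp
qed

text \<open>
  Let \<open>D\<^sub>0 = \<pi>^2 / (\<rho>^2 T^2)\<close>.  For \<open>D \<ge> D\<^sub>0\<close> the left-hand side of the lifetime bound is at
  least \<open>\<pi>\<close>, which the right-hand side never reaches.  For \<open>D\<close> between \<open>D\<^sub>0 / 2\<close> and \<open>D\<^sub>0\<close> the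
  right-hand side stays below a constant \<open>q < \<pi>\<close>, so \<open>D\<close> stays away from \<open>D\<^sub>0\<close>.  The point is that
  \<open>\<kappa>\<close> depends only on \<open>\<rho>\<close> and \<open>T\<close>, so that the strict bound survives integration against varying
  test functions.
\<close>

lemma lifetime_gap:
  fixes \<rho> T :: real
  assumes "\<rho> \<noteq> 0" "T > 0"
  obtains \<kappa> where "1 \<le> \<kappa>" "\<kappa> < 1 + pi\<^sup>2 / (\<rho>\<^sup>2 * T\<^sup>2)"
    "\<And>D. D > 0 \<Longrightarrow> \<bar>\<rho>\<bar> * sqrt D * T \<le> pi / 2 + arctan (\<bar>D - 1\<bar> / (2 * sqrt D)) \<Longrightarrow> D + 1 \<le> \<kappa>"
proof -
  define D0 where "D0 = pi\<^sup>2 / (\<rho>\<^sup>2 * T\<^sup>2)"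
  have D0: "D0 > 0" using assms by (simp add: D0_def)
  define q where "q = pi / 2 + arctan ((D0 + 1) / (2 * sqrt (D0 / 2)))"
  have q: "0 \<le> q" "q < pi"
    using D0 arctan_ubound[of "(D0 + 1) / (2 * sqrt (D0 / 2))"]
    by (auto simp: q_def intro!: add_nonneg_nonneg)
  define \<kappa>1 where "\<kappa>1 = (q / (\<bar>\<rho>\<bar> * T))\<^sup>2"
  have k1: "\<kappa>1 < D0"
    using q assms unfolding \<kappa>1_def D0_def
    by (simp add: power_divide power_mult_distrib divide_strict_right_mono power_strict_mono)
  have sD0: "\<bar>\<rho>\<bar> * sqrt D0 * T = pi"
    using assms by (simp add: D0_def real_sqrt_divide real_sqrt_mult)
  show ?thesis
  proof (rule that[of "1 + max (D0 / 2) \<kappa>1"])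
    show "1 \<le> 1 + max (D0 / 2) \<kappa>1" using D0 by simp
    show "1 + max (D0 / 2) \<kappa>1 < 1 + pi\<^sup>2 / (\<rho>\<^sup>2 * T\<^sup>2)"
      using D0 k1 by (simp add: D0_def[symmetric])
    fix D :: real
    assume D: "D > 0" and le: "\<bar>\<rho>\<bar> * sqrt D * T \<le> pi / 2 + arctan (\<bar>D - 1\<bar> / (2 * sqrt D))"
    show "D + 1 \<le> 1 + max (D0 / 2) \<kappa>1"
    proof (cases "D \<le> D0 / 2")
      case False
      have "D < D0"
      proof (rule ccontr)
        assume "\<not> D < D0"
        then have "\<bar>\<rho>\<bar> * sqrt D0 * T \<le> \<bar>\<rho>\<bar> * sqrt D * T"
          using assms by (intro mult_right_mono mult_left_mono) auto
        then show False using le sD0 arctan_ubound[of "\<bar>D - 1\<bar> / (2 * sqrt D)"] by linarith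
      qed
      have "\<bar>D - 1\<bar> / (2 * sqrt D) \<le> (D0 + 1) / (2 * sqrt (D0 / 2))"
        using \<open>D < D0\<close> False D0 D by (intro frac_le) auto
      then have "\<bar>\<rho>\<bar> * sqrt D * T \<le> q" using le unfolding q_def
        by (meson add_left_mono arctan_monotone' order_trans)
      then have "sqrt D \<le> q / (\<bar>\<rho>\<bar> * T)" using assms by (simp add: field_simps)
      then have "(sqrt D)\<^sup>2 \<le> \<kappa>1" unfolding \<kappa>1_def using D by (intro power_mono) auto
      then show ?thesis using D by simp
    qed simp
  qed
qed

section \<open>Calculus of the carre du champ and the improved curvature condition\<close>

lemma nonneg_quadratic_discriminant:
  fixes a b c :: real
  assumes "\<And>r. a + 2 * b * r + c * r\<^sup>2 \<ge> 0" "c \<ge> 0"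
  shows "b\<^sup>2 \<le> a * c"
proof (cases "c = 0")
  case True
  have "b = 0"
  proof (rule ccontr)
    assume "b \<noteq> 0"
    then show False using assms(1)[of "- (a + 1) / (2 * b)"] True by (simp add: field_simps)
  qed
  then show ?thesis using True by simp
next
  case False
  then have "c > 0" using assms(2) by simp
  then show ?thesis using assms(1)[of "- b / c"] by (simp add: field_simps power2_eq_square)
qed

context markov_diffusion_triple
begin

abbreviation \<Gamma> :: "('a \<Rightarrow> real) \<Rightarrow> ('a \<Rightarrow> real) \<Rightarrow> 'a \<Rightarrow> real"
  where "\<Gamma> \<equiv> carre_du_champ L"

lemma S_scale: "f \<in> S \<Longrightarrow> (\<lambda>x. c * f x) \<in> S"
  by (intro S_mult S_const)

lemma S_minus: "f \<in> S \<Longrightarrow> (\<lambda>x. - f x) \<in> S"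
  using S_scale[of f "-1"] by simp

lemma S_diff: "f \<in> S \<Longrightarrow> g \<in> S \<Longrightarrow> (\<lambda>x. f x - g x) \<in> S"
  using S_add[OF _ S_minus, of f g] by simp

lemma S_divide: "f \<in> S \<Longrightarrow> (\<lambda>x. f x / c) \<in> S"
  using S_scale[of f "inverse c"] by (simp add: divide_inverse mult.commute)

lemma S_elementary: "elementary \<phi> \<Longrightarrow> f \<in> S \<Longrightarrow> (\<lambda>x. \<phi> (f x)) \<in> S"
  by (rule S_smooth[OF elementary_smooth_real])

lemma \<Gamma>_S: "f \<in> S \<Longrightarrow> g \<in> S \<Longrightarrow> \<Gamma> f g \<in> S"
  unfolding carre_du_champ_def by (intro S_divide S_diff S_mult L_S)

lemmas S_closed = S_const S_add S_mult S_diff S_minus S_divide L_S \<Gamma>_S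

lemma L_const: "L (\<lambda>_. c) = (\<lambda>_. 0)"
proof
  fix x
  have "smooth_real (\<lambda>_. c)" by (intro elementary_smooth_real elementary.const)
  from diffusion[OF this S_const[of 0], of x] show "L (\<lambda>_. c) x = 0"
    by (simp add: deriv_const[abs_def])
qed

lemma L_minus: "f \<in> S \<Longrightarrow> L (\<lambda>x. - f x) = (\<lambda>x. - L f x)"
  using L_scale[of f "-1"] by simp

lemma L_diff: "f \<in> S \<Longrightarrow> g \<in> S \<Longrightarrow> L (\<lambda>x. f x - g x) = (\<lambda>x. L f x - L g x)"
  using L_add[OF _ S_minus, of f g] L_minus[of g] by simp

lemma L_mult: "f \<in> S \<Longrightarrow> g \<in> S \<Longrightarrow>
    L (\<lambda>x. f x * g x) = (\<lambda>x. f x * L g x + g x * L f x + 2 * \<Gamma> f g x)"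
  by (intro ext) (simp add: carre_du_champ_def field_simps)

lemma \<Gamma>_commute: "\<Gamma> f g = \<Gamma> g f"
  by (auto simp: carre_du_champ_def mult.commute)

lemma \<Gamma>_add_left:
  assumes "f \<in> S" "g \<in> S" "h \<in> S"
  shows "\<Gamma> (\<lambda>x. f x + g x) h = (\<lambda>x. \<Gamma> f h x + \<Gamma> g h x)"
proof -
  have "L (\<lambda>y. (f y + g y) * h y) = (\<lambda>x. L (\<lambda>y. f y * h y) x + L (\<lambda>y. g y * h y) x)"
    unfolding distrib_right by (intro L_add S_mult assms)
  then show ?thesis
    by (intro ext) (simp add: carre_du_champ_def L_add[OF assms(1,2)] field_simps)
qed

lemma \<Gamma>_scale_left:
  assumes "f \<in> S" "h \<in> S"
  shows "\<Gamma> (\<lambda>x. c * f x) h = (\<lambda>x. c * \<Gamma> f h x)"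
proof -
  have "L (\<lambda>y. c * f y * h y) = (\<lambda>x. c * L (\<lambda>y. f y * h y) x)"
    unfolding mult.assoc by (intro L_scale S_mult assms)
  then show ?thesis
    by (intro ext) (simp add: carre_du_champ_def L_scale[OF assms(1)] field_simps)
qed

lemma \<Gamma>_minus_left: "f \<in> S \<Longrightarrow> h \<in> S \<Longrightarrow> \<Gamma> (\<lambda>x. - f x) h = (\<lambda>x. - \<Gamma> f h x)"
  using \<Gamma>_scale_left[of f h "-1"] by simp

lemma \<Gamma>_diff_left: "f \<in> S \<Longrightarrow> g \<in> S \<Longrightarrow> h \<in> S \<Longrightarrow>
    \<Gamma> (\<lambda>x. f x - g x) h = (\<lambda>x. \<Gamma> f h x - \<Gamma> g h x)"
  using \<Gamma>_add_left[OF _ S_minus, of f g h] \<Gamma>_minus_left[of g h] by simp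

lemma \<Gamma>_const_left: "h \<in> S \<Longrightarrow> \<Gamma> (\<lambda>_. c) h = (\<lambda>_. 0)"
  by (auto simp: carre_du_champ_def L_const L_scale)

lemma \<Gamma>_const_right: "h \<in> S \<Longrightarrow> \<Gamma> h (\<lambda>_. c) = (\<lambda>_. 0)"
  unfolding \<Gamma>_commute[of h] by (rule \<Gamma>_const_left)

lemma \<Gamma>_add_right: "f \<in> S \<Longrightarrow> g \<in> S \<Longrightarrow> h \<in> S \<Longrightarrow>
    \<Gamma> h (\<lambda>x. f x + g x) = (\<lambda>x. \<Gamma> h f x + \<Gamma> h g x)"
  unfolding \<Gamma>_commute[of h] by (rule \<Gamma>_add_left)

lemma \<Gamma>_diff_right: "f \<in> S \<Longrightarrow> g \<in> S \<Longrightarrow> h \<in> S \<Longrightarrow>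
    \<Gamma> h (\<lambda>x. f x - g x) = (\<lambda>x. \<Gamma> h f x - \<Gamma> h g x)"
  unfolding \<Gamma>_commute[of h] by (rule \<Gamma>_diff_left)

lemma \<Gamma>_scale_right: "f \<in> S \<Longrightarrow> h \<in> S \<Longrightarrow> \<Gamma> h (\<lambda>x. c * f x) = (\<lambda>x. c * \<Gamma> h f x)"
  unfolding \<Gamma>_commute[of h] by (rule \<Gamma>_scale_left)

lemma \<Gamma>_minus_right: "f \<in> S \<Longrightarrow> h \<in> S \<Longrightarrow> \<Gamma> h (\<lambda>x. - f x) = (\<lambda>x. - \<Gamma> h f x)"
  unfolding \<Gamma>_commute[of h] by (rule \<Gamma>_minus_left)

lemmas \<Gamma>_linear = \<Gamma>_add_left \<Gamma>_add_right \<Gamma>_diff_left \<Gamma>_diff_right \<Gamma>_scale_left \<Gamma>_scale_right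
  \<Gamma>_minus_left \<Gamma>_minus_right \<Gamma>_const_left \<Gamma>_const_right

lemma L_cube:
  assumes "f \<in> S"
  shows "L (\<lambda>y. f y ^ 3) x = 3 * (f x)\<^sup>2 * L f x + 6 * f x * \<Gamma> f f x"
proof -
  have "elementary (\<lambda>r::real. r * (r * r))" by (intro elementary.intros)
  then have "smooth_real (\<lambda>r. r ^ 3)"
    by (simp add: power3_eq_cube mult.assoc elementary_smooth_real)
  moreover have d1: "deriv (\<lambda>r::real. r ^ 3) = (\<lambda>r. 3 * r\<^sup>2)"
    by (intro ext DERIV_imp_deriv) (auto intro!: derivative_eq_intros)
  moreover have "deriv (\<lambda>r::real. 3 * r\<^sup>2) = (\<lambda>r. 6 * r)"
    by (intro ext DERIV_imp_deriv) (auto intro!: derivative_eq_intros)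
  ultimately show ?thesis using diffusion[OF _ assms, of "\<lambda>r. r ^ 3" x] by simp
qed

text \<open>
  Polarization of \<open>L_cube\<close>.  It expresses that \<open>L\<close> is a second-order operator without zeroth-order
  term, from which the Leibniz rule for \<open>\<Gamma>\<close> follows.
\<close>

lemma L_triple_product:
  assumes S: "f \<in> S" "g \<in> S" "h \<in> S"
  shows "L (\<lambda>y. f y * g y * h y) x = f x * g x * L h x + f x * h x * L g x + g x * h x * L f x
    + 2 * (f x * \<Gamma> g h x + g x * \<Gamma> f h x + h x * \<Gamma> f g x)"
proof -
  have cube: "k \<in> S \<Longrightarrow> (\<lambda>y. k y ^ 3) \<in> S" for k
    by (simp add: power3_eq_cube S_closed)
  have polar: "(\<lambda>y. 6 * (f y * g y * h y)) = (\<lambda>y. ((f y + g y + h y) ^ 3 - (f y + g y) ^ 3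
      - (g y + h y) ^ 3) - (f y + h y) ^ 3 + (f y ^ 3 + (g y ^ 3 + h y ^ 3)))"
    by (auto simp: power3_eq_cube algebra_simps)
  have "6 * L (\<lambda>y. f y * g y * h y) x = L (\<lambda>y. 6 * (f y * g y * h y)) x"
    using S by (simp add: L_scale S_closed)
  then have "6 * L (\<lambda>y. f y * g y * h y) x
    = L (\<lambda>y. (f y + g y + h y) ^ 3) x - L (\<lambda>y. (f y + g y) ^ 3) x
      - L (\<lambda>y. (g y + h y) ^ 3) x - L (\<lambda>y. (f y + h y) ^ 3) x
      + (L (\<lambda>y. f y ^ 3) x + (L (\<lambda>y. g y ^ 3) x + L (\<lambda>y. h y ^ 3) x))"
    unfolding polar using S by (simp add: L_add L_diff cube S_closed)
  moreover have "L (\<lambda>y. (f y + g y) ^ 3) x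
    = 3 * (f x + g x)\<^sup>2 * (L f x + L g x) + 6 * (f x + g x) * (\<Gamma> f f x + 2 * \<Gamma> f g x + \<Gamma> g g x)"
    if "f \<in> S" "g \<in> S" for f g
    using that \<Gamma>_commute[of g f] by (simp add: L_cube S_closed L_add \<Gamma>_linear)
  note this[OF S(1,2)] this[OF S(2,3)] this[OF S(1,3)]
  moreover have "L (\<lambda>y. (f y + g y + h y) ^ 3) x
    = 3 * (f x + g x + h x)\<^sup>2 * (L f x + L g x + L h x) + 6 * (f x + g x + h x)
      * (\<Gamma> f f x + \<Gamma> g g x + \<Gamma> h h x + 2 * (\<Gamma> f g x + \<Gamma> f h x + \<Gamma> g h x))"
    using S \<Gamma>_commute[of g f] \<Gamma>_commute[of h f] \<Gamma>_commute[of h g]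
    by (simp add: L_cube S_closed L_add \<Gamma>_linear)
  ultimately show ?thesis
    using L_cube[OF S(1), of x] L_cube[OF S(2), of x] L_cube[OF S(3), of x]
    by (simp only: power2_eq_square) (simp add: algebra_simps)
qed

lemma \<Gamma>_mult_left:
  assumes S: "f \<in> S" "g \<in> S" "h \<in> S"
  shows "\<Gamma> (\<lambda>x. f x * g x) h = (\<lambda>x. f x * \<Gamma> g h x + g x * \<Gamma> f h x)"
proof
  fix x
  have "\<Gamma> (\<lambda>x. f x * g x) h x
      = (L (\<lambda>y. f y * g y * h y) x - f x * g x * L h x - h x * L (\<lambda>x. f x * g x) x) / 2"
    by (simp add: carre_du_champ_def)
  then show "\<Gamma> (\<lambda>x. f x * g x) h x = f x * \<Gamma> g h x + g x * \<Gamma> f h x"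
    unfolding L_triple_product[OF S] L_mult[OF S(1,2)] by (simp add: field_simps)
qed

lemma \<Gamma>_mult_right: "f \<in> S \<Longrightarrow> g \<in> S \<Longrightarrow> h \<in> S \<Longrightarrow>
    \<Gamma> h (\<lambda>x. f x * g x) = (\<lambda>x. f x * \<Gamma> h g x + g x * \<Gamma> h f x)"
  unfolding \<Gamma>_commute[of h] by (rule \<Gamma>_mult_left)

lemma \<Gamma>_quadratic:
  assumes S: "f \<in> S" "g \<in> S"
  shows "0 \<le> a\<^sup>2 * \<Gamma> f f x + 2 * (a * b * \<Gamma> f g x) + b\<^sup>2 * \<Gamma> g g x"
proof -
  have "0 \<le> \<Gamma> (\<lambda>x. a * f x + b * g x) (\<lambda>x. a * f x + b * g x) x"
    using S by (intro carre_nonneg S_add S_scale)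
  then show ?thesis
    using S \<Gamma>_commute[of g f]
    by (simp add: \<Gamma>_linear S_closed power2_eq_square algebra_simps)
qed

lemma \<Gamma>_Cauchy_Schwarz:
  assumes S: "f \<in> S" "g \<in> S"
  shows "(\<Gamma> f g x)\<^sup>2 \<le> \<Gamma> f f x * \<Gamma> g g x"
proof (rule nonneg_quadratic_discriminant)
  show "0 \<le> \<Gamma> f f x + 2 * \<Gamma> f g x * r + \<Gamma> g g x * r\<^sup>2" for r
    using \<Gamma>_quadratic[OF S, of 1 x r] by (simp add: mult_ac)
qed (rule carre_nonneg[OF S(2)])

lemma abs_\<Gamma>_le_sqrt: "f \<in> S \<Longrightarrow> g \<in> S \<Longrightarrow> \<bar>\<Gamma> f g x\<bar> \<le> sqrt (\<Gamma> f f x) * sqrt (\<Gamma> g g x)"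
  using real_sqrt_le_mono[OF \<Gamma>_Cauchy_Schwarz[of f g x]] by (simp add: real_sqrt_mult)

lemma abs_\<Gamma>_le: "f \<in> S \<Longrightarrow> g \<in> S \<Longrightarrow> \<bar>\<Gamma> f g x\<bar> \<le> (\<Gamma> f f x + \<Gamma> g g x) / 2"
  using \<Gamma>_quadratic[of f g 1 x 1] \<Gamma>_quadratic[of f g 1 x "-1"] by (simp add: abs_le_iff)

text \<open>
  Replacing \<open>\<phi>\<close> by \<open>\<psi> r = \<phi> r - \<phi>'(f(x)) r\<close> reduces the claim to a vanishing derivative at \<open>f(x)\<close>.
  Then \<open>\<Gamma>(\<psi>(f))\<close> vanishes at \<open>x\<close>, by the diffusion property for \<open>\<psi>\<close> and \<open>\<psi>^2\<close>, and the
  Cauchy--Schwarz inequality for \<open>\<Gamma>\<close> finishes the proof.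
\<close>

lemma \<Gamma>_chain:
  assumes \<phi>: "elementary \<phi>" and S: "f \<in> S" "g \<in> S"
  shows "\<Gamma> (\<lambda>y. \<phi> (f y)) g x = deriv \<phi> (f x) * \<Gamma> f g x"
proof -
  define c where "c = deriv \<phi> (f x)"
  define \<psi> where "\<psi> = (\<lambda>r. \<phi> r + (- c) * r)"
  have el: "elementary \<psi>" unfolding \<psi>_def by (intro elementary.intros \<phi>)
  have d1: "deriv \<psi> = (\<lambda>r. deriv \<phi> r - c)"
    unfolding \<psi>_def by (intro ext DERIV_imp_deriv) (auto intro!: derivative_eq_intros elementary_DERIV[OF \<phi>])
  have dsq: "deriv (\<lambda>r. \<psi> r * \<psi> r) = (\<lambda>r. 2 * (\<psi> r * deriv \<psi> r))"
    by (intro ext DERIV_imp_deriv)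
       (auto intro!: derivative_eq_intros elementary_DERIV[OF el] simp: mult.commute)
  have d2: "deriv (\<lambda>r. 2 * (\<psi> r * deriv \<psi> r))
      = (\<lambda>r. 2 * (deriv \<psi> r * deriv \<psi> r + \<psi> r * deriv (deriv \<psi>) r))"
    using elementary_DERIV[OF elementary_deriv[OF el]]
    by (intro ext DERIV_imp_deriv)
       (auto intro!: derivative_eq_intros elementary_DERIV[OF el] simp: algebra_simps)
  have \<psi>S: "(\<lambda>y. \<psi> (f y)) \<in> S" by (rule S_elementary[OF el S(1)])
  have sq: "smooth_real (\<lambda>r. \<psi> r * \<psi> r)" by (intro elementary_smooth_real elementary.mult el)
  have "deriv \<psi> (f x) = 0" by (simp add: d1 c_def)
  then have "L (\<lambda>y. \<psi> (f y) * \<psi> (f y)) x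
      = 2 * (\<psi> (f x) * (deriv \<psi> (f x) * L f x + deriv (deriv \<psi>) (f x) * \<Gamma> f f x))"
    using diffusion[OF sq S(1), of x] unfolding dsq d2 by (simp add: algebra_simps)
  then have "L (\<lambda>y. \<psi> (f y) * \<psi> (f y)) x = 2 * (\<psi> (f x) * L (\<lambda>y. \<psi> (f y)) x)"
    using diffusion[OF elementary_smooth_real[OF el] S(1), of x] by simp
  then have "\<Gamma> (\<lambda>y. \<psi> (f y)) (\<lambda>y. \<psi> (f y)) x = 0"
    by (simp add: carre_du_champ_def)
  then have "(\<Gamma> (\<lambda>y. \<psi> (f y)) g x)\<^sup>2 \<le> 0"
    using \<Gamma>_Cauchy_Schwarz[OF \<psi>S S(2), of x] by simp
  moreover have "\<Gamma> (\<lambda>y. \<psi> (f y)) g x = \<Gamma> (\<lambda>y. \<phi> (f y)) g x + (- c) * \<Gamma> f g x"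
    unfolding \<psi>_def using S S_elementary[OF \<phi> S(1)] by (simp only: \<Gamma>_add_left \<Gamma>_scale_left S_scale)
  ultimately show ?thesis by (simp add: c_def)
qed

lemma bounded_algebraI: "f \<in> S \<Longrightarrow> (\<And>x. \<bar>f x\<bar> \<le> C) \<Longrightarrow> f \<in> bounded_algebra S"
  unfolding bounded_algebra_def by (auto intro!: boundedI)

lemma bounded_algebraE:
  assumes "f \<in> bounded_algebra S"
  obtains C where "f \<in> S" "C \<ge> 0" "\<And>x. \<bar>f x\<bar> \<le> C"
proof -
  have "f \<in> S" "bounded (range f)" using assms by (auto simp: bounded_algebra_def)
  then obtain C where "\<And>x. \<bar>f x\<bar> \<le> C" by (auto simp: bounded_iff)
  then show ?thesis using that[of C] \<open>f \<in> S\<close> by (meson abs_ge_zero order_trans)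
qed

lemma \<Gamma>2_S: "f \<in> S \<Longrightarrow> Gamma2 L f \<in> S"
  unfolding Gamma2_def by (intro S_closed)

text \<open>
  The curvature condition is applied to \<open>f + r a g\<close> with \<open>a = f - f(x)\<close> and a function \<open>g\<close> that
  vanishes at \<open>x\<close> and has there the same first-order behaviour as \<open>\<Gamma>(f)\<close>.  The perturbation changes
  the Hessian of \<open>f\<close> at \<open>x\<close> but not its gradient.  At \<open>x\<close> one gets a quadratic polynomial in
  \<open>r\<close> that is nonnegative, with constant term \<open>\<Gamma>_2(f) - \<rho> \<Gamma>(f)\<close>, linear coefficient
  \<open>2 \<Gamma>(\<Gamma>(f), g) = 2 \<Gamma>(\<Gamma>(f))\<close> and quadratic coefficient
  \<open>2 \<Gamma>(f) \<Gamma>(g) + 2 \<Gamma>(f, g)^2 \<le> 4 \<Gamma>(f) \<Gamma>(\<Gamma>(f))\<close>; its discriminant is the claim.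
\<close>

lemma curvature_improved:
  assumes CD: "curvature_dimension S L \<rho> n" and "n > 0" and f: "f \<in> bounded_algebra S"
  shows "\<Gamma> (\<Gamma> f f) (\<Gamma> f f) x \<le> 4 * \<Gamma> f f x * (Gamma2 L f x - \<rho> * \<Gamma> f f x)"
proof -
  obtain C where fS: "f \<in> S" and C: "C \<ge> 0" "\<And>x. \<bar>f x\<bar> \<le> C" by (rule bounded_algebraE[OF f]) blast
  define G where "G = \<Gamma> f f"
  define N where "N = Gamma2 L f x - \<rho> * G x"
  define a where "a = (\<lambda>y. f y - f x)"
  \<comment> \<open>the sine keeps the perturbed function bounded, as \<open>\<Gamma>(f)\<close> itself need not be\<close>
  define g where "g = (\<lambda>y. sin (G y + - G x))"
  define q where "q = (\<lambda>y. a y * g y)"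
  have G: "G \<in> S" unfolding G_def by (intro \<Gamma>_S fS)
  have a: "a \<in> S" unfolding a_def by (intro S_closed fS)
  have el: "elementary (\<lambda>r. sin (r + - G x))" by (intro elementary.intros)
  have g: "g \<in> S" unfolding g_def using S_elementary[OF el G] .
  have q: "q \<in> S" unfolding q_def by (intro S_closed a g)
  have g_chain: "\<Gamma> g h x = \<Gamma> G h x" if "h \<in> S" for h
  proof -
    have "deriv (\<lambda>r. sin (r + - G x)) (G x) = 1"
      by (intro DERIV_imp_deriv) (auto intro!: derivative_eq_intros)
    then show ?thesis unfolding g_def using \<Gamma>_chain[OF el G that, of x] by simp
  qed
  have x0: "a x = 0" "g x = 0" by (auto simp: a_def g_def)
  have a_eq: "L a = L f" "\<And>h. h \<in> S \<Longrightarrow> \<Gamma> a h = \<Gamma> f h" "\<And>h. h \<in> S \<Longrightarrow> \<Gamma> h a = \<Gamma> h f"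
    unfolding a_def using fS by (simp_all add: L_diff L_const S_closed \<Gamma>_linear)
  have Lq: "L q = (\<lambda>y. a y * L g y + g y * L f y + 2 * \<Gamma> f g y)"
    unfolding q_def using a g fS by (simp add: L_mult a_eq)
  have q\<Gamma>: "\<Gamma> h q = (\<lambda>y. a y * \<Gamma> h g y + g y * \<Gamma> h f y)" if "h \<in> S" for h
    unfolding q_def using a g fS that by (simp add: \<Gamma>_mult_right a_eq)
  have q\<Gamma>': "\<Gamma> q h = (\<lambda>y. a y * \<Gamma> g h y + g y * \<Gamma> f h y)" if "h \<in> S" for h
    using q\<Gamma>[OF that] unfolding \<Gamma>_commute[of h] .
  have qq: "\<Gamma> q q = (\<lambda>y. a y * (a y * \<Gamma> g g y + g y * \<Gamma> f g y)
      + g y * (a y * \<Gamma> f g y + g y * G y))"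
    using q\<Gamma>[OF q] q\<Gamma>'[OF g] q\<Gamma>'[OF fS] \<Gamma>_commute[of g f] by (simp add: G_def)
  have cross: "(L (\<Gamma> f q) x - \<Gamma> f (L q) x - \<Gamma> q (L f) x) / 2 = \<Gamma> G g x"
    unfolding q\<Gamma>[OF fS] q\<Gamma>'[OF L_S[OF fS]] unfolding Lq
    using fS a g G \<Gamma>_commute[of f g] \<Gamma>_commute[of G g]
    by (simp add: L_add L_mult \<Gamma>_linear \<Gamma>_mult_right S_closed a_eq x0 G_def[symmetric])
  have "L (\<Gamma> q q) x = 4 * (G x * \<Gamma> g g x + (\<Gamma> f g x)\<^sup>2)"
    unfolding qq using fS a g G \<Gamma>_commute[of f g]
    by (simp add: L_add L_mult \<Gamma>_linear \<Gamma>_mult_right S_closed a_eq x0 G_def[symmetric]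
        power2_eq_square)
  moreover have "\<Gamma> q (L q) x = 0" using q\<Gamma>'[OF L_S[OF q]] x0 by simp
  ultimately have q2: "Gamma2 L q x = 2 * (G x * \<Gamma> g g x + (\<Gamma> f g x)\<^sup>2)"
    by (simp add: Gamma2_def)
  have quad: "0 \<le> N + 2 * \<Gamma> G g x * r + 2 * (G x * \<Gamma> g g x + (\<Gamma> f g x)\<^sup>2) * r\<^sup>2" for r
  proof -
    let ?u = "\<lambda>y. f y + r * q y"
    have "?u \<in> bounded_algebra S"
    proof (rule bounded_algebraI)
      show "?u \<in> S" by (intro S_add S_scale fS q)
      fix y
      have "\<bar>a y\<bar> \<le> 2 * C" using C(2)[of x] C(2)[of y] by (simp add: a_def)
      then have "\<bar>q y\<bar> \<le> 2 * C * 1"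
        unfolding q_def g_def abs_mult by (intro mult_mono) (auto simp: C)
      then have "\<bar>r * q y\<bar> \<le> \<bar>r\<bar> * (2 * C)" by (simp add: abs_mult mult_left_mono)
      then show "\<bar>?u y\<bar> \<le> C + \<bar>r\<bar> * (2 * C)" using C(2)[of y] by linarith
    qed
    then have "Gamma2 L ?u x \<ge> \<rho> * \<Gamma> ?u ?u x + 1 / n * (L ?u x)\<^sup>2"
      using CD by (auto simp: curvature_dimension_def)
    then have "0 \<le> Gamma2 L ?u x - \<rho> * \<Gamma> ?u ?u x"
      using \<open>n > 0\<close> by (smt (verit) divide_nonneg_pos zero_le_power2 mult_nonneg_nonneg)
    moreover have "\<Gamma> ?u ?u x = G x"
      using fS q g a x0 by (simp add: \<Gamma>_linear S_closed q\<Gamma> q\<Gamma>' G_def)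
    moreover have "Gamma2 L ?u x = Gamma2 L f x
        + 2 * r * ((L (\<Gamma> f q) x - \<Gamma> f (L q) x - \<Gamma> q (L f) x) / 2) + r\<^sup>2 * Gamma2 L q x"
      using fS q \<Gamma>_commute[of q f]
      by (simp add: Gamma2_def \<Gamma>_linear L_add L_scale S_closed)
         (simp add: field_simps power2_eq_square)
    ultimately show ?thesis unfolding cross q2 N_def by (simp add: algebra_simps)
  qed
  have G0: "G x \<ge> 0" "\<Gamma> g g x \<ge> 0" "N \<ge> 0"
    using carre_nonneg fS g quad[of 0] by (auto simp: G_def)
  have "(\<Gamma> G g x)\<^sup>2 \<le> N * (2 * (G x * \<Gamma> g g x + (\<Gamma> f g x)\<^sup>2))"
    by (rule nonneg_quadratic_discriminant[OF quad]) (use G0 in auto)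
  also have "\<dots> \<le> N * (2 * (G x * \<Gamma> g g x + G x * \<Gamma> g g x))"
    using \<Gamma>_Cauchy_Schwarz[OF fS g, of x] G0
    by (intro mult_left_mono add_left_mono) (auto simp: G_def)
  finally have "(\<Gamma> G g x)\<^sup>2 \<le> 4 * G x * N * \<Gamma> g g x" by (simp add: algebra_simps)
  moreover have "\<Gamma> G g x = \<Gamma> G G x" "\<Gamma> g g x = \<Gamma> G G x"
    using g_chain[OF G] g_chain[OF g] \<Gamma>_commute[of G g] by auto
  ultimately have "\<Gamma> G G x * \<Gamma> G G x \<le> 4 * G x * N * \<Gamma> G G x" by (simp add: power2_eq_square)
  moreover have "\<Gamma> G G x \<ge> 0" "0 \<le> 4 * G x * N" using carre_nonneg[OF G] G0 by auto
  ultimately have "\<Gamma> G G x \<le> 4 * G x * N"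
    by (cases "\<Gamma> G G x = 0") (auto simp: mult_le_cancel_right)
  then show ?thesis unfolding N_def G_def .
qed

end

section \<open>The Markov semigroup on bounded functions\<close>

lemma integrable_bounded_mult:
  fixes f g :: "'a \<Rightarrow> real"
  assumes "f \<in> borel_measurable M" "\<And>x. \<bar>f x\<bar> \<le> C" "integrable M g"
  shows "integrable M (\<lambda>x. f x * g x)"
proof (rule Bochner_Integration.integrable_bound)
  show "integrable M (\<lambda>x. C * g x)" using assms(3) by simp
  show "(\<lambda>x. f x * g x) \<in> borel_measurable M" using assms by measurable
  show "AE x in M. norm (f x * g x) \<le> norm (C * g x)"
    using assms(2) by (auto simp: abs_mult intro!: mult_right_mono order_trans[OF assms(2) abs_ge_self])
qed

lemma integral_Cauchy_Schwarz:
  fixes a b :: "'a \<Rightarrow> real"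
  assumes "integrable M (\<lambda>x. (a x)\<^sup>2)" "integrable M (\<lambda>x. (b x)\<^sup>2)" "integrable M (\<lambda>x. a x * b x)"
  shows "\<bar>\<integral>x. a x * b x \<partial>M\<bar> \<le> sqrt (\<integral>x. (a x)\<^sup>2 \<partial>M) * sqrt (\<integral>x. (b x)\<^sup>2 \<partial>M)"
proof -
  have "(\<integral>x. a x * b x \<partial>M)\<^sup>2 \<le> (\<integral>x. (a x)\<^sup>2 \<partial>M) * (\<integral>x. (b x)\<^sup>2 \<partial>M)"
  proof (rule nonneg_quadratic_discriminant)
    fix r
    have "0 \<le> (\<integral>x. (a x + r * b x)\<^sup>2 \<partial>M)" by simp
    also have "(\<integral>x. (a x + r * b x)\<^sup>2 \<partial>M) = (\<integral>x. (a x)\<^sup>2 + (2 * r) * (a x * b x) + r\<^sup>2 * (b x)\<^sup>2 \<partial>M)"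
      by (intro Bochner_Integration.integral_cong) (auto simp: power2_eq_square algebra_simps)
    also have "\<dots> = (\<integral>x. (a x)\<^sup>2 \<partial>M) + (2 * r) * (\<integral>x. a x * b x \<partial>M) + r\<^sup>2 * (\<integral>x. (b x)\<^sup>2 \<partial>M)"
      using assms by simp
    finally show "0 \<le> (\<integral>x. (a x)\<^sup>2 \<partial>M) + 2 * (\<integral>x. a x * b x \<partial>M) * r + (\<integral>x. (b x)\<^sup>2 \<partial>M) * r\<^sup>2"
      by (simp add: algebra_simps)
  qed simp
  then have "sqrt ((\<integral>x. a x * b x \<partial>M)\<^sup>2) \<le> sqrt ((\<integral>x. (a x)\<^sup>2 \<partial>M) * (\<integral>x. (b x)\<^sup>2 \<partial>M))"
    by (rule real_sqrt_le_mono)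
  then show ?thesis by (simp add: real_sqrt_mult)
qed

context markov_diffusion_triple
begin

abbreviation P :: "real \<Rightarrow> ('a \<Rightarrow> real) \<Rightarrow> 'a \<Rightarrow> real"
  where "P \<equiv> semigroup_op p"

lemma kernel_subprob: "t \<ge> 0 \<Longrightarrow> p t \<in> M \<rightarrow>\<^sub>M subprob_algebra M"
  by (intro measurable_prob_algebraD kernel)

lemma kernel_prob:
  assumes "t \<ge> 0" shows "prob_space (p t x)" "sets (p t x) = sets M"
proof -
  have "p t x \<in> space (prob_algebra M)"
    using measurable_space[OF kernel[OF assms], of x] by (simp add: space_UNIV)
  then show "prob_space (p t x)" "sets (p t x) = sets M" by (auto simp: space_prob_algebra)
qed

lemma kernel_measurable:
  "t \<ge> 0 \<Longrightarrow> f \<in> borel_measurable M \<Longrightarrow> f \<in> borel_measurable (p t x)"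
  by (simp add: measurable_cong_sets[OF kernel_prob(2) refl])

lemma kernel_integrable:
  fixes f :: "'a \<Rightarrow> real"
  assumes "t \<ge> 0" "f \<in> borel_measurable M" "\<And>x. \<bar>f x\<bar> \<le> C"
  shows "integrable (p t x) f"
proof -
  interpret prob_space "p t x" by (rule kernel_prob[OF assms(1)])
  show ?thesis using assms kernel_measurable by (intro integrable_const_bound[of _ C]) auto
qed

lemma P_measurable: "t \<ge> 0 \<Longrightarrow> f \<in> borel_measurable M \<Longrightarrow> P t f \<in> borel_measurable M"
  unfolding semigroup_op_def
  by (rule measurable_compose[OF kernel_subprob integral_measurable_subprob_algebra])

lemma P_ge:
  assumes "t \<ge> 0" "f \<in> borel_measurable M" "\<And>x. \<bar>f x\<bar> \<le> C" "\<And>x. c \<le> f x"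
  shows "c \<le> P t f x"
proof -
  interpret prob_space "p t x" by (rule kernel_prob[OF assms(1)])
  show ?thesis unfolding semigroup_op_def
    using assms by (intro integral_ge_const kernel_integrable[of t f C]) auto
qed

lemma P_bound:
  assumes "t \<ge> 0" "f \<in> borel_measurable M" "\<And>x. \<bar>f x\<bar> \<le> C"
  shows "\<bar>P t f x\<bar> \<le> C"
proof -
  interpret prob_space "p t x" by (rule kernel_prob[OF assms(1)])
  have "P t f x \<le> C" unfolding semigroup_op_def
    using assms(3) by (intro integral_le_const kernel_integrable[OF assms]) (auto simp: abs_le_iff)
  moreover have "- C \<le> P t f x"
    using assms(3) by (intro P_ge[OF assms]) (auto simp: abs_le_iff minus_le_iff)
  ultimately show ?thesis by simp
qed

lemma P_pos:
  assumes "t \<ge> 0" "f \<in> borel_measurable M" "\<And>x. \<bar>f x\<bar> \<le> C" "\<And>x. 0 < f x"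
  shows "0 < P t f x"
proof -
  interpret prob_space "p t x" by (rule kernel_prob[OF assms(1)])
  have int: "integrable (p t x) f" by (rule kernel_integrable[OF assms(1-3)])
  have "P t f x \<noteq> 0"
  proof
    assume "P t f x = 0"
    then have "AE y in p t x. f y = 0"
      using integral_nonneg_eq_0_iff_AE[OF int] assms(4) by (simp add: semigroup_op_def less_imp_le)
    then have "AE y in p t x. False"
      by (rule eventually_mono) (use assms(4) in \<open>metis less_irrefl\<close>)
    then show False by (simp only: AE_False)
  qed
  moreover have "0 \<le> P t f x" using assms(4) by (intro P_ge[OF assms(1-3)] less_imp_le)
  ultimately show ?thesis by simp
qed

lemma P_const: "t \<ge> 0 \<Longrightarrow> P t (\<lambda>_. c) = (\<lambda>_. c)"
  by (auto simp: semigroup_op_def prob_space.prob_space[OF kernel_prob(1)] prob_space.emeasure_space_1)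

lemma P_add:
  assumes "t \<ge> 0" "f \<in> borel_measurable M" "\<And>x. \<bar>f x\<bar> \<le> C" "g \<in> borel_measurable M" "\<And>x. \<bar>g x\<bar> \<le> D"
  shows "P t (\<lambda>x. f x + g x) x = P t f x + P t g x"
  unfolding semigroup_op_def
  by (intro Bochner_Integration.integral_add kernel_integrable[OF assms(1-3)]
      kernel_integrable[OF assms(1,4,5)])

lemma P_diff:
  assumes "t \<ge> 0" "f \<in> borel_measurable M" "\<And>x. \<bar>f x\<bar> \<le> C" "g \<in> borel_measurable M" "\<And>x. \<bar>g x\<bar> \<le> D"
  shows "P t (\<lambda>x. f x - g x) x = P t f x - P t g x"
  unfolding semigroup_op_def
  by (intro Bochner_Integration.integral_diff kernel_integrable[OF assms(1-3)]
      kernel_integrable[OF assms(1,4,5)])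

lemma P_0: "f \<in> borel_measurable M \<Longrightarrow> P 0 f = f"
  by (auto simp: semigroup_op_def kernel_0 integral_return space_UNIV)

lemma P_comp:
  assumes "s \<ge> 0" "t \<ge> 0" "f \<in> borel_measurable M" "\<And>x. \<bar>f x\<bar> \<le> C"
  shows "P (s + t) f = P s (P t f)"
proof
  fix x
  interpret s: prob_space "p s x" by (rule kernel_prob[OF assms(1)])
  have "integral\<^sup>L (p s x \<bind> p t) f = (\<integral>y. integral\<^sup>L (p t y) f \<partial>(p s x))"
  proof (rule integral_bind[where B = C and K = M and B' = 1])
    show "p t \<in> p s x \<rightarrow>\<^sub>M subprob_algebra M"
      using kernel_subprob[OF assms(2)] by (simp add: measurable_cong_sets[OF kernel_prob(2)[OF assms(1)] refl])
    show "AE y in p s x. emeasure (p t y) (space (p t y)) \<le> ennreal 1"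
      using prob_space.emeasure_space_1[OF kernel_prob(1)[OF assms(2)]] by simp
    show "finite_measure (p s x)" by unfold_locales
  qed (use assms in auto)
  then show "P (s + t) f x = P s (P t f) x"
    by (simp add: semigroup_op_def chapman_kolmogorov[OF assms(1,2)])
qed

lemma nn_kernel_measurable:
  fixes f :: "'a \<Rightarrow> ennreal"
  shows "t \<ge> 0 \<Longrightarrow> f \<in> borel_measurable M \<Longrightarrow> (\<lambda>x. \<integral>\<^sup>+y. f y \<partial>(p t x)) \<in> borel_measurable M"
  by (rule measurable_compose[OF kernel_subprob nn_integral_measurable_subprob_algebra])

text \<open>
  The symmetry of the kernel extends from sets to nonnegative functions one argument at a time.
\<close>

lemma nn_reversible_extend:
  fixes f g :: "'a \<Rightarrow> ennreal"
  assumes t: "t \<ge> 0" and f: "f \<in> borel_measurable M" and g [measurable]: "g \<in> borel_measurable M"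
    and sets: "\<And>B. B \<in> sets M \<Longrightarrow>
      (\<integral>\<^sup>+x. (\<integral>\<^sup>+y. g y \<partial>(p t x)) * indicator B x \<partial>M) = (\<integral>\<^sup>+x. emeasure (p t x) B * g x \<partial>M)"
  shows "(\<integral>\<^sup>+x. (\<integral>\<^sup>+y. g y \<partial>(p t x)) * f x \<partial>M) = (\<integral>\<^sup>+x. (\<integral>\<^sup>+y. f y \<partial>(p t x)) * g x \<partial>M)"
proof -
  note [measurable] = nn_kernel_measurable[OF t]
  note km = kernel_measurable[OF t]
  show ?thesis using f
  proof (induction rule: borel_measurable_induct)
    case (cong f g)
    then have "f = g" by (auto simp: space_UNIV)
    then show ?case using cong by simp
  next
    case (set A)
    then show ?case using sets[OF set] by (simp add: kernel_prob(2)[OF t])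
  next
    case (mult u c)
    then show ?case
      by (simp add: nn_integral_cmult km mult.assoc mult.left_commute[of _ c])
  next
    case (add u v)
    then show ?case
      by (simp add: nn_integral_add km distrib_right distrib_left)
  next
    case (seq U)
    have U [measurable]: "U i \<in> borel_measurable M" for i by (rule seq)
    have Uinc: "incseq U" by (rule seq)
    have inc: "incseq (\<lambda>i x. \<integral>\<^sup>+y. U i y \<partial>(p t x))"
      by (auto simp: incseq_def le_fun_def intro!: nn_integral_mono le_funD[OF incseqD[OF Uinc]])
    have sup: "(\<integral>\<^sup>+y. (SUP i. U i) y \<partial>(p t x)) = (SUP i. \<integral>\<^sup>+y. U i y \<partial>(p t x))" for x
      unfolding SUP_apply using Uinc km[OF U] by (intro nn_integral_monotone_convergence_SUP) auto
    have "(\<integral>\<^sup>+x. (\<integral>\<^sup>+y. g y \<partial>(p t x)) * (SUP i. U i) x \<partial>M)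
        = (SUP i. \<integral>\<^sup>+x. (\<integral>\<^sup>+y. g y \<partial>(p t x)) * U i x \<partial>M)"
      unfolding SUP_apply SUP_mult_left_ennreal
      by (intro nn_integral_monotone_convergence_SUP)
         (use Uinc in \<open>auto simp: incseq_def le_fun_def intro!: mult_left_mono\<close>)
    also have "\<dots> = (SUP i. \<integral>\<^sup>+x. (\<integral>\<^sup>+y. U i y \<partial>(p t x)) * g x \<partial>M)"
      by (simp add: seq.IH)
    also have "\<dots> = (\<integral>\<^sup>+x. (\<integral>\<^sup>+y. (SUP i. U i) y \<partial>(p t x)) * g x \<partial>M)"
      unfolding sup SUP_mult_right_ennreal
      by (intro nn_integral_monotone_convergence_SUP[symmetric])
         (use inc in \<open>auto simp: incseq_def le_fun_def intro!: mult_right_mono\<close>)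
    finally show ?case .
  qed
qed

lemma nn_reversible:
  fixes f g :: "'a \<Rightarrow> ennreal"
  assumes t: "t \<ge> 0" and f: "f \<in> borel_measurable M" and g: "g \<in> borel_measurable M"
  shows "(\<integral>\<^sup>+x. (\<integral>\<^sup>+y. g y \<partial>(p t x)) * f x \<partial>M) = (\<integral>\<^sup>+x. (\<integral>\<^sup>+y. f y \<partial>(p t x)) * g x \<partial>M)"
proof (rule nn_reversible_extend[OF t f g])
  fix B assume B: "B \<in> sets M"
  have "(\<integral>\<^sup>+x. (\<integral>\<^sup>+y. indicator B y \<partial>(p t x)) * g x \<partial>M)
      = (\<integral>\<^sup>+x. (\<integral>\<^sup>+y. g y \<partial>(p t x)) * indicator B x \<partial>M)"
    by (rule nn_reversible_extend[OF t g]) (use B reversible[OF t B] in \<open>simp_all add: kernel_prob(2)[OF t]\<close>)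
  then show "(\<integral>\<^sup>+x. (\<integral>\<^sup>+y. g y \<partial>(p t x)) * indicator B x \<partial>M) = (\<integral>\<^sup>+x. emeasure (p t x) B * g x \<partial>M)"
    using B by (simp add: kernel_prob(2)[OF t])
qed

lemma ennreal_P:
  assumes "t \<ge> 0" "f \<in> borel_measurable M" "\<And>x. \<bar>f x\<bar> \<le> C" "\<And>x. 0 \<le> f x"
  shows "ennreal (P t f x) = (\<integral>\<^sup>+y. ennreal (f y) \<partial>(p t x))"
  unfolding semigroup_op_def using assms
  by (intro nn_integral_eq_integral[symmetric] kernel_integrable) auto

text \<open>
  Reversibility tested against the constant \<open>1\<close>: the mass of \<open>P_t \<bar>f\<bar>\<close> is that of \<open>\<bar>f\<bar>\<close>.
\<close>

lemma P_L1:
  assumes t: "t \<ge> 0" and f: "integrable M f" "\<And>x. \<bar>f x\<bar> \<le> C"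
  shows "integrable M (P t f)" "(\<integral>x. \<bar>P t f x\<bar> \<partial>M) \<le> (\<integral>x. \<bar>f x\<bar> \<partial>M)"
proof -
  have fm [measurable]: "f \<in> borel_measurable M" using f by auto
  note [measurable] = P_measurable[OF t fm]
  have "\<bar>P t f x\<bar> \<le> P t (\<lambda>x. \<bar>f x\<bar>) x" for x
    unfolding semigroup_op_def by (rule integral_abs_bound)
  then have "(\<integral>\<^sup>+x. ennreal \<bar>P t f x\<bar> \<partial>M) \<le> (\<integral>\<^sup>+x. (\<integral>\<^sup>+y. ennreal \<bar>f y\<bar> \<partial>(p t x)) * 1 \<partial>M)"
    using f(2) by (auto intro!: nn_integral_mono simp: ennreal_P[OF t, of "\<lambda>x. \<bar>f x\<bar>" C, symmetric] ennreal_leI)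
  also have "\<dots> = (\<integral>\<^sup>+x. (\<integral>\<^sup>+y. 1 \<partial>(p t x)) * ennreal \<bar>f x\<bar> \<partial>M)"
    by (rule nn_reversible[OF t]) auto
  also have "\<dots> = (\<integral>\<^sup>+x. ennreal \<bar>f x\<bar> \<partial>M)"
    by (simp add: prob_space.emeasure_space_1[OF kernel_prob(1)[OF t]])
  finally have le: "(\<integral>\<^sup>+x. ennreal \<bar>P t f x\<bar> \<partial>M) \<le> (\<integral>\<^sup>+x. ennreal \<bar>f x\<bar> \<partial>M)" .
  also have "\<dots> < \<infinity>" using f(1) by (simp add: integrable_iff_bounded)
  finally show int: "integrable M (P t f)" by (simp add: integrable_iff_bounded)
  have "ennreal (\<integral>x. \<bar>P t f x\<bar> \<partial>M) \<le> ennreal (\<integral>x. \<bar>f x\<bar> \<partial>M)"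
    using le int f(1) by (simp add: nn_integral_eq_integral)
  then show "(\<integral>x. \<bar>P t f x\<bar> \<partial>M) \<le> (\<integral>x. \<bar>f x\<bar> \<partial>M)" by (subst (asm) ennreal_le_iff) auto
qed

lemma P_symmetric_nonneg:
  assumes t: "t \<ge> 0" and f: "f \<in> borel_measurable M" "\<And>x. \<bar>f x\<bar> \<le> C" "\<And>x. 0 \<le> f x"
    and g: "integrable M g" "\<And>x. \<bar>g x\<bar> \<le> D" "\<And>x. 0 \<le> g x"
  shows "(\<integral>x. P t f x * g x \<partial>M) = (\<integral>x. f x * P t g x \<partial>M)"
proof -
  have gm: "g \<in> borel_measurable M" using g by auto
  note [measurable] = f(1) gm P_measurable[OF t]
  have Pf: "0 \<le> P t f x" and Pg: "0 \<le> P t g x" for x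
    using P_ge[OF t f(1,2)] P_ge[OF t gm g(2)] f(3) g(3) by auto
  have "(\<integral>\<^sup>+x. ennreal (P t f x * g x) \<partial>M) = (\<integral>\<^sup>+x. (\<integral>\<^sup>+y. ennreal (f y) \<partial>(p t x)) * ennreal (g x) \<partial>M)"
    by (simp add: ennreal_mult Pf g(3) ennreal_P[OF t f])
  also have "\<dots> = (\<integral>\<^sup>+x. (\<integral>\<^sup>+y. ennreal (g y) \<partial>(p t x)) * ennreal (f x) \<partial>M)"
    by (rule nn_reversible[OF t]) auto
  also have "\<dots> = (\<integral>\<^sup>+x. ennreal (f x * P t g x) \<partial>M)"
    by (simp add: ennreal_mult Pg f(3) ennreal_P[OF t gm g(2,3)] mult.commute)
  finally show ?thesis
    using Pf Pg f(3) g(3) by (simp add: integral_eq_nn_integral)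
qed

lemma P_symmetric:
  assumes t: "t \<ge> 0" and f: "f \<in> borel_measurable M" "\<And>x. \<bar>f x\<bar> \<le> C"
    and g: "integrable M g" "\<And>x. \<bar>g x\<bar> \<le> D"
  shows "(\<integral>x. P t f x * g x \<partial>M) = (\<integral>x. f x * P t g x \<partial>M)"
proof -
  have gm [measurable]: "g \<in> borel_measurable M" using g by auto
  note [measurable] = f(1)
  have C: "C \<ge> 0" using f(2) abs_ge_zero order_trans by blast
  have pos: "(\<integral>x. P t f x * h x \<partial>M) = (\<integral>x. f x * P t h x \<partial>M)"
    if h: "integrable M h" "\<And>x. \<bar>h x\<bar> \<le> D" "\<And>x. 0 \<le> h x" for h
  proof -
    have Pf: "integrable M (\<lambda>x. P t f x * h x)"
      by (rule integrable_bounded_mult[OF P_measurable[OF t f(1)] P_bound[OF t f] h(1)])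
    have Ph: "integrable M (P t h)" "integrable M (\<lambda>x. f x * P t h x)"
      using P_L1(1)[OF t h(1,2)] integrable_bounded_mult[OF f _] by auto
    have "(\<integral>x. P t (\<lambda>x. f x + C) x * h x \<partial>M) = (\<integral>x. (f x + C) * P t h x \<partial>M)"
    proof (rule P_symmetric_nonneg[OF t _ _ _ h])
      show "\<bar>f x + C\<bar> \<le> C + C" "0 \<le> f x + C" for x using f(2)[of x] C by (auto simp: abs_le_iff)
    qed auto
    moreover have "P t (\<lambda>x. f x + C) x = P t f x + C" for x
      using P_add[OF t f, of "\<lambda>_. C" "\<bar>C\<bar>"] by (simp add: P_const[OF t])
    moreover have "(\<integral>x. P t (\<lambda>_. 1) x * h x \<partial>M) = (\<integral>x. 1 * P t h x \<partial>M)"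
      by (rule P_symmetric_nonneg[OF t _ _ _ h, where C = 1]) auto
    then have "(\<integral>x. h x \<partial>M) = (\<integral>x. P t h x \<partial>M)" by (simp add: P_const[OF t])
    ultimately show ?thesis using Pf Ph h(1) by (simp add: distrib_right)
  qed
  define g1 g2 where "g1 = (\<lambda>x. max (g x) 0)" and "g2 = (\<lambda>x. max (- g x) 0)"
  have i: "integrable M g1" "integrable M g2" unfolding g1_def g2_def using g(1) by auto
  have b: "\<bar>g1 x\<bar> \<le> D" "\<bar>g2 x\<bar> \<le> D" "0 \<le> g1 x" "0 \<le> g2 x" for x
    using g(2)[of x] by (auto simp: g1_def g2_def abs_le_iff max_def)
  have geq: "g = (\<lambda>x. g1 x - g2 x)" by (auto simp: g1_def g2_def)
  have Pg: "P t g x = P t g1 x - P t g2 x" for x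
    unfolding geq using i b by (intro P_diff[OF t, of _ D _ D]) auto
  have I: "integrable M (\<lambda>x. P t f x * g1 x)" "integrable M (\<lambda>x. P t f x * g2 x)"
    "integrable M (\<lambda>x. f x * P t g1 x)" "integrable M (\<lambda>x. f x * P t g2 x)"
    using integrable_bounded_mult[OF P_measurable[OF t f(1)] P_bound[OF t f]]
      integrable_bounded_mult[OF f] P_L1(1)[OF t] i b by blast+
  have "(\<integral>x. P t f x * g x \<partial>M) = (\<integral>x. P t f x * g1 x \<partial>M) - (\<integral>x. P t f x * g2 x \<partial>M)"
    using I by (simp add: geq right_diff_distrib)
  also have "\<dots> = (\<integral>x. f x * P t g1 x \<partial>M) - (\<integral>x. f x * P t g2 x \<partial>M)"
    using pos[OF i(1)] pos[OF i(2)] b by simp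
  also have "\<dots> = (\<integral>x. f x * P t g x \<partial>M)"
    using I by (simp add: Pg right_diff_distrib)
  finally show ?thesis .
qed

end

section \<open>Time regularity of the semigroup\<close>

text \<open>
  The generator is a right derivative at time \<open>0\<close>, and by the semigroup property this gives
  right increments at all times with an error that is uniform in the base point.  Moving the base
  point from \<open>y\<close> to \<open>r\<close> costs the increment of \<open>\<psi>\<close>, which the same kind of estimate
  controls; hence the derivative is two-sided.
\<close>

lemma derivative_from_right_increments:
  fixes \<phi> \<psi> \<xi> \<eta> \<theta> :: "real \<Rightarrow> real"
  assumes \<eta>: "(\<eta> \<longlongrightarrow> 0) (at_right 0)" and \<theta>: "(\<theta> \<longlongrightarrow> 0) (at_right 0)"
    and 1: "\<And>r d. r \<ge> 0 \<Longrightarrow> d > 0 \<Longrightarrow> \<bar>\<phi> (r + d) - \<phi> r - d * \<psi> r\<bar> \<le> d * \<eta> d"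
    and 2: "\<And>r d. r \<ge> 0 \<Longrightarrow> d > 0 \<Longrightarrow> \<bar>\<psi> (r + d) - \<psi> r - d * \<xi> r\<bar> \<le> d * \<theta> d"
    and 3: "\<And>r. r \<ge> 0 \<Longrightarrow> \<bar>\<xi> r\<bar> \<le> B"
    and r: "r \<ge> 0"
  shows "(\<phi> has_real_derivative \<psi> r) (at r within {0..})"
proof -
  define m where "m d = \<eta> d + d * (B + \<theta> d)" for d
  have m: "(m \<longlongrightarrow> 0) (at_right 0)"
    unfolding m_def using \<eta> \<theta> by (auto intro!: tendsto_eq_intros)
  have B: "B \<ge> 0" using 3[of 0] by linarith
  have bound: "\<bar>(\<phi> y - \<phi> r) / (y - r) - \<psi> r\<bar> \<le> m \<bar>y - r\<bar>" if y: "y \<ge> 0" "y \<noteq> r" for y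
  proof -
    define d where "d = \<bar>y - r\<bar>"
    have d: "d > 0" using y by (simp add: d_def)
    have th: "\<theta> d \<ge> 0" using 2[OF r d] d by (meson abs_ge_zero order_trans zero_le_mult_iff not_less)
    have *: "\<bar>\<phi> y - \<phi> r - (y - r) * \<psi> r\<bar> \<le> d * m d"
    proof (cases "y > r")
      case True
      then have y': "y = r + d" by (simp add: d_def)
      have "\<bar>\<phi> y - \<phi> r - (y - r) * \<psi> r\<bar> \<le> d * \<eta> d" using 1[OF r d] by (simp add: y')
      also have "\<dots> \<le> d * m d" unfolding m_def using d th B by (intro mult_left_mono) auto
      finally show ?thesis .
    next
      case False
      then have r': "r = y + d" using y by (simp add: d_def)
      have "\<bar>d * \<xi> y\<bar> \<le> d * B" using 3[OF y(1)] d by (simp add: abs_mult)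
      then have "\<bar>\<psi> r - \<psi> y\<bar> \<le> d * \<theta> d + d * B"
        using 2[OF y(1) d] unfolding r' by linarith
      then have "d * \<bar>\<psi> r - \<psi> y\<bar> \<le> d * (d * \<theta> d + d * B)" using d by (intro mult_left_mono) auto
      moreover have "\<phi> y - \<phi> r - (y - r) * \<psi> r = - (\<phi> r - \<phi> y - d * \<psi> y) + d * (\<psi> r - \<psi> y)"
        by (simp add: r' algebra_simps)
      then have "\<bar>\<phi> y - \<phi> r - (y - r) * \<psi> r\<bar> \<le> \<bar>\<phi> r - \<phi> y - d * \<psi> y\<bar> + d * \<bar>\<psi> r - \<psi> y\<bar>"
      proof -
        have "\<bar>d * (\<psi> r - \<psi> y)\<bar> = d * \<bar>\<psi> r - \<psi> y\<bar>" using d by (simp add: abs_mult)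
        then show ?thesis unfolding \<open>\<phi> y - \<phi> r - (y - r) * \<psi> r = _\<close> by linarith
      qed
      moreover have "\<bar>\<phi> r - \<phi> y - d * \<psi> y\<bar> \<le> d * \<eta> d" using 1[OF y(1) d] by (simp add: r')
      ultimately show ?thesis unfolding m_def by (simp add: algebra_simps)
    qed
    have "(\<phi> y - \<phi> r) / (y - r) - \<psi> r = (\<phi> y - \<phi> r - (y - r) * \<psi> r) / (y - r)"
      using y by (simp add: field_simps)
    then have "\<bar>(\<phi> y - \<phi> r) / (y - r) - \<psi> r\<bar> = \<bar>\<phi> y - \<phi> r - (y - r) * \<psi> r\<bar> / d"
      by (simp add: d_def)
    also have "\<dots> \<le> m d" using * d by (simp add: divide_le_eq mult.commute)
    finally show ?thesis by (simp add: d_def)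
  qed
  have "filterlim (\<lambda>y. \<bar>y - r\<bar>) (at_right 0) (at r within {0..})"
    unfolding filterlim_at
    by (auto intro!: tendsto_eq_intros simp: eventually_at_filter)
  from filterlim_compose[OF m this]
  have "((\<lambda>y. (\<phi> y - \<phi> r) / (y - r) - \<psi> r) \<longlongrightarrow> 0) (at r within {0..})"
    by (rule Lim_null_comparison[rotated]) (use bound in \<open>auto simp: eventually_at_filter\<close>)
  then show ?thesis by (simp add: has_field_derivative_iff LIM_zero_cancel)
qed

lemma first_order_remainder:
  fixes \<phi> :: "real \<Rightarrow> real"
  assumes d: "\<And>r. r \<ge> 0 \<Longrightarrow> (\<phi> has_real_derivative \<psi> r) (at r within {0..})"
    and B: "\<And>r. r \<ge> 0 \<Longrightarrow> \<bar>\<psi> r\<bar> \<le> B" and "a \<ge> 0" "b \<ge> 0"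
  shows "\<bar>\<phi> b - \<phi> a\<bar> \<le> B * \<bar>b - a\<bar>"
  using field_differentiable_bound[of "{0..}" \<phi> \<psi> B b a] assms by auto

lemma second_order_remainder:
  fixes \<phi> :: "real \<Rightarrow> real"
  assumes d1: "\<And>r. r \<ge> 0 \<Longrightarrow> (\<phi> has_real_derivative \<psi> r) (at r within {0..})"
    and d2: "\<And>r. r \<ge> 0 \<Longrightarrow> (\<psi> has_real_derivative \<xi> r) (at r within {0..})"
    and B: "\<And>r. r \<ge> 0 \<Longrightarrow> \<bar>\<xi> r\<bar> \<le> B" and ab: "a \<ge> 0" "b \<ge> 0"
  shows "\<bar>\<phi> b - \<phi> a - (b - a) * \<psi> a\<bar> \<le> B * (b - a)\<^sup>2"
proof -
  define I where "I = {min a b..max a b}"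
  have I: "I \<subseteq> {0..}" using ab by (auto simp: I_def)
  have B0: "B \<ge> 0" using B[of 0] by linarith
  define Z where "Z r = \<phi> r - (r - a) * \<psi> a" for r
  have "norm (Z b - Z a) \<le> (B * \<bar>b - a\<bar>) * norm (b - a)"
  proof (rule field_differentiable_bound[of I _ "\<lambda>r. \<psi> r - \<psi> a"])
    show "convex I" by (simp add: I_def)
    fix r assume r: "r \<in> I"
    show "(Z has_real_derivative \<psi> r - \<psi> a) (at r within I)"
      unfolding Z_def using DERIV_subset[OF d1 I, of r] r I by (auto intro!: derivative_eq_intros)
    have "\<bar>\<psi> r - \<psi> a\<bar> \<le> B * \<bar>r - a\<bar>" using first_order_remainder[OF d2 B, of a r] ab r I by auto
    also have "\<dots> \<le> B * \<bar>b - a\<bar>" using r B0 by (intro mult_left_mono) (auto simp: I_def)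
    finally show "norm (\<psi> r - \<psi> a) \<le> B * \<bar>b - a\<bar>" by simp
  qed (auto simp: I_def)
  then show ?thesis by (simp add: Z_def power2_eq_square mult.assoc algebra_simps abs_mult_self)
qed

context markov_diffusion_triple
begin

lemma S_meas: "f \<in> S \<Longrightarrow> f \<in> borel_measurable M"
  using S_measurable by auto

lemma A0_in_S: "h \<in> A0 \<Longrightarrow> h \<in> S"
  using A0_S by auto

lemma A0_boundedE:
  assumes "h \<in> A0" obtains C where "C \<ge> 0" "\<And>x. \<bar>h x\<bar> \<le> C"
  by (rule bounded_algebraE[of h]) (use assms A0_in_S A0_bounded in \<open>auto simp: bounded_algebra_def\<close>)

lemma A0_ideal2: "f \<in> S \<Longrightarrow> h \<in> A0 \<Longrightarrow> (\<lambda>x. h x * f x) \<in> A0"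
  using A0_ideal[of f h] by (simp add: mult.commute)

lemma A0_scale: "h \<in> A0 \<Longrightarrow> (\<lambda>x. c * h x) \<in> A0"
  by (intro A0_ideal S_const)

lemma A0_minus: "h \<in> A0 \<Longrightarrow> (\<lambda>x. - h x) \<in> A0"
  using A0_scale[of h "-1"] by simp

lemma A0_diff: "h \<in> A0 \<Longrightarrow> k \<in> A0 \<Longrightarrow> (\<lambda>x. h x - k x) \<in> A0"
  using A0_add[OF _ A0_minus, of h k] by simp

lemma A0_\<Gamma>: assumes "f \<in> S" "h \<in> A0" shows "\<Gamma> f h \<in> A0" "\<Gamma> h f \<in> A0"
proof -
  have "(\<lambda>x. 1 / 2 * ((L (\<lambda>y. f y * h y) x - f x * L h x) - h x * L f x)) \<in> A0"
    by (intro A0_scale A0_diff A0_ideal A0_ideal2 A0_L L_S assms)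
  then show "\<Gamma> f h \<in> A0" by (simp add: carre_du_champ_def[abs_def])
  then show "\<Gamma> h f \<in> A0" using \<Gamma>_commute[of h f] by simp
qed

lemma A0_integrable_mult: "f \<in> S \<Longrightarrow> h \<in> A0 \<Longrightarrow> integrable M (\<lambda>x. h x * f x)"
  by (intro A0_integrable A0_ideal2)

lemma L_symmetric: "f \<in> S \<Longrightarrow> h \<in> A0 \<Longrightarrow> (\<integral>x. h x * L f x \<partial>M) = (\<integral>x. L h x * f x \<partial>M)"
  using ibp_left[of f h] ibp_right[of f h] by (simp add: mult.commute)

lemma A0_bounded_algebra: "h \<in> A0 \<Longrightarrow> h \<in> bounded_algebra S"
  using A0_in_S A0_bounded by (auto simp: bounded_algebra_def)

text \<open>
  Inequalities in \<open>S\<close> that hold after integration against nonnegative test functions hold at every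
  point.  All pointwise statements about the semigroup below are obtained in this way.
\<close>

lemma S_le_by_testing:
  assumes "f \<in> S" "g \<in> S"
    and "\<And>h. h \<in> A0 \<Longrightarrow> (\<And>x. h x \<ge> 0) \<Longrightarrow> (\<integral>x. h x * f x \<partial>M) \<le> (\<integral>x. h x * g x \<partial>M)"
  shows "f x \<le> g x"
proof -
  have "0 \<le> (\<lambda>x. g x - f x) x"
  proof (rule nonneg_weak)
    show "(\<lambda>x. g x - f x) \<in> S" by (intro S_diff assms)
    fix h assume h: "h \<in> A0" "\<And>x. h x \<ge> 0"
    then show "0 \<le> (\<integral>x. h x * (g x - f x) \<partial>M)"
      using assms(3)[OF h] assms(1,2) by (simp add: right_diff_distrib A0_integrable_mult)
  qed
  then show ?thesis by simp
qed

lemma S_le_AE: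
  assumes "f \<in> S" "g \<in> S" "AE x in M. f x \<le> g x"
  shows "f x \<le> g x"
proof (rule S_le_by_testing[OF assms(1,2)])
  fix h assume h: "h \<in> A0" "\<And>x. h x \<ge> 0"
  show "(\<integral>x. h x * f x \<partial>M) \<le> (\<integral>x. h x * g x \<partial>M)"
    using h assms by (intro integral_mono_AE A0_integrable_mult)
      (auto elim!: eventually_mono intro: mult_left_mono)
qed

lemma S_eq_by_testing:
  assumes "f \<in> S" "g \<in> S"
    and "\<And>h. h \<in> A0 \<Longrightarrow> (\<integral>x. h x * f x \<partial>M) = (\<integral>x. h x * g x \<partial>M)"
  shows "f = g"
  using S_le_by_testing[of f g] S_le_by_testing[of g f] assms by (auto intro!: ext antisym)

lemma P_A0_S: "t \<ge> 0 \<Longrightarrow> h \<in> A0 \<Longrightarrow> P t h \<in> S"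
  by (intro semigroup_S A0_bounded_algebra)

lemma P_A0_bound: "t \<ge> 0 \<Longrightarrow> h \<in> A0 \<Longrightarrow> (\<And>x. \<bar>h x\<bar> \<le> C) \<Longrightarrow> \<bar>P t h x\<bar> \<le> C"
  by (intro P_bound S_meas A0_in_S)

lemma P_A0_integrable:
  assumes "t \<ge> 0" "h \<in> A0" shows "integrable M (P t h)"
  using A0_boundedE[OF assms(2)] P_L1(1)[OF assms(1) A0_integrable[OF assms(2)]] by metis

lemma P_A0_L1:
  assumes "t \<ge> 0" "h \<in> A0" shows "(\<integral>x. \<bar>P t h x\<bar> \<partial>M) \<le> (\<integral>x. \<bar>h x\<bar> \<partial>M)"
  using A0_boundedE[OF assms(2)] P_L1(2)[OF assms(1) A0_integrable[OF assms(2)]] by metis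

lemma P_dual:
  assumes "t \<ge> 0" "u \<in> A0" "f \<in> borel_measurable M" "\<And>x. \<bar>f x\<bar> \<le> C"
  shows "(\<integral>x. u x * P t f x \<partial>M) = (\<integral>x. P t u x * f x \<partial>M)"
proof -
  obtain D where "\<And>x. \<bar>u x\<bar> \<le> D" using A0_boundedE[OF assms(2)] by blast
  from P_symmetric[OF assms(1,3,4) A0_integrable[OF assms(2)] this]
  show ?thesis by (simp add: mult.commute)
qed

text \<open>
  The semigroup is moved to \<open>u\<close>, where \<open>P_r u\<close> is bounded in \<open>L^2\<close> uniformly in \<open>r\<close>; the
  Cauchy--Schwarz inequality and the strong \<open>L^2\<close> derivative at time \<open>0\<close> do the rest.
\<close>

lemma weak_increment:
  assumes u: "u \<in> A0" and h: "h \<in> A0"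
  obtains \<eta> where "(\<eta> \<longlongrightarrow> 0) (at_right 0)"
    "\<And>r d. r \<ge> 0 \<Longrightarrow> d > 0 \<Longrightarrow>
      \<bar>(\<integral>x. u x * P (r + d) h x \<partial>M) - (\<integral>x. u x * P r h x \<partial>M) - d * (\<integral>x. u x * P r (L h) x \<partial>M)\<bar> \<le> d * \<eta> d"
proof -
  obtain Cu where Cu: "Cu \<ge> 0" "\<And>x. \<bar>u x\<bar> \<le> Cu" using A0_boundedE[OF u] by blast
  obtain Ch where Ch: "Ch \<ge> 0" "\<And>x. \<bar>h x\<bar> \<le> Ch" using A0_boundedE[OF h] by blast
  have Lh: "L h \<in> A0" using A0_L[OF h] .
  obtain Cl where Cl: "Cl \<ge> 0" "\<And>x. \<bar>L h x\<bar> \<le> Cl" using A0_boundedE[OF Lh] by blast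
  define K where "K = Cu * (\<integral>x. \<bar>u x\<bar> \<partial>M)"
  define e where "e d = (\<integral>x. ((P d h x - h x) / d - L h x)\<^sup>2 \<partial>M)" for d
  have [measurable]: "u \<in> borel_measurable M" "h \<in> borel_measurable M" "L h \<in> borel_measurable M"
    using u h Lh by (auto intro: S_meas A0_in_S)
  show ?thesis
  proof (rule that[of "\<lambda>d. sqrt K * sqrt (e d)"])
    have "(e \<longlongrightarrow> 0) (at_right 0)" unfolding e_def by (rule generator[OF h])
    then show "((\<lambda>d. sqrt K * sqrt (e d)) \<longlongrightarrow> 0) (at_right 0)"
      by (auto intro!: tendsto_eq_intros)
  next
    fix r d :: real assume r: "r \<ge> 0" and d: "d > 0"
    note [measurable] = P_measurable[OF r] P_measurable[of d]
    have Pd: "P d h \<in> borel_measurable M" "integrable M (P d h)" "\<bar>P d h x\<bar> \<le> Ch" for x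
      using d by (auto intro!: P_measurable P_A0_integrable h P_A0_bound Ch)
    define a where "a = P r u"
    define b where "b = (\<lambda>x. (P d h x - h x) / d - L h x)"
    have a: "a \<in> borel_measurable M" "integrable M a" "\<bar>a x\<bar> \<le> Cu" for x
      unfolding a_def using r by (auto intro!: P_measurable P_A0_integrable P_A0_bound u Cu)
    have b: "b \<in> borel_measurable M" "integrable M b"
      unfolding b_def using Pd A0_integrable[OF h] A0_integrable[OF Lh] by auto
    have bb: "\<bar>b x\<bar> \<le> (Ch + Ch) / d + Cl" for x
    proof -
      have "\<bar>P d h x - h x\<bar> \<le> Ch + Ch" using Pd(3)[of x] Ch(2)[of x] by linarith
      then have "\<bar>(P d h x - h x) / d\<bar> \<le> (Ch + Ch) / d" using d by (simp add: divide_right_mono)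
      then show ?thesis unfolding b_def using Cl(2)[of x] by linarith
    qed
    have int: "integrable M (\<lambda>x. (a x)\<^sup>2)" "integrable M (\<lambda>x. (b x)\<^sup>2)" "integrable M (\<lambda>x. a x * b x)"
      unfolding power2_eq_square
      by (rule integrable_bounded_mult[OF a(1) a(3) a(2)],
          rule integrable_bounded_mult[OF b(1) bb b(2)], rule integrable_bounded_mult[OF a(1) a(3) b(2)])
    have "(\<integral>x. (a x)\<^sup>2 \<partial>M) \<le> (\<integral>x. Cu * \<bar>a x\<bar> \<partial>M)"
    proof (rule integral_mono[OF int(1)])
      show "(a x)\<^sup>2 \<le> Cu * \<bar>a x\<bar>" for x
        using mult_right_mono[OF a(3)[of x], of "\<bar>a x\<bar>"] by (simp add: power2_eq_square)
    qed (use a in auto)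
    also have "\<dots> \<le> K" unfolding K_def a_def using P_A0_L1[OF r u] Cu(1) by (simp add: mult_left_mono)
    finally have aK: "(\<integral>x. (a x)\<^sup>2 \<partial>M) \<le> K" .
    have iF: "integrable M (\<lambda>x. a x * P d h x)" "integrable M (\<lambda>x. a x * h x)" "integrable M (\<lambda>x. a x * L h x)"
      using integrable_bounded_mult[OF a(1) a(3)] Pd(2) A0_integrable[OF h] A0_integrable[OF Lh] by auto
    have "d * (\<integral>x. a x * b x \<partial>M) = (\<integral>x. d * (a x * b x) \<partial>M)" by simp
    also have "\<dots> = (\<integral>x. a x * P d h x - a x * h x - d * (a x * L h x) \<partial>M)"
      using d by (intro Bochner_Integration.integral_cong) (auto simp: b_def field_simps)
    also have "\<dots> = (\<integral>x. a x * P d h x \<partial>M) - (\<integral>x. a x * h x \<partial>M) - d * (\<integral>x. a x * L h x \<partial>M)"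
      using iF by simp
    also have "(\<integral>x. a x * P d h x \<partial>M) = (\<integral>x. u x * P (r + d) h x \<partial>M)"
      unfolding a_def using P_dual[OF r u Pd(1,3)] P_comp[OF r _ _ Ch(2), of d] d by simp
    also have "(\<integral>x. a x * h x \<partial>M) = (\<integral>x. u x * P r h x \<partial>M)"
      unfolding a_def using P_dual[OF r u _ Ch(2)] by simp
    also have "(\<integral>x. a x * L h x \<partial>M) = (\<integral>x. u x * P r (L h) x \<partial>M)"
      unfolding a_def using P_dual[OF r u _ Cl(2)] by simp
    finally have eq: "(\<integral>x. u x * P (r + d) h x \<partial>M) - (\<integral>x. u x * P r h x \<partial>M)
        - d * (\<integral>x. u x * P r (L h) x \<partial>M) = d * (\<integral>x. a x * b x \<partial>M)" by simp
    have "\<bar>\<integral>x. a x * b x \<partial>M\<bar> \<le> sqrt (\<integral>x. (a x)\<^sup>2 \<partial>M) * sqrt (e d)"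
      unfolding e_def using integral_Cauchy_Schwarz[OF int] by (simp add: b_def)
    also have "\<dots> \<le> sqrt K * sqrt (e d)" using aK by (intro mult_right_mono) (auto simp: e_def)
    finally show "\<bar>(\<integral>x. u x * P (r + d) h x \<partial>M) - (\<integral>x. u x * P r h x \<partial>M)
        - d * (\<integral>x. u x * P r (L h) x \<partial>M)\<bar> \<le> d * (sqrt K * sqrt (e d))"
      unfolding eq using d by (simp add: abs_mult)
  qed
qed

lemma weak_pairing_bound:
  assumes u: "u \<in> A0" and h: "h \<in> A0" and r: "r \<ge> 0" and C: "\<And>x. \<bar>h x\<bar> \<le> C"
  shows "\<bar>\<integral>x. u x * P r h x \<partial>M\<bar> \<le> C * (\<integral>x. \<bar>u x\<bar> \<partial>M)"
proof -
  have "\<bar>\<integral>x. u x * P r h x \<partial>M\<bar> \<le> (\<integral>x. \<bar>u x * P r h x\<bar> \<partial>M)" by (rule integral_abs_bound)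
  also have "\<dots> \<le> (\<integral>x. C * \<bar>u x\<bar> \<partial>M)"
  proof (rule integral_mono)
    show "integrable M (\<lambda>x. \<bar>u x * P r h x\<bar>)" using A0_integrable_mult[OF P_A0_S[OF r h] u] by simp
    show "integrable M (\<lambda>x. C * \<bar>u x\<bar>)" using A0_integrable[OF u] by simp
    show "\<bar>u x * P r h x\<bar> \<le> C * \<bar>u x\<bar>" for x
      using mult_right_mono[OF P_A0_bound[OF r h C, of x], of "\<bar>u x\<bar>"] by (simp add: abs_mult mult.commute)
  qed
  finally show ?thesis by simp
qed

lemma weak_derivative:
  assumes u: "u \<in> A0" and h: "h \<in> A0" and r: "r \<ge> 0"
  shows "((\<lambda>r. \<integral>x. u x * P r h x \<partial>M) has_real_derivative (\<integral>x. u x * P r (L h) x \<partial>M)) (at r within {0..})"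
proof -
  obtain \<eta> where \<eta>: "(\<eta> \<longlongrightarrow> 0) (at_right 0)"
    "\<And>r d. r \<ge> 0 \<Longrightarrow> d > 0 \<Longrightarrow>
      \<bar>(\<integral>x. u x * P (r + d) h x \<partial>M) - (\<integral>x. u x * P r h x \<partial>M) - d * (\<integral>x. u x * P r (L h) x \<partial>M)\<bar> \<le> d * \<eta> d"
    by (rule weak_increment[OF u h]) blast
  obtain \<theta> where \<theta>: "(\<theta> \<longlongrightarrow> 0) (at_right 0)"
    "\<And>r d. r \<ge> 0 \<Longrightarrow> d > 0 \<Longrightarrow>
      \<bar>(\<integral>x. u x * P (r + d) (L h) x \<partial>M) - (\<integral>x. u x * P r (L h) x \<partial>M) - d * (\<integral>x. u x * P r (L (L h)) x \<partial>M)\<bar> \<le> d * \<theta> d"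
    by (rule weak_increment[OF u A0_L[OF h]]) blast
  obtain C where C: "\<And>x. \<bar>L (L h) x\<bar> \<le> C" using A0_boundedE[OF A0_L[OF A0_L[OF h]]] by blast
  show ?thesis
    by (rule derivative_from_right_increments[OF \<eta>(1) \<theta>(1) \<eta>(2) \<theta>(2)
          weak_pairing_bound[OF u A0_L[OF A0_L[OF h]] _ C] r])
qed

text \<open>
  The derivative of \<open>\<integral> u P_t h = \<integral> h P_t u\<close> can be computed in two ways, as \<open>\<integral> u P_t (L h)\<close> and as
  \<open>\<integral> h P_t (L u) = \<integral> u L (P_t h)\<close>.
\<close>

lemma L_P_commute:
  assumes h: "h \<in> A0" and t: "t \<ge> 0"
  shows "L (P t h) = P t (L h)"
proof (rule S_eq_by_testing)
  show "L (P t h) \<in> S" "P t (L h) \<in> S" by (intro L_S P_A0_S t h A0_L)+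
  fix u assume u: "u \<in> A0"
  obtain Cu where Cu: "\<And>x. \<bar>u x\<bar> \<le> Cu" using A0_boundedE[OF u] by blast
  obtain Cl where Cl: "\<And>x. \<bar>L u x\<bar> \<le> Cl" using A0_boundedE[OF A0_L[OF u]] by blast
  have swap: "(\<integral>x. h x * P r k x \<partial>M) = (\<integral>x. k x * P r h x \<partial>M)" if rk: "r \<ge> 0" "k \<in> A0" for r k
  proof -
    obtain C where C: "\<And>x. \<bar>k x\<bar> \<le> C" using A0_boundedE[OF rk(2)] by blast
    show ?thesis using P_dual[OF rk(1) h S_meas[OF A0_in_S[OF rk(2)]] C] by (simp add: mult.commute)
  qed
  have nb: "at t within {0..} \<noteq> bot"
  proof
    assume "at t within {0..} = bot"
    moreover have "at_right t \<le> at t within {0..}" using t by (intro at_le) auto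
    ultimately have "at_right t = bot" by (simp only: le_bot)
    then show False using trivial_limit_at_right_real[of t] by simp
  qed
  have "((\<lambda>r. \<integral>x. u x * P r h x \<partial>M) has_real_derivative (\<integral>x. u x * P t (L h) x \<partial>M)) (at t within {0..})"
    by (rule weak_derivative[OF u h t])
  moreover have "((\<lambda>r. \<integral>x. u x * P r h x \<partial>M) has_real_derivative (\<integral>x. h x * P t (L u) x \<partial>M)) (at t within {0..})"
    by (rule has_field_derivative_transform_within[OF weak_derivative[OF h u t] zero_less_one])
       (use t swap u in auto)
  ultimately have "(\<integral>x. u x * P t (L h) x \<partial>M) = (\<integral>x. h x * P t (L u) x \<partial>M)"
    unfolding has_real_derivative_iff_has_vector_derivative by (rule vector_derivative_unique_within[OF nb])
  also have "\<dots> = (\<integral>x. L u x * P t h x \<partial>M)" by (rule swap[OF t A0_L[OF u]])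
  also have "\<dots> = (\<integral>x. u x * L (P t h) x \<partial>M)" by (rule L_symmetric[OF P_A0_S[OF t h] u, symmetric])
  finally show "(\<integral>x. u x * L (P t h) x \<partial>M) = (\<integral>x. u x * P t (L h) x \<partial>M)" by simp
qed

lemma weak_remainder:
  assumes u: "u \<in> A0" and h: "h \<in> A0" and ab: "a \<ge> 0" "b \<ge> 0"
    and B: "\<And>r. r \<ge> 0 \<Longrightarrow> \<bar>\<integral>x. u x * P r (L (L h)) x \<partial>M\<bar> \<le> B"
  shows "\<bar>\<integral>x. u x * (P b h x - P a h x - (b - a) * P a (L h) x) \<partial>M\<bar> \<le> B * (b - a)\<^sup>2"
proof -
  have "integrable M (\<lambda>x. u x * P r k x)" if "r \<ge> 0" "k \<in> A0" for r k
    using A0_integrable_mult[OF P_A0_S[OF that] u] .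
  note i = this[OF ab(2) h] this[OF ab(1) h] this[OF ab(1) A0_L[OF h]]
  have "(\<integral>x. u x * (P b h x - P a h x - (b - a) * P a (L h) x) \<partial>M)
     = (\<integral>x. u x * P b h x - u x * P a h x - (b - a) * (u x * P a (L h) x) \<partial>M)"
    by (intro Bochner_Integration.integral_cong) (auto simp: algebra_simps)
  also have "\<dots> = (\<integral>x. u x * P b h x \<partial>M) - (\<integral>x. u x * P a h x \<partial>M) - (b - a) * (\<integral>x. u x * P a (L h) x \<partial>M)"
    using i by simp
  also have "\<bar>\<dots>\<bar> \<le> B * (b - a)\<^sup>2"
    by (rule second_order_remainder[OF weak_derivative[OF u h] weak_derivative[OF u A0_L[OF h]] B ab])
  finally show ?thesis .
qed

text \<open>
  The weak second-order Taylor estimate has a constant proportional to the mass of \<open>u\<close>, so it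
  is a pointwise estimate that is uniform on the space.
\<close>

lemma uniform_remainder:
  assumes h: "h \<in> A0" and ab: "a \<ge> 0" "b \<ge> 0" and C: "\<And>x. \<bar>L (L h) x\<bar> \<le> C"
  shows "\<bar>P b h x - P a h x - (b - a) * P a (L h) x\<bar> \<le> C * (b - a)\<^sup>2"
proof -
  define R where "R = (\<lambda>x. P b h x - P a h x - (b - a) * P a (L h) x)"
  have R: "R \<in> S" unfolding R_def by (intro S_closed P_A0_S ab h A0_L)
  have weak: "\<bar>\<integral>x. u x * R x \<partial>M\<bar> \<le> (\<integral>x. u x * (C * (b - a)\<^sup>2) \<partial>M)" if u: "u \<in> A0" "\<And>x. u x \<ge> 0" for u
    using weak_remainder[OF u(1) h ab weak_pairing_bound[OF u(1) A0_L[OF A0_L[OF h]] _ C]] u(2)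
    by (simp add: R_def mult_ac)
  have "R x \<le> C * (b - a)\<^sup>2"
    by (rule S_le_by_testing[OF R S_const]) (use weak in fastforce)
  moreover have "- R x \<le> C * (b - a)\<^sup>2"
    by (rule S_le_by_testing[OF S_minus[OF R] S_const]) (use weak in fastforce)
  ultimately show ?thesis by (simp add: R_def)
qed

lemma uniform_lipschitz:
  assumes h: "h \<in> A0" and ab: "a \<ge> 0" "b \<ge> 0" and C: "\<And>x. \<bar>L h x\<bar> \<le> C"
  shows "\<bar>P b h x - P a h x\<bar> \<le> C * \<bar>b - a\<bar>"
proof -
  define R where "R = (\<lambda>x. P b h x - P a h x)"
  have R: "R \<in> S" unfolding R_def by (intro S_closed P_A0_S ab h)
  have weak: "\<bar>\<integral>x. u x * R x \<partial>M\<bar> \<le> (\<integral>x. u x * (C * \<bar>b - a\<bar>) \<partial>M)" if u: "u \<in> A0" "\<And>x. u x \<ge> 0" for u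
  proof -
    have "integrable M (\<lambda>x. u x * P r h x)" if "r \<ge> 0" for r
      using A0_integrable_mult[OF P_A0_S[OF that h] u(1)] .
    then have "(\<integral>x. u x * R x \<partial>M) = (\<integral>x. u x * P b h x \<partial>M) - (\<integral>x. u x * P a h x \<partial>M)"
      using ab by (simp add: R_def right_diff_distrib)
    also have "\<bar>\<dots>\<bar> \<le> C * (\<integral>x. \<bar>u x\<bar> \<partial>M) * \<bar>b - a\<bar>"
      by (rule first_order_remainder[OF weak_derivative[OF u(1) h] weak_pairing_bound[OF u(1) A0_L[OF h] _ C] ab])
    finally show ?thesis using u(2) by (simp add: mult_ac)
  qed
  have "R x \<le> C * \<bar>b - a\<bar>"
    by (rule S_le_by_testing[OF R S_const]) (use weak in fastforce)
  moreover have "- R x \<le> C * \<bar>b - a\<bar>"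
    by (rule S_le_by_testing[OF S_minus[OF R] S_const]) (use weak in fastforce)
  ultimately show ?thesis by (simp add: R_def)
qed

end

section \<open>Cutoffs and energy estimates\<close>

lemma abs_le_mean_if_square_le:
  fixes y a b :: real
  assumes "y\<^sup>2 \<le> a * b" "0 \<le> a" "0 \<le> b"
  shows "\<bar>y\<bar> \<le> (a + b) / 2"
proof -
  have "0 \<le> ((a - b) / 2)\<^sup>2" by simp
  then have "y\<^sup>2 \<le> ((a + b) / 2)\<^sup>2" using assms(1) by (simp add: power2_eq_square field_simps)
  then show ?thesis using assms(2,3) by (simp add: abs_le_square_iff[symmetric])
qed

context markov_diffusion_triple
begin

definition cutoff :: "nat \<Rightarrow> 'a \<Rightarrow> real"
  where "cutoff = (SOME \<zeta>. (\<forall>k. \<zeta> k \<in> A0) \<and> (\<forall>k x. 0 \<le> \<zeta> k x \<and> \<zeta> k x \<le> \<zeta> (Suc k) x) \<and>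
      (AE x in M. (\<lambda>k. \<zeta> k x) \<longlonglongrightarrow> 1) \<and>
      (\<forall>k x. carre_du_champ L (\<zeta> k) (\<zeta> k) x \<le> 1 / real (Suc k)))"

lemma cutoff_props:
  shows cutoff_A0: "cutoff k \<in> A0"
    and cutoff_nonneg: "0 \<le> cutoff k x"
    and cutoff_mono: "cutoff k x \<le> cutoff (Suc k) x"
    and cutoff_AE: "AE x in M. (\<lambda>k. cutoff k x) \<longlonglongrightarrow> 1"
    and \<Gamma>_cutoff: "\<Gamma> (cutoff k) (cutoff k) x \<le> 1 / real (Suc k)"
  using someI_ex[OF complete] unfolding cutoff_def[symmetric] by blast+

lemma cutoff_S: "cutoff k \<in> S"
  by (intro A0_in_S cutoff_A0)

lemma cutoff_le_1: "cutoff k x \<le> 1"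
proof (rule S_le_AE[OF cutoff_S S_const])
  have "incseq (\<lambda>k. cutoff k x)" for x by (intro incseq_SucI cutoff_mono)
  then show "AE x in M. cutoff k x \<le> 1"
    using cutoff_AE by (auto elim!: eventually_mono intro: incseq_le)
qed

lemma \<Gamma>_cutoff_le_1: "\<Gamma> (cutoff k) (cutoff k) x \<le> 1"
  using \<Gamma>_cutoff[of k x] by (rule order_trans) simp

lemma cutoff_limit:
  assumes "integrable M X"
  shows "(\<lambda>k. \<integral>x. cutoff k x * X x \<partial>M) \<longlonglongrightarrow> (\<integral>x. X x \<partial>M)"
proof (rule integral_dominated_convergence[where w = "\<lambda>x. \<bar>X x\<bar>"])
  show "(\<lambda>x. cutoff k x * X x) \<in> borel_measurable M" for k
    using assms S_meas[OF cutoff_S] by (intro borel_measurable_times) auto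
  show "AE x in M. (\<lambda>k. cutoff k x * X x) \<longlonglongrightarrow> X x"
    using cutoff_AE by eventually_elim (auto intro!: tendsto_eq_intros)
  show "AE x in M. norm (cutoff k x * X x) \<le> \<bar>X x\<bar>" for k
    using cutoff_nonneg cutoff_le_1 by (auto simp: abs_mult intro!: mult_left_le_one_le)
qed (use assms in auto)

text \<open>
  Fatou's lemma.  Cutoffs enter squared because they come from testing with \<open>\<zeta>^2\<close>, for which
  the error terms containing \<open>\<Gamma>(\<zeta>)\<close> can be absorbed.
\<close>

lemma integrable_by_cutoff:
  assumes X: "X \<in> S" "\<And>x. 0 \<le> X x"
    and K: "\<And>k. (\<integral>x. (cutoff k x)\<^sup>2 * X x \<partial>M) \<le> K"
  shows "integrable M X" "(\<integral>x. X x \<partial>M) \<le> K"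
proof -
  note [measurable] = S_meas[OF X(1)] S_meas[OF cutoff_S]
  have i: "integrable M (\<lambda>x. (cutoff k x)\<^sup>2 * X x)" for k
    using A0_integrable[OF A0_ideal[OF S_mult[OF X(1) cutoff_S] cutoff_A0], of k k]
    by (simp add: power2_eq_square mult_ac)
  have K0: "K \<ge> 0" using K[of 0] X(2) by (smt (verit) integral_nonneg_AE AE_I2 mult_nonneg_nonneg zero_le_power2)
  have "(\<integral>\<^sup>+x. ennreal (X x) \<partial>M) = (\<integral>\<^sup>+x. liminf (\<lambda>k. ennreal ((cutoff k x)\<^sup>2 * X x)) \<partial>M)"
  proof (rule nn_integral_cong_AE)
    show "AE x in M. ennreal (X x) = liminf (\<lambda>k. ennreal ((cutoff k x)\<^sup>2 * X x))"
      using cutoff_AE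
    proof eventually_elim
      case (elim x)
      then have "(\<lambda>k. (cutoff k x)\<^sup>2 * X x) \<longlonglongrightarrow> X x" by (auto intro!: tendsto_eq_intros)
      then have "(\<lambda>k. ennreal ((cutoff k x)\<^sup>2 * X x)) \<longlonglongrightarrow> ennreal (X x)" by (rule tendsto_ennrealI)
      then show ?case by (simp add: lim_imp_Liminf)
    qed
  qed
  also have "\<dots> \<le> liminf (\<lambda>k. \<integral>\<^sup>+x. ennreal ((cutoff k x)\<^sup>2 * X x) \<partial>M)"
    by (rule nn_integral_liminf) measurable
  also have "\<dots> \<le> ennreal K"
  proof (rule Liminf_le)
    show "\<forall>\<^sub>F k in sequentially. (\<integral>\<^sup>+x. ennreal ((cutoff k x)\<^sup>2 * X x) \<partial>M) \<le> ennreal K"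
      using K i X(2) by (auto simp: nn_integral_eq_integral ennreal_leI intro!: always_eventually)
  qed simp
  finally have le: "(\<integral>\<^sup>+x. ennreal (X x) \<partial>M) \<le> ennreal K" .
  then show int: "integrable M X"
    using X(2) by (auto simp: integrable_iff_bounded le_less_trans[OF _ ennreal_less_top])
  show "(\<integral>x. X x \<partial>M) \<le> K" using le int X(2) K0 by (simp add: nn_integral_eq_integral)
qed

text \<open>
  These functions have finite energy and admit integration by parts on the whole space.  The
  evolution of \<open>A0\<close> under the semigroup stays in this class, while it may leave \<open>A0\<close>.
\<close>

definition tame :: "('a \<Rightarrow> real) set"
  where "tame = {u \<in> S. bounded (range u) \<and> bounded (range (L u)) \<and> integrable M u \<and> integrable M (L u)}"

lemma tameI: "u \<in> S \<Longrightarrow> (\<And>x. \<bar>u x\<bar> \<le> C) \<Longrightarrow> (\<And>x. \<bar>L u x\<bar> \<le> D) \<Longrightarrow> integrable M u \<Longrightarrow>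
    integrable M (L u) \<Longrightarrow> u \<in> tame"
  unfolding tame_def by (auto intro!: boundedI)

lemma tameE:
  assumes "u \<in> tame"
  obtains C D where "u \<in> S" "C \<ge> 0" "\<And>x. \<bar>u x\<bar> \<le> C" "\<And>x. \<bar>L u x\<bar> \<le> D" "integrable M u" "integrable M (L u)"
proof -
  have u: "u \<in> S" "bounded (range u)" "bounded (range (L u))" "integrable M u" "integrable M (L u)"
    using assms by (auto simp: tame_def)
  obtain C where C: "\<And>x. \<bar>u x\<bar> \<le> C" using u(2) by (auto simp: bounded_iff)
  obtain D where D: "\<And>x. \<bar>L u x\<bar> \<le> D" using u(3) by (auto simp: bounded_iff)
  have "C \<ge> 0" using C[of undefined] by linarith
  then show ?thesis using that[of C D] u C D by blast
qed

lemma tame_S: "u \<in> tame \<Longrightarrow> u \<in> S"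
  by (simp add: tame_def)

lemma tame_integrable: "u \<in> tame \<Longrightarrow> integrable M u" "u \<in> tame \<Longrightarrow> integrable M (L u)"
  by (simp_all add: tame_def)

lemma tame_integrable_mult:
  assumes "u \<in> tame" "integrable M X"
  shows "integrable M (\<lambda>x. u x * X x)" "integrable M (\<lambda>x. L u x * X x)"
proof -
  obtain C D where u: "u \<in> S" "\<And>x. \<bar>u x\<bar> \<le> C" "\<And>x. \<bar>L u x\<bar> \<le> D" by (rule tameE[OF assms(1)]) blast
  show "integrable M (\<lambda>x. u x * X x)" "integrable M (\<lambda>x. L u x * X x)"
    by (rule integrable_bounded_mult[OF S_meas[OF u(1)] u(2) assms(2)],
        rule integrable_bounded_mult[OF S_meas[OF L_S[OF u(1)]] u(3) assms(2)])
qed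

lemma tame_square: "u \<in> tame \<Longrightarrow> integrable M (\<lambda>x. (u x)\<^sup>2)" "u \<in> tame \<Longrightarrow> integrable M (\<lambda>x. (L u x)\<^sup>2)"
  unfolding power2_eq_square by (intro tame_integrable_mult tame_integrable; assumption)+

lemma tame_add:
  assumes "u \<in> tame" "v \<in> tame" shows "(\<lambda>x. u x + v x) \<in> tame"
proof -
  obtain C D where u: "u \<in> S" "\<And>x. \<bar>u x\<bar> \<le> C" "\<And>x. \<bar>L u x\<bar> \<le> D" "integrable M u" "integrable M (L u)"
    by (rule tameE[OF assms(1)]) blast
  obtain C' D' where v: "v \<in> S" "\<And>x. \<bar>v x\<bar> \<le> C'" "\<And>x. \<bar>L v x\<bar> \<le> D'" "integrable M v" "integrable M (L v)"
    by (rule tameE[OF assms(2)]) blast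
  show ?thesis
  proof (rule tameI[of _ "C + C'" "D + D'"])
    show "\<bar>u x + v x\<bar> \<le> C + C'" for x using u(2)[of x] v(2)[of x] by linarith
    show "\<bar>L (\<lambda>x. u x + v x) x\<bar> \<le> D + D'" for x
      using u(3)[of x] v(3)[of x] unfolding L_add[OF u(1) v(1)] by linarith
  qed (use u v in \<open>auto simp: L_add S_add\<close>)
qed

lemma tame_scale:
  assumes "u \<in> tame" shows "(\<lambda>x. c * u x) \<in> tame"
proof -
  obtain C D where u: "u \<in> S" "\<And>x. \<bar>u x\<bar> \<le> C" "\<And>x. \<bar>L u x\<bar> \<le> D" "integrable M u" "integrable M (L u)"
    by (rule tameE[OF assms(1)]) blast
  show ?thesis
  proof (rule tameI[of _ "\<bar>c\<bar> * C" "\<bar>c\<bar> * D"])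
    show "\<bar>c * u x\<bar> \<le> \<bar>c\<bar> * C" for x using u(2)[of x] by (simp add: abs_mult mult_left_mono)
    show "\<bar>L (\<lambda>x. c * u x) x\<bar> \<le> \<bar>c\<bar> * D" for x
      using u(3)[of x] by (simp add: L_scale u abs_mult mult_left_mono)
  qed (use u in \<open>auto simp: L_scale S_scale\<close>)
qed

lemma tame_diff:
  assumes "u \<in> tame" "v \<in> tame" shows "(\<lambda>x. u x - v x) \<in> tame"
  using tame_add[OF assms(1) tame_scale[OF assms(2), of "-1"]] by simp

lemma tame_P:
  assumes t: "t \<ge> 0" and h: "h \<in> A0" shows "P t h \<in> tame"
proof -
  obtain C where C: "\<And>x. \<bar>h x\<bar> \<le> C" using A0_boundedE[OF h] by blast
  obtain D where D: "\<And>x. \<bar>L h x\<bar> \<le> D" using A0_boundedE[OF A0_L[OF h]] by blast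
  show ?thesis
    by (rule tameI[OF P_A0_S[OF t h] P_A0_bound[OF t h C]], unfold L_P_commute[OF h t],
        rule P_A0_bound[OF t A0_L[OF h] D], intro P_A0_integrable t h, intro P_A0_integrable t A0_L h)
qed

lemma tame_L_P: "t \<ge> 0 \<Longrightarrow> h \<in> A0 \<Longrightarrow> L (P t h) \<in> tame"
  by (simp add: L_P_commute tame_P A0_L)

lemma P_A0_nonneg:
  assumes "t \<ge> 0" "h \<in> A0" "\<And>x. 0 \<le> h x" shows "0 \<le> P t h x"
  using A0_boundedE[OF assms(2)] P_ge[OF assms(1) S_meas[OF A0_in_S[OF assms(2)]] _ assms(3)] by metis

text \<open>
  Caccioppoli's argument: integrate \<open>u L u\<close> against \<open>\<zeta>^2\<close>.  The cross term \<open>2 \<zeta> u \<Gamma>(u, \<zeta>)\<close> is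
  absorbed in half of \<open>\<zeta>^2 \<Gamma>(u)\<close> and \<open>2 u^2 \<Gamma>(\<zeta>) \<le> 2 u^2\<close>.
\<close>

lemma energy_bound:
  assumes u: "u \<in> tame"
  shows "integrable M (\<Gamma> u u)" "(\<integral>x. \<Gamma> u u x \<partial>M) \<le> 5 * (\<integral>x. (u x)\<^sup>2 \<partial>M) + (\<integral>x. (L u x)\<^sup>2 \<partial>M)"
proof -
  note uS = tame_S[OF u]
  have "(\<integral>x. (cutoff k x)\<^sup>2 * \<Gamma> u u x \<partial>M) \<le> 5 * (\<integral>x. (u x)\<^sup>2 \<partial>M) + (\<integral>x. (L u x)\<^sup>2 \<partial>M)" for k
  proof -
    define z where "z = cutoff k"
    define w where "w = (\<lambda>x. z x * u x * z x)"
    have zA: "z \<in> A0" and zS: "z \<in> S" and z0: "0 \<le> z x" and z1: "z x \<le> 1" for x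
      by (auto simp: z_def cutoff_A0 cutoff_S cutoff_nonneg cutoff_le_1)
    have w: "w \<in> A0" unfolding w_def by (intro A0_ideal S_mult zS zA uS)
    have \<Gamma>w: "\<Gamma> u w x = (z x)\<^sup>2 * \<Gamma> u u x + 2 * (z x * u x * \<Gamma> u z x)" for x
      unfolding w_def using uS zS by (simp add: \<Gamma>_mult_right S_closed power2_eq_square algebra_simps)
    have i1: "integrable M (\<lambda>x. (z x)\<^sup>2 * \<Gamma> u u x)"
      using A0_integrable[OF A0_ideal[OF S_mult[OF \<Gamma>_S[OF uS uS] zS] zA]]
      by (simp add: power2_eq_square mult_ac)
    have i2: "integrable M (\<Gamma> u w)" by (intro A0_integrable A0_\<Gamma> uS w)
    have i3: "integrable M (\<lambda>x. w x * L u x)" by (intro A0_integrable_mult L_S uS w)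
    have pt: "(z x)\<^sup>2 * \<Gamma> u u x \<le> 2 * \<Gamma> u w x + 4 * (u x)\<^sup>2" for x
    proof -
      have "0 \<le> (z x)\<^sup>2 * \<Gamma> u u x + 2 * (z x * (2 * u x) * \<Gamma> u z x) + (2 * u x)\<^sup>2 * \<Gamma> z z x"
        by (rule \<Gamma>_quadratic[OF uS zS])
      moreover have "(2 * u x)\<^sup>2 * \<Gamma> z z x \<le> (2 * u x)\<^sup>2 * 1"
        using \<Gamma>_cutoff_le_1[of k x] by (intro mult_left_mono) (auto simp: z_def)
      moreover have "2 * \<Gamma> u w x = 2 * ((z x)\<^sup>2 * \<Gamma> u u x) + 2 * (z x * (2 * u x) * \<Gamma> u z x)"
        by (simp add: \<Gamma>w)
      moreover have "(2 * u x)\<^sup>2 = 4 * (u x)\<^sup>2" by (simp add: power_mult_distrib)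
      ultimately show ?thesis by linarith
    qed
    have "(\<integral>x. (z x)\<^sup>2 * \<Gamma> u u x \<partial>M) \<le> (\<integral>x. 2 * \<Gamma> u w x + 4 * (u x)\<^sup>2 \<partial>M)"
      using i1 i2 tame_square(1)[OF u] pt by (intro integral_mono) auto
    also have "\<dots> = - 2 * (\<integral>x. w x * L u x \<partial>M) + 4 * (\<integral>x. (u x)\<^sup>2 \<partial>M)"
      using i2 tame_square(1)[OF u] by (simp add: ibp_left[OF uS w])
    also have "- 2 * (\<integral>x. w x * L u x \<partial>M) = (\<integral>x. - 2 * (w x * L u x) \<partial>M)" by simp
    also have "\<dots> \<le> (\<integral>x. (u x)\<^sup>2 + (L u x)\<^sup>2 \<partial>M)"
    proof (rule integral_mono)
      fix x
      have "\<bar>w x\<bar> \<le> \<bar>u x\<bar>"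
      proof -
        have "\<bar>w x\<bar> = (z x * z x) * \<bar>u x\<bar>" unfolding w_def using z0 by (simp add: abs_mult)
        also have "\<dots> \<le> 1 * \<bar>u x\<bar>" using z0 z1 by (intro mult_right_mono mult_le_one) auto
        finally show ?thesis by simp
      qed
      then have "\<bar>w x * L u x\<bar> \<le> \<bar>u x\<bar> * \<bar>L u x\<bar>" by (simp add: abs_mult mult_right_mono)
      moreover have "2 * (\<bar>u x\<bar> * \<bar>L u x\<bar>) \<le> (u x)\<^sup>2 + (L u x)\<^sup>2"
        using sum_squares_bound[of "\<bar>u x\<bar>" "\<bar>L u x\<bar>"] by simp
      ultimately show "- 2 * (w x * L u x) \<le> (u x)\<^sup>2 + (L u x)\<^sup>2" by linarith
    qed (use i3 tame_square[OF u] in auto)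
    also have "\<dots> = (\<integral>x. (u x)\<^sup>2 \<partial>M) + (\<integral>x. (L u x)\<^sup>2 \<partial>M)" using tame_square[OF u] by simp
    finally show ?thesis by (simp add: z_def)
  qed
  from integrable_by_cutoff[OF \<Gamma>_S[OF uS uS] carre_nonneg[OF uS] this]
  show "integrable M (\<Gamma> u u)" "(\<integral>x. \<Gamma> u u x \<partial>M) \<le> 5 * (\<integral>x. (u x)\<^sup>2 \<partial>M) + (\<integral>x. (L u x)\<^sup>2 \<partial>M)" .
qed

lemma tame_\<Gamma>_integrable:
  assumes "u \<in> tame" "v \<in> tame" shows "integrable M (\<Gamma> u v)"
proof (rule Bochner_Integration.integrable_bound)
  note S = assms[THEN tame_S]
  show "integrable M (\<lambda>x. (\<Gamma> u u x + \<Gamma> v v x) / 2)" using assms[THEN energy_bound(1)] by simp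
  show "\<Gamma> u v \<in> borel_measurable M" by (intro S_meas \<Gamma>_S S)
  show "AE x in M. norm (\<Gamma> u v x) \<le> norm ((\<Gamma> u u x + \<Gamma> v v x) / 2)"
    using abs_\<Gamma>_le[OF S] by (auto intro: order_trans[OF _ abs_ge_self])
qed

lemma uniform_energy:
  assumes h: "h \<in> A0"
  obtains K where "K \<ge> 0" "\<And>t. t \<ge> 0 \<Longrightarrow> (\<integral>x. \<Gamma> (P t h) (P t h) x \<partial>M) \<le> K"
proof -
  have sq: "\<exists>K\<ge>0. \<forall>t\<ge>0. (\<integral>x. (P t k x)\<^sup>2 \<partial>M) \<le> K" if k: "k \<in> A0" for k
  proof -
    obtain C where C: "C \<ge> 0" "\<And>x. \<bar>k x\<bar> \<le> C" using A0_boundedE[OF k] by blast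
    have "(\<integral>x. (P t k x)\<^sup>2 \<partial>M) \<le> C * (\<integral>x. \<bar>k x\<bar> \<partial>M)" if t: "t \<ge> 0" for t
    proof -
      have "(\<integral>x. (P t k x)\<^sup>2 \<partial>M) \<le> (\<integral>x. C * \<bar>P t k x\<bar> \<partial>M)"
      proof (rule integral_mono)
        show "(P t k x)\<^sup>2 \<le> C * \<bar>P t k x\<bar>" for x
          using mult_right_mono[OF P_A0_bound[OF t k C(2), of x], of "\<bar>P t k x\<bar>"] by (simp add: power2_eq_square)
      qed (use tame_square[OF tame_P[OF t k]] P_A0_integrable[OF t k] in auto)
      also have "\<dots> \<le> C * (\<integral>x. \<bar>k x\<bar> \<partial>M)" using P_A0_L1[OF t k] C(1) by (simp add: mult_left_mono)
      finally show ?thesis .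
    qed
    then show ?thesis using C(1) by (intro exI[of _ "C * (\<integral>x. \<bar>k x\<bar> \<partial>M)"]) auto
  qed
  obtain K1 where K1: "K1 \<ge> 0" "\<And>t. t \<ge> 0 \<Longrightarrow> (\<integral>x. (P t h x)\<^sup>2 \<partial>M) \<le> K1" using sq[OF h] by blast
  obtain K2 where K2: "K2 \<ge> 0" "\<And>t. t \<ge> 0 \<Longrightarrow> (\<integral>x. (P t (L h) x)\<^sup>2 \<partial>M) \<le> K2" using sq[OF A0_L[OF h]] by blast
  show ?thesis
  proof (rule that[of "5 * K1 + K2"])
    fix t :: real assume t: "t \<ge> 0"
    show "(\<integral>x. \<Gamma> (P t h) (P t h) x \<partial>M) \<le> 5 * K1 + K2"
      using energy_bound(2)[OF tame_P[OF t h]] K1(2)[OF t] K2(2)[OF t] unfolding L_P_commute[OF h t] by linarith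
  qed (use K1 K2 in auto)
qed

text \<open>
  The error of the first-order Taylor expansion of \<open>P_t h\<close> at time \<open>a\<close>, evaluated at time \<open>b\<close>.
\<close>

definition remainder :: "('a \<Rightarrow> real) \<Rightarrow> real \<Rightarrow> real \<Rightarrow> 'a \<Rightarrow> real"
  where "remainder h a b = (\<lambda>x. P b h x - P a h x - (b - a) * P a (L h) x)"

lemma tame_remainder: "h \<in> A0 \<Longrightarrow> a \<ge> 0 \<Longrightarrow> b \<ge> 0 \<Longrightarrow> remainder h a b \<in> tame"
  unfolding remainder_def by (intro tame_diff tame_scale tame_P A0_L)

lemma L_remainder:
  assumes "h \<in> A0" "a \<ge> 0" "b \<ge> 0" shows "L (remainder h a b) = remainder (L h) a b"
  unfolding remainder_def using assms
  by (simp add: L_diff L_scale S_diff S_scale P_A0_S A0_L L_P_commute)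

text \<open>
  Write \<open>R\<close> for the remainder.  The weak Taylor estimate is tested with \<open>\<zeta> R\<close> itself.  Its
  constant is at most \<open>sup \<bar>R\<bar>\<close> times the \<open>L^1\<close> norm of \<open>L (L h)\<close>, and the supremum is already of
  second order.
\<close>

lemma L2_remainder:
  assumes h: "h \<in> A0"
  obtains K where "K \<ge> 0" "\<And>a b. a \<ge> 0 \<Longrightarrow> b \<ge> 0 \<Longrightarrow> (\<integral>x. (remainder h a b x)\<^sup>2 \<partial>M) \<le> K * (b - a) ^ 4"
proof -
  have LLh: "L (L h) \<in> A0" by (intro A0_L h)
  obtain C where C: "C \<ge> 0" "\<And>x. \<bar>L (L h) x\<bar> \<le> C" using A0_boundedE[OF LLh] by blast
  define I where "I = (\<integral>x. \<bar>L (L h) x\<bar> \<partial>M)"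
  have I: "I \<ge> 0" by (simp add: I_def)
  have "(\<integral>x. (remainder h a b x)\<^sup>2 \<partial>M) \<le> C * I * (b - a) ^ 4" if ab: "a \<ge> 0" "b \<ge> 0" for a b
  proof -
    define R where "R = remainder h a b"
    have R: "R \<in> tame" unfolding R_def by (rule tame_remainder[OF h ab])
    have RC: "\<bar>R x\<bar> \<le> C * (b - a)\<^sup>2" for x
      unfolding R_def remainder_def by (rule uniform_remainder[OF h ab C(2)])
    have "(\<integral>x. cutoff k x * (R x)\<^sup>2 \<partial>M) \<le> C * I * (b - a) ^ 4" for k
    proof -
      define u where "u = (\<lambda>x. R x * cutoff k x)"
      have u: "u \<in> A0" unfolding u_def by (intro A0_ideal tame_S R cutoff_A0)
      have uC: "\<bar>u x\<bar> \<le> C * (b - a)\<^sup>2" for x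
      proof -
        have "\<bar>u x\<bar> = \<bar>R x\<bar> * cutoff k x" by (simp add: u_def abs_mult cutoff_nonneg)
        also have "\<dots> \<le> \<bar>R x\<bar> * 1" by (intro mult_left_mono cutoff_le_1) auto
        finally show ?thesis using RC[of x] by simp
      qed
      have "\<bar>\<integral>x. u x * P r (L (L h)) x \<partial>M\<bar> \<le> C * (b - a)\<^sup>2 * I" if r: "r \<ge> 0" for r
      proof -
        have "\<bar>\<integral>x. u x * P r (L (L h)) x \<partial>M\<bar> \<le> (\<integral>x. \<bar>u x * P r (L (L h)) x\<bar> \<partial>M)" by (rule integral_abs_bound)
        also have "\<dots> \<le> (\<integral>x. C * (b - a)\<^sup>2 * \<bar>P r (L (L h)) x\<bar> \<partial>M)"
        proof (rule integral_mono)
          show "\<bar>u x * P r (L (L h)) x\<bar> \<le> C * (b - a)\<^sup>2 * \<bar>P r (L (L h)) x\<bar>" for x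
            unfolding abs_mult by (intro mult_right_mono uC) auto
        qed (use A0_integrable_mult[OF P_A0_S[OF r LLh] u] P_A0_integrable[OF r LLh] in auto)
        also have "\<dots> \<le> C * (b - a)\<^sup>2 * I"
          using P_A0_L1[OF r LLh] C(1) by (simp add: I_def mult_left_mono)
        finally show ?thesis .
      qed
      from weak_remainder[OF u h ab this]
      have "\<bar>\<integral>x. u x * R x \<partial>M\<bar> \<le> C * (b - a)\<^sup>2 * I * (b - a)\<^sup>2" by (simp add: R_def remainder_def)
      moreover have "(b - a)\<^sup>2 * (b - a)\<^sup>2 = (b - a) ^ 4" by (simp flip: power_add)
      moreover have "(\<integral>x. cutoff k x * (R x)\<^sup>2 \<partial>M) = (\<integral>x. u x * R x \<partial>M)"
        by (simp add: u_def power2_eq_square mult_ac)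
      ultimately show ?thesis by (simp add: mult_ac abs_le_iff)
    qed
    then show ?thesis
      using cutoff_limit[OF tame_square(1)[OF R]] unfolding R_def by (intro LIMSEQ_le_const2) auto
  qed
  then show ?thesis using C I by (intro that[of "C * I"]) auto
qed

lemma energy_remainder:
  assumes h: "h \<in> A0"
  obtains K where "K \<ge> 0" "\<And>a b. a \<ge> 0 \<Longrightarrow> b \<ge> 0 \<Longrightarrow>
    (\<integral>x. \<Gamma> (remainder h a b) (remainder h a b) x \<partial>M) \<le> K * (b - a) ^ 4"
proof -
  obtain K1 where K1: "K1 \<ge> 0"
    "\<And>a b. a \<ge> 0 \<Longrightarrow> b \<ge> 0 \<Longrightarrow> (\<integral>x. (remainder h a b x)\<^sup>2 \<partial>M) \<le> K1 * (b - a) ^ 4"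
    by (rule L2_remainder[OF h]) blast
  obtain K2 where K2: "K2 \<ge> 0"
    "\<And>a b. a \<ge> 0 \<Longrightarrow> b \<ge> 0 \<Longrightarrow> (\<integral>x. (remainder (L h) a b x)\<^sup>2 \<partial>M) \<le> K2 * (b - a) ^ 4"
    by (rule L2_remainder[OF A0_L[OF h]]) blast
  show ?thesis
  proof (rule that[of "5 * K1 + K2"])
    fix a b :: real assume ab: "a \<ge> 0" "b \<ge> 0"
    show "(\<integral>x. \<Gamma> (remainder h a b) (remainder h a b) x \<partial>M) \<le> (5 * K1 + K2) * (b - a) ^ 4"
      using energy_bound(2)[OF tame_remainder[OF h ab]] K1(2)[OF ab] K2(2)[OF ab]
      unfolding L_remainder[OF h ab] by (simp add: distrib_right)
  qed (use K1 K2 in auto)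
qed

text \<open>
  With \<open>N = \<Gamma>_2(g) - \<rho> \<Gamma>(g)\<close>, integrating \<open>L \<Gamma>(g)\<close> against \<open>\<zeta>^2\<close> produces the error
  \<open>\<zeta> \<Gamma>(\<zeta>, \<Gamma>(g))\<close>.  The improved curvature inequality bounds it by \<open>\<zeta>^2 N / 2 + 2 \<Gamma>(g)\<close>, so
  that half of the integral of \<open>\<zeta>^2 N\<close> survives.
\<close>

lemma \<Gamma>2_integrable:
  assumes CD: "curvature_dimension S L \<rho> n" and n: "n > 0"
    and g: "g \<in> tame" and Lg: "L g \<in> tame"
  shows "integrable M (\<lambda>x. Gamma2 L g x - \<rho> * \<Gamma> g g x)" "0 \<le> Gamma2 L g x - \<rho> * \<Gamma> g g x"
proof -
  obtain C where gS: "g \<in> S" and C: "\<And>x. \<bar>g x\<bar> \<le> C" by (rule tameE[OF g]) blast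
  have gb: "g \<in> bounded_algebra S" by (rule bounded_algebraI[OF gS C])
  define G where "G = \<Gamma> g g"
  define N where "N = (\<lambda>x. Gamma2 L g x - \<rho> * G x)"
  have GS: "G \<in> S" unfolding G_def by (intro \<Gamma>_S gS)
  have NS: "N \<in> S" unfolding N_def by (intro S_diff S_scale \<Gamma>2_S gS GS)
  have G0: "0 \<le> G x" for x unfolding G_def by (rule carre_nonneg[OF gS])
  have N0: "0 \<le> N x" for x
  proof -
    have "Gamma2 L g x \<ge> \<rho> * \<Gamma> g g x + 1 / n * (L g x)\<^sup>2" using CD gb by (auto simp: curvature_dimension_def)
    moreover have "1 / n * (L g x)\<^sup>2 \<ge> 0" using n by simp
    ultimately show ?thesis by (simp add: N_def G_def)
  qed
  have iG: "integrable M G" "integrable M (\<Gamma> g (L g))"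
    unfolding G_def by (intro tame_\<Gamma>_integrable g Lg)+
  define K where "K = 2 * (\<integral>x. 2 * G x + \<bar>\<Gamma> g (L g) x\<bar> + \<bar>\<rho>\<bar> * G x \<partial>M)"
  have "(\<integral>x. (cutoff k x)\<^sup>2 * N x \<partial>M) \<le> K" for k
  proof -
    define z where "z = cutoff k"
    have zA: "z \<in> A0" and zS: "z \<in> S" and z0: "0 \<le> z x" and z1: "z x \<le> 1" for x
      by (auto simp: z_def cutoff_A0 cutoff_S cutoff_nonneg cutoff_le_1)
    have z2: "(\<lambda>x. z x * z x) \<in> A0" by (rule A0_ideal[OF zS zA])
    have iX: "integrable M (\<lambda>x. (z x)\<^sup>2 * X x)" if "X \<in> S" for X
      using A0_integrable_mult[OF that z2] by (simp add: power2_eq_square)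
    have iz: "integrable M (\<lambda>x. z x * \<Gamma> G z x)"
      by (intro A0_integrable A0_ideal A0_\<Gamma> zS zA GS)
    have "(\<integral>x. z x * z x * L G x \<partial>M) = - (\<integral>x. \<Gamma> G (\<lambda>x. z x * z x) x \<partial>M)"
      using ibp_left[OF GS z2] by simp
    also have "\<Gamma> G (\<lambda>x. z x * z x) = (\<lambda>x. 2 * (z x * \<Gamma> G z x))"
      using GS zS by (simp add: \<Gamma>_mult_right)
    finally have ibp: "(\<integral>x. (z x)\<^sup>2 * L G x \<partial>M) = - 2 * (\<integral>x. z x * \<Gamma> G z x \<partial>M)"
      by (simp add: power2_eq_square)
    have pt: "- (z x * \<Gamma> G z x) \<le> ((z x)\<^sup>2 * N x) / 2 + 2 * G x" for x
    proof -
      have "(z x * \<Gamma> G z x)\<^sup>2 \<le> (z x)\<^sup>2 * (\<Gamma> G G x * \<Gamma> z z x)"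
        unfolding power_mult_distrib by (intro mult_left_mono \<Gamma>_Cauchy_Schwarz GS zS) auto
      also have "\<dots> \<le> (z x)\<^sup>2 * ((4 * G x * N x) * 1)"
        using curvature_improved[OF CD n gb, of x] \<Gamma>_cutoff_le_1[of k x] carre_nonneg[OF zS] G0 N0
        by (intro mult_left_mono mult_mono) (auto simp: G_def N_def z_def)
      finally have "(z x * \<Gamma> G z x)\<^sup>2 \<le> ((z x)\<^sup>2 * N x) * (4 * G x)" by (simp add: mult_ac)
      from abs_le_mean_if_square_le[OF this] show ?thesis
        using G0[of x] N0[of x] by (simp add: abs_le_iff)
    qed
    have "(\<integral>x. (z x)\<^sup>2 * N x \<partial>M) = (\<integral>x. (z x)\<^sup>2 * L G x / 2 - (z x)\<^sup>2 * \<Gamma> g (L g) x - \<rho> * ((z x)\<^sup>2 * G x) \<partial>M)"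
      by (intro Bochner_Integration.integral_cong) (auto simp: N_def Gamma2_def G_def field_simps)
    also have "\<dots> = (\<integral>x. (z x)\<^sup>2 * L G x \<partial>M) / 2 - (\<integral>x. (z x)\<^sup>2 * \<Gamma> g (L g) x \<partial>M) - \<rho> * (\<integral>x. (z x)\<^sup>2 * G x \<partial>M)"
      using iX[OF L_S[OF GS]] iX[OF \<Gamma>_S[OF gS L_S[OF gS]]] iX[OF GS] by simp
    also have "\<dots> = (\<integral>x. - (z x * \<Gamma> G z x) - (z x)\<^sup>2 * \<Gamma> g (L g) x - \<rho> * ((z x)\<^sup>2 * G x) \<partial>M)"
      using iz iX[OF \<Gamma>_S[OF gS L_S[OF gS]]] iX[OF GS] by (simp add: ibp)
    also have "\<dots> \<le> (\<integral>x. ((z x)\<^sup>2 * N x) / 2 + (2 * G x + \<bar>\<Gamma> g (L g) x\<bar> + \<bar>\<rho>\<bar> * G x) \<partial>M)"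
    proof (rule integral_mono)
      fix x
      have z2: "0 \<le> (z x)\<^sup>2" "(z x)\<^sup>2 \<le> 1" using z0 z1 by (auto simp: power_le_one)
      have "\<bar>(z x)\<^sup>2 * \<Gamma> g (L g) x\<bar> \<le> 1 * \<bar>\<Gamma> g (L g) x\<bar>"
        unfolding abs_mult using z2 by (intro mult_right_mono) auto
      moreover have "\<bar>\<rho> * ((z x)\<^sup>2 * G x)\<bar> \<le> \<bar>\<rho>\<bar> * (1 * G x)"
        unfolding abs_mult using z2 G0[of x] by (intro mult_left_mono mult_mono) auto
      ultimately show "- (z x * \<Gamma> G z x) - (z x)\<^sup>2 * \<Gamma> g (L g) x - \<rho> * ((z x)\<^sup>2 * G x)
          \<le> ((z x)\<^sup>2 * N x) / 2 + (2 * G x + \<bar>\<Gamma> g (L g) x\<bar> + \<bar>\<rho>\<bar> * G x)"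
        using pt[of x] by linarith
    qed (use iz iX[OF \<Gamma>_S[OF gS L_S[OF gS]]] iX[OF GS] iX[OF NS] iG in auto)
    also have "\<dots> = (\<integral>x. (z x)\<^sup>2 * N x \<partial>M) / 2 + K / 2"
      unfolding K_def using iX[OF NS] iG by simp
    finally show ?thesis by (simp add: z_def)
  qed
  from integrable_by_cutoff(1)[OF NS N0 this]
  show "integrable M (\<lambda>x. Gamma2 L g x - \<rho> * \<Gamma> g g x)" by (simp add: N_def G_def)
  show "0 \<le> Gamma2 L g x - \<rho> * \<Gamma> g g x" using N0[of x] by (simp add: N_def G_def)
qed

text \<open>
  Moving \<open>L\<close> from \<open>H\<close> to \<open>k\<close> under a cutoff leaves the errors \<open>H \<Gamma>(k, \<zeta>_j)\<close> and \<open>k \<Gamma>(H, \<zeta>_j)\<close>.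
  As \<open>\<Gamma>(\<zeta>_j) \<le> 1/(j+1)\<close>, they vanish in the limit as soon as \<open>H \<surd>\<Gamma>(k)\<close> and \<open>k \<surd>\<Gamma>(H)\<close> are
  integrable.  Only an integrable lower bound of \<open>k L H\<close> is passed to the limit, since \<open>k L H\<close>
  itself is not known to be integrable.
\<close>

lemma integrate_generator_inequality:
  assumes k: "k \<in> tame" and H: "H \<in> S" "integrable M H"
    and e1: "integrable M (\<lambda>x. k x * sqrt (\<Gamma> H H x))" and e2: "integrable M (\<lambda>x. H x * sqrt (\<Gamma> k k x))"
    and q: "integrable M q" "\<And>x. q x \<le> k x * L H x"
  shows "(\<integral>x. q x \<partial>M) \<le> (\<integral>x. L k x * H x \<partial>M)"
proof -
  note kS = tame_S[OF k]
  define J where "J = (\<integral>x. \<bar>k x * sqrt (\<Gamma> H H x)\<bar> + \<bar>H x * sqrt (\<Gamma> k k x)\<bar> \<partial>M)"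
  have iLk: "integrable M (\<lambda>x. L k x * H x)" by (rule tame_integrable_mult(2)[OF k H(2)])
  have step: "(\<integral>x. cutoff j x * q x \<partial>M) \<le> (\<integral>x. cutoff j x * (L k x * H x) \<partial>M) + sqrt (inverse (real (Suc j))) * J" for j
  proof -
    define z where "z = cutoff j"
    have zA: "z \<in> A0" and zS: "z \<in> S" and z0: "0 \<le> z x" and z1: "z x \<le> 1" for x
      by (auto simp: z_def cutoff_A0 cutoff_S cutoff_nonneg cutoff_le_1)
    have zz: "\<bar>z x\<bar> \<le> 1" for x using z0 z1 by simp
    have kz: "(\<lambda>x. k x * z x) \<in> A0" and Hz: "(\<lambda>x. H x * z x) \<in> A0" by (intro A0_ideal kS H zA)+
    define a where "a = (\<lambda>x. k x * \<Gamma> H z x)"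
    define b where "b = (\<lambda>x. H x * \<Gamma> k z x)"
    define c where "c = (\<lambda>x. \<Gamma> H k x * z x)"
    have abc: "a \<in> A0" "b \<in> A0" "c \<in> A0"
      unfolding a_def b_def c_def by (intro A0_ideal A0_\<Gamma> \<Gamma>_S kS H zA)+
    note iabc = abc[THEN A0_integrable]
    have e1': "(\<integral>x. k x * z x * L H x \<partial>M) = - (\<integral>x. a x + c x \<partial>M)"
    proof -
      have "\<Gamma> H (\<lambda>x. k x * z x) = (\<lambda>x. a x + c x)"
        unfolding a_def c_def using kS zS H by (simp add: \<Gamma>_mult_right mult.commute)
      then show ?thesis using ibp_left[OF H(1) kz] by simp
    qed
    have e2': "(\<integral>x. H x * z x * L k x \<partial>M) = - (\<integral>x. b x + c x \<partial>M)"
    proof -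
      have "\<Gamma> k (\<lambda>x. H x * z x) = (\<lambda>x. b x + c x)"
        unfolding b_def c_def using kS zS H by (simp add: \<Gamma>_mult_right mult.commute \<Gamma>_commute[of k H])
      then show ?thesis using ibp_left[OF kS Hz] by simp
    qed
    have "(\<integral>x. z x * q x \<partial>M) \<le> (\<integral>x. k x * z x * L H x \<partial>M)"
    proof (rule integral_mono)
      show "integrable M (\<lambda>x. z x * q x)" by (rule integrable_bounded_mult[OF S_meas[OF zS] zz q(1)])
      show "integrable M (\<lambda>x. k x * z x * L H x)" by (rule A0_integrable_mult[OF L_S[OF H(1)] kz])
      show "z x * q x \<le> k x * z x * L H x" for x
        using mult_left_mono[OF q(2)[of x] z0[of x]] by (simp add: mult_ac)
    qed
    also have "\<dots> = (\<integral>x. H x * z x * L k x \<partial>M) + (\<integral>x. b x - a x \<partial>M)"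
      unfolding e1' e2' using iabc by simp
    also have "(\<integral>x. b x - a x \<partial>M) \<le> (\<integral>x. sqrt (inverse (real (Suc j))) * (\<bar>k x * sqrt (\<Gamma> H H x)\<bar> + \<bar>H x * sqrt (\<Gamma> k k x)\<bar>) \<partial>M)"
    proof (rule integral_mono)
      fix x
      have r: "\<bar>\<Gamma> f z x\<bar> \<le> sqrt (\<Gamma> f f x) * sqrt (inverse (real (Suc j)))" if "f \<in> S" for f
      proof -
        have "\<bar>\<Gamma> f z x\<bar> \<le> sqrt (\<Gamma> f f x) * sqrt (\<Gamma> z z x)" by (rule abs_\<Gamma>_le_sqrt[OF that zS])
        also have "\<dots> \<le> sqrt (\<Gamma> f f x) * sqrt (inverse (real (Suc j)))"
          using \<Gamma>_cutoff[of j x] carre_nonneg[OF that]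
          by (intro mult_left_mono) (auto simp: z_def inverse_eq_divide)
        finally show ?thesis .
      qed
      have "\<bar>a x\<bar> \<le> \<bar>k x\<bar> * (sqrt (\<Gamma> H H x) * sqrt (inverse (real (Suc j))))"
        unfolding a_def abs_mult by (intro mult_left_mono r H) auto
      moreover have "\<bar>b x\<bar> \<le> \<bar>H x\<bar> * (sqrt (\<Gamma> k k x) * sqrt (inverse (real (Suc j))))"
        unfolding b_def abs_mult by (intro mult_left_mono r kS) auto
      ultimately have "b x - a x \<le> \<bar>k x\<bar> * (sqrt (\<Gamma> H H x) * sqrt (inverse (real (Suc j))))
          + \<bar>H x\<bar> * (sqrt (\<Gamma> k k x) * sqrt (inverse (real (Suc j))))" by linarith
      also have "\<dots> = sqrt (inverse (real (Suc j))) * (\<bar>k x * sqrt (\<Gamma> H H x)\<bar> + \<bar>H x * sqrt (\<Gamma> k k x)\<bar>)"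
        using carre_nonneg[OF H(1), of x] carre_nonneg[OF kS, of x]
        by (simp only: abs_mult real_sqrt_abs2 abs_of_nonneg real_sqrt_ge_zero distrib_left mult_ac)
      finally show "b x - a x \<le> sqrt (inverse (real (Suc j))) * (\<bar>k x * sqrt (\<Gamma> H H x)\<bar> + \<bar>H x * sqrt (\<Gamma> k k x)\<bar>)" .
    qed (use iabc e1 e2 in auto)
    also have "\<dots> = sqrt (inverse (real (Suc j))) * J" by (simp add: J_def)
    finally show ?thesis by (simp add: z_def mult_ac)
  qed
  have "(\<lambda>j. (\<integral>x. cutoff j x * (L k x * H x) \<partial>M) + sqrt (inverse (real (Suc j))) * J)
      \<longlonglongrightarrow> (\<integral>x. L k x * H x \<partial>M) + sqrt 0 * J"
    by (intro tendsto_intros cutoff_limit iLk LIMSEQ_inverse_real_of_nat)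
  with cutoff_limit[OF q(1)] have "(\<integral>x. q x \<partial>M) \<le> (\<integral>x. L k x * H x \<partial>M) + sqrt 0 * J"
    by (rule LIMSEQ_le) (use step in blast)
  then show ?thesis by simp
qed

end

section \<open>Evolution of convex gradient functionals\<close>

text \<open>
  The function \<open>exp (c s) \<Phi>(s)\<close> has increments bounded below by a quadratic error.
\<close>

lemma backward_gronwall:
  fixes \<Phi> :: "real \<Rightarrow> real"
  assumes T: "T \<ge> 0" and c: "c \<ge> 0"
    and range: "\<And>s. 0 \<le> s \<Longrightarrow> s \<le> T \<Longrightarrow> 0 \<le> \<Phi> s \<and> \<Phi> s \<le> B"
    and step: "\<And>a b. 0 \<le> a \<Longrightarrow> a < b \<Longrightarrow> b \<le> T \<Longrightarrow> \<Phi> b - \<Phi> a \<ge> (b - a) * (- c * \<Phi> a) - C * (b - a)\<^sup>2"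
  shows "\<Phi> 0 \<le> exp (c * T) * \<Phi> T"
proof -
  have B: "B \<ge> 0" using range[of 0] T by auto
  define K where "K = \<bar>C\<bar> + c\<^sup>2 * B"
  have K: "K \<ge> 0" using B by (simp add: K_def)
  have "exp (c * T) * \<Phi> T - exp (c * 0) * \<Phi> 0 \<ge> 0 * T"
  proof (rule superlinear_growth[OF T, where C = "exp (c * T) * K"])
    fix a b :: real assume ab: "0 \<le> a" "a \<le> b" "b \<le> T"
    show "0 * (b - a) - exp (c * T) * K * (b - a)\<^sup>2 \<le> exp (c * b) * \<Phi> b - exp (c * a) * \<Phi> a"
    proof (cases "a = b")
      case False
      define x where "x = c * (b - a)"
      have x: "x \<ge> 0" using c ab by (simp add: x_def)
      have Pa: "0 \<le> \<Phi> a" "\<Phi> a \<le> B" using range[of a] ab by auto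
      have "1 \<le> (1 + x) * (1 - x + x\<^sup>2)"
      proof -
        have "(1 + x) * (1 - x + x\<^sup>2) = 1 + x ^ 3" by (simp add: power2_eq_square power3_eq_cube algebra_simps)
        then show ?thesis using x by simp
      qed
      also have "\<dots> \<le> exp x * (1 - x + x\<^sup>2)"
      proof (rule mult_right_mono[OF exp_ge_add_one_self])
        show "0 \<le> 1 - x + x\<^sup>2" using zero_le_power2[of "x - 1"] x by (simp add: power2_diff)
      qed
      finally have "exp (c * a) * \<Phi> a * 1 \<le> exp (c * a) * \<Phi> a * (exp x * (1 - x + x\<^sup>2))"
        using Pa by (intro mult_left_mono) auto
      also have "\<dots> = exp (c * b) * ((1 - x + x\<^sup>2) * \<Phi> a)"
        by (simp add: x_def exp_diff right_diff_distrib)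
      also have "\<dots> \<le> exp (c * b) * (\<Phi> b + K * (b - a)\<^sup>2)"
      proof (rule mult_left_mono)
        have "C * (b - a)\<^sup>2 \<le> \<bar>C\<bar> * (b - a)\<^sup>2" by (intro mult_right_mono abs_ge_self) auto
        moreover have "\<Phi> b - \<Phi> a \<ge> (b - a) * (- c * \<Phi> a) - C * (b - a)\<^sup>2"
          using ab False by (intro step) auto
        moreover have "x\<^sup>2 * \<Phi> a \<le> x\<^sup>2 * B" using Pa by (intro mult_left_mono) auto
        moreover have "x\<^sup>2 * B = c\<^sup>2 * B * (b - a)\<^sup>2" by (simp add: x_def power_mult_distrib)
        moreover have "(1 - x + x\<^sup>2) * \<Phi> a = \<Phi> a + (b - a) * (- c * \<Phi> a) + x\<^sup>2 * \<Phi> a"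
          by (simp add: x_def algebra_simps)
        ultimately show "(1 - x + x\<^sup>2) * \<Phi> a \<le> \<Phi> b + K * (b - a)\<^sup>2"
          by (simp only: K_def distrib_right)
      qed simp
      also have "\<dots> \<le> exp (c * b) * \<Phi> b + exp (c * T) * (K * (b - a)\<^sup>2)"
        unfolding distrib_left using ab c K by (intro add_left_mono mult_right_mono) (auto intro: mult_left_mono)
      finally show ?thesis by simp
    qed simp
  qed
  then show ?thesis by simp
qed

context markov_diffusion_triple
begin

text \<open>
  Here \<open>H\<close> and \<open>H'\<close> are the values at times \<open>a\<close> and \<open>b\<close> of a functional that is convex in \<open>v\<close> and
  its gradient, where \<open>v_s = P_{T-s} f\<close>.  The coefficients \<open>\<alpha>\<close> and \<open>\<beta>\<close> are its derivatives at time
  \<open>a\<close> with respect to \<open>\<Gamma>(v)\<close> and to \<open>v\<close>, so that the inequality for \<open>H'\<close> is the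
  supporting hyperplane.  The last clause bounds \<open>(L + \<partial>_s) H\<close> from below, with \<open>\<partial>_s v = - L v\<close>
  inserted in the linearization.
\<close>

definition convex_subsolution ::
    "('a \<Rightarrow> real) \<Rightarrow> ('a \<Rightarrow> real) \<Rightarrow> real \<Rightarrow> real \<Rightarrow> real \<Rightarrow> real \<Rightarrow> ('a \<Rightarrow> real) \<Rightarrow> ('a \<Rightarrow> real) \<Rightarrow>
      ('a \<Rightarrow> real) \<Rightarrow> ('a \<Rightarrow> real) \<Rightarrow> ('a \<Rightarrow> real) \<Rightarrow> bool"
  where "convex_subsolution u f T c a b H H' \<alpha> \<beta> q \<longleftrightarrow>
    0 \<le> a \<and> a < b \<and> b \<le> T \<and> H \<in> S \<and> integrable M H' \<and> integrable M q \<and>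
    \<alpha> \<in> borel_measurable M \<and> \<beta> \<in> borel_measurable M \<and>
    (\<forall>x. \<bar>H x\<bar> \<le> c * \<Gamma> (P (T - a) f) (P (T - a) f) x) \<and>
    (\<forall>x. \<bar>\<alpha> x\<bar> \<le> c) \<and>
    (\<forall>x. \<bar>\<beta> x\<bar> \<le> c * \<Gamma> (P (T - a) f) (P (T - a) f) x) \<and>
    (\<forall>x. H' x \<ge> H x
      + 2 * \<alpha> x * (\<Gamma> (P (T - b) f) (P (T - a) f) x - \<Gamma> (P (T - a) f) (P (T - a) f) x)
      + \<beta> x * (P (T - b) f x - P (T - a) f x)) \<and>
    integrable M (\<lambda>x. P a u x * sqrt (\<Gamma> H H x)) \<and>
    integrable M (\<lambda>x. H x * sqrt (\<Gamma> (P a u) (P a u) x)) \<and>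
    (\<forall>x. q x \<le> P a u x * (L H x - 2 * \<alpha> x * \<Gamma> (L (P (T - a) f)) (P (T - a) f) x
      - \<beta> x * L (P (T - a) f) x))"

text \<open>
  Formally the derivative of \<open>\<integral> P_s u H_s\<close> is \<open>\<integral> P_s u (L + \<partial>_s) H_s\<close>.  Only increments from below are
  needed, and there the supporting hyperplane replaces \<open>H'\<close> by an affine function of \<open>v_b - v_a\<close>.
  The first-order Taylor expansions of \<open>v\<close> and of \<open>P_s u\<close> then apply; their remainders are of
  second order in supremum norm, and that of \<open>v\<close> also in energy.
\<close>

lemma evolution_step:
  assumes u: "u \<in> A0" "\<And>x. 0 \<le> u x" and f: "f \<in> A0" and c: "c \<ge> 0"
  obtains C where "\<And>a b H H' \<alpha> \<beta> q. convex_subsolution u f T c a b H H' \<alpha> \<beta> q \<Longrightarrow>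
      (\<integral>x. P b u x * H' x \<partial>M) - (\<integral>x. P a u x * H x \<partial>M) \<ge> (b - a) * (\<integral>x. q x \<partial>M) - C * (b - a)\<^sup>2"
proof -
  have Lf: "L f \<in> A0" and Lu: "L u \<in> A0" by (intro A0_L f u)+
  obtain Cu where Cu: "Cu \<ge> 0" "\<And>x. \<bar>u x\<bar> \<le> Cu" using A0_boundedE[OF u(1)] by blast
  obtain C1 where C1: "C1 \<ge> 0" "\<And>x. \<bar>L u x\<bar> \<le> C1" using A0_boundedE[OF Lu] by blast
  obtain CQ where CQ: "CQ \<ge> 0" "\<And>x. \<bar>L (L u) x\<bar> \<le> CQ" using A0_boundedE[OF A0_L[OF Lu]] by blast
  obtain Cf where Cf: "Cf \<ge> 0" "\<And>x. \<bar>L f x\<bar> \<le> Cf" using A0_boundedE[OF Lf] by blast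
  obtain C2 where C2: "C2 \<ge> 0" "\<And>x. \<bar>L (L f) x\<bar> \<le> C2" using A0_boundedE[OF A0_L[OF Lf]] by blast
  obtain K0 where K0: "K0 \<ge> 0" "\<And>t. t \<ge> 0 \<Longrightarrow> (\<integral>x. \<Gamma> (P t f) (P t f) x \<partial>M) \<le> K0"
    by (rule uniform_energy[OF f]) blast
  obtain K1 where K1: "K1 \<ge> 0" "\<And>t. t \<ge> 0 \<Longrightarrow> (\<integral>x. \<Gamma> (P t (L f)) (P t (L f)) x \<partial>M) \<le> K1"
    by (rule uniform_energy[OF Lf]) blast
  obtain K2 where K2: "K2 \<ge> 0" "\<And>a b. a \<ge> 0 \<Longrightarrow> b \<ge> 0 \<Longrightarrow>
      (\<integral>x. \<Gamma> (remainder f a b) (remainder f a b) x \<partial>M) \<le> K2 * (b - a) ^ 4"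
    by (rule energy_remainder[OF f]) blast
  \<comment> \<open>dominates the coefficients of \<open>\<Gamma>(v)\<close>, \<open>\<Gamma>(L v)\<close> and \<open>\<Gamma>(R)\<close> in the error of the expansion\<close>
  define B where "B = c * (CQ + C1 * (1 + Cf) + Cu * (1 + C2))"
  have B: "B \<ge> 0" unfolding B_def using c CQ(1) C1(1) Cf(1) Cu(1) C2(1) by simp
  show ?thesis
  proof (rule that[of "B * (K0 + K1 + K2)"])
    fix a b :: real and H H' \<alpha> \<beta> q :: "'a \<Rightarrow> real"
    define v where "v = P (T - a) f"
    define v' where "v' = P (T - b) f"
    define k where "k = P a u"
    define k' where "k' = P b u"
    assume "convex_subsolution u f T c a b H H' \<alpha> \<beta> q"
    then have ab: "0 \<le> a" "a < b" "b \<le> T"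
      and HS: "H \<in> S" and H': "integrable M H'"
      and \<alpha>m: "\<alpha> \<in> borel_measurable M" and \<beta>m: "\<beta> \<in> borel_measurable M"
      and Hb: "\<forall>x. \<bar>H x\<bar> \<le> c * \<Gamma> (P (T - a) f) (P (T - a) f) x"
      and \<alpha>b: "\<forall>x. \<bar>\<alpha> x\<bar> \<le> c"
      and \<beta>b: "\<forall>x. \<bar>\<beta> x\<bar> \<le> c * \<Gamma> (P (T - a) f) (P (T - a) f) x"
      and conv: "\<forall>x. H' x \<ge> H x + 2 * \<alpha> x * (\<Gamma> (P (T - b) f) (P (T - a) f) x - \<Gamma> (P (T - a) f) (P (T - a) f) x)
            + \<beta> x * (P (T - b) f x - P (T - a) f x)"
      and e1: "integrable M (\<lambda>x. P a u x * sqrt (\<Gamma> H H x))"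
      and e2: "integrable M (\<lambda>x. H x * sqrt (\<Gamma> (P a u) (P a u) x))"
      and qi: "integrable M q"
      and qb: "\<forall>x. q x \<le> P a u x * (L H x - 2 * \<alpha> x * \<Gamma> (L (P (T - a) f)) (P (T - a) f) x
            - \<beta> x * L (P (T - a) f) x)"
      unfolding convex_subsolution_def by blast+
    note Hb = Hb[rule_format, folded v_def] and \<alpha>b = \<alpha>b[rule_format]
      and \<beta>b = \<beta>b[rule_format, folded v_def] and conv = conv[rule_format, folded v_def v'_def]
      and e1 = e1[folded k_def] and e2 = e2[folded k_def] and qb = qb[rule_format, folded v_def k_def]
    define d where "d = b - a"
    have d: "d > 0" using ab by (simp add: d_def)
    have times: "0 \<le> T - a" "0 \<le> T - b" "0 \<le> b" using ab by auto
    define R where "R = remainder f (T - a) (T - b)"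
    have Rt: "R \<in> tame" unfolding R_def by (rule tame_remainder[OF f times(1,2)])
    have kt: "k \<in> tame" "k' \<in> tame" unfolding k_def k'_def by (intro tame_P ab times u)+
    have vt: "v \<in> tame" "v' \<in> tame" unfolding v_def v'_def by (intro tame_P times f)+
    have Lv: "L v = P (T - a) (L f)" unfolding v_def by (rule L_P_commute[OF f times(1)])
    have Lvt: "L v \<in> tame" unfolding Lv by (intro tame_P times Lf)
    note S = kt[THEN tame_S] vt[THEN tame_S] Lvt[THEN tame_S] Rt[THEN tame_S]
    have v'_eq: "v' = (\<lambda>x. v x - d * L v x + R x)"
      unfolding R_def remainder_def Lv unfolding v_def v'_def d_def by (auto simp: algebra_simps)
    have \<Gamma>v': "\<Gamma> v' v x - \<Gamma> v v x = \<Gamma> R v x - d * \<Gamma> (L v) v x" for x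
      unfolding v'_eq using S by (simp add: \<Gamma>_linear S_closed)
    define G where "G = \<Gamma> v v"
    have G0: "0 \<le> G x" for x unfolding G_def by (rule carre_nonneg[OF S(3)])
    define Hd where "Hd = (\<lambda>x. - 2 * \<alpha> x * \<Gamma> (L v) v x - \<beta> x * L v x)"
    define bd where "bd = (\<lambda>x. d\<^sup>2 * (B * (G x + \<Gamma> (L v) (L v) x)) + B / d\<^sup>2 * \<Gamma> R R x)"
    have iG: "integrable M G" "integrable M (\<Gamma> (L v) (L v))" "integrable M (\<Gamma> R R)" "integrable M (\<Gamma> (L v) v)"
      unfolding G_def by (intro tame_\<Gamma>_integrable vt Lvt Rt)+
    have Lvb: "\<bar>L v x\<bar> \<le> Cf" for x unfolding Lv by (rule P_A0_bound[OF times(1) Lf Cf(2)])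
    have Hd_b: "\<bar>Hd x\<bar> \<le> c * ((1 + Cf) * G x + \<Gamma> (L v) (L v) x)" for x
    proof -
      have "\<bar>2 * \<alpha> x * \<Gamma> (L v) v x\<bar> \<le> c * (\<Gamma> (L v) (L v) x + G x)"
      proof -
        have "\<bar>\<alpha> x\<bar> * (2 * \<bar>\<Gamma> (L v) v x\<bar>) \<le> c * (\<Gamma> (L v) (L v) x + G x)"
          using abs_\<Gamma>_le[OF S(5,3), of x] \<alpha>b[of x] c by (intro mult_mono) (auto simp: G_def)
        then show ?thesis by (simp add: abs_mult mult_ac)
      qed
      moreover have "\<bar>\<beta> x * L v x\<bar> \<le> c * G x * Cf"
        unfolding abs_mult using \<beta>b[of x] Lvb[of x] c G0[of x] by (intro mult_mono) (auto simp: G_def)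
      ultimately show ?thesis unfolding Hd_def by (simp add: algebra_simps)
    qed
    have Hd_m: "Hd \<in> borel_measurable M"
      unfolding Hd_def using \<alpha>m \<beta>m S_meas[OF S(5)] S_meas[OF \<Gamma>_S[OF S(5,3)]] by measurable
    have Hd_i: "integrable M Hd"
    proof (rule Bochner_Integration.integrable_bound[OF _ Hd_m])
      show "integrable M (\<lambda>x. c * ((1 + Cf) * G x + \<Gamma> (L v) (L v) x))" using iG by simp
      show "AE x in M. norm (Hd x) \<le> norm (c * ((1 + Cf) * G x + \<Gamma> (L v) (L v) x))"
        using Hd_b by (auto intro: order_trans[OF _ abs_ge_self])
    qed
    have H_i: "integrable M H"
    proof (rule Bochner_Integration.integrable_bound[OF _ S_meas[OF HS]])
      show "integrable M (\<lambda>x. c * G x)" using iG by simp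
      show "AE x in M. norm (H x) \<le> norm (c * G x)"
        using Hb by (auto simp: G_def intro: order_trans[OF _ abs_ge_self])
    qed
    note kHd = tame_integrable_mult(1)[OF kt(1) Hd_i] and LkH = tame_integrable_mult(2)[OF kt(1) H_i]
      and kH = tame_integrable_mult(1)[OF kt(1) H_i]
    have "(\<integral>x. q x - k x * Hd x \<partial>M) \<le> (\<integral>x. L k x * H x \<partial>M)"
    proof (rule integrate_generator_inequality[OF kt(1) HS H_i e1 e2])
      show "integrable M (\<lambda>x. q x - k x * Hd x)" using qi kHd by simp
      show "q x - k x * Hd x \<le> k x * L H x" for x
        using qb[of x] by (simp add: Hd_def algebra_simps)
    qed
    then have main: "(\<integral>x. q x \<partial>M) \<le> (\<integral>x. k x * Hd x \<partial>M) + (\<integral>x. L k x * H x \<partial>M)"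
      using qi kHd by simp
    have pt: "k x * H x + d * (k x * Hd x + L k x * H x) - bd x \<le> k' x * H' x" for x
    proof -
      have k'0: "0 \<le> k' x" unfolding k'_def by (rule P_A0_nonneg[OF times(3) u])
      have k'C: "k' x \<le> Cu" using P_A0_bound[OF times(3) u(1) Cu(2), of x] by (simp add: k'_def abs_le_iff)
      have Lk: "L k = P a (L u)" unfolding k_def by (rule L_P_commute[OF u(1) ab(1)])
      have Q: "\<bar>k' x - k x - d * L k x\<bar> \<le> CQ * d\<^sup>2"
        unfolding Lk unfolding k_def k'_def d_def by (rule uniform_remainder[OF u(1) ab(1) times(3) CQ(2)])
      have k1: "\<bar>k' x - k x\<bar> \<le> C1 * d"
        using uniform_lipschitz[OF u(1) ab(1) times(3) C1(2), of x] d by (simp add: k_def k'_def d_def)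
      have Rb: "\<bar>R x\<bar> \<le> C2 * d\<^sup>2"
        using uniform_remainder[OF f times(1,2) C2(2), of x]
        by (simp add: R_def remainder_def d_def power2_commute)
      \<comment> \<open>the energy of \<open>R\<close> is of fourth order in \<open>d\<close>, so both terms are of second order\<close>
      have \<Gamma>R: "2 * \<bar>\<Gamma> R v x\<bar> \<le> \<Gamma> R R x / d\<^sup>2 + d\<^sup>2 * G x"
        using \<Gamma>_quadratic[OF S(6,3), of "1 / d" x d] \<Gamma>_quadratic[OF S(6,3), of "1 / d" x "- d"] d
        by (simp add: G_def power_divide abs_le_iff)
      define E where "E = 2 * \<alpha> x * \<Gamma> R v x + \<beta> x * R x"
      have Eb: "\<bar>E\<bar> \<le> c * (\<Gamma> R R x / d\<^sup>2 + d\<^sup>2 * G x) + c * G x * (C2 * d\<^sup>2)"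
      proof -
        have "\<bar>\<alpha> x\<bar> * (2 * \<bar>\<Gamma> R v x\<bar>) \<le> c * (\<Gamma> R R x / d\<^sup>2 + d\<^sup>2 * G x)"
          using \<Gamma>R \<alpha>b[of x] c by (intro mult_mono) auto
        then have "\<bar>2 * \<alpha> x * \<Gamma> R v x\<bar> \<le> c * (\<Gamma> R R x / d\<^sup>2 + d\<^sup>2 * G x)" by (simp add: abs_mult mult_ac)
        moreover have "\<bar>\<beta> x * R x\<bar> \<le> c * G x * (C2 * d\<^sup>2)"
          unfolding abs_mult using \<beta>b[of x] Rb c G0[of x] by (intro mult_mono) (auto simp: G_def)
        ultimately show ?thesis unfolding E_def by linarith
      qed
      have "H' x \<ge> H x + d * Hd x + E"
      proof -
        have "v' x - v x = R x - d * L v x" by (simp add: v'_eq)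
        then show ?thesis using conv[of x] unfolding \<Gamma>v' E_def Hd_def
          by (simp only:) (simp add: algebra_simps)
      qed
      then have "k' x * H' x \<ge> k' x * (H x + d * Hd x + E)" using k'0 by (rule mult_left_mono)
      also have "k' x * (H x + d * Hd x + E) = k x * H x + d * (k x * Hd x + L k x * H x)
          + ((k' x - k x - d * L k x) * H x + d * ((k' x - k x) * Hd x) + k' x * E)"
        by (simp add: algebra_simps)
      finally have low: "k' x * H' x \<ge> k x * H x + d * (k x * Hd x + L k x * H x)
          + ((k' x - k x - d * L k x) * H x + d * ((k' x - k x) * Hd x) + k' x * E)" .
      have t1: "\<bar>(k' x - k x - d * L k x) * H x\<bar> \<le> (CQ * d\<^sup>2) * (c * G x)"
        unfolding abs_mult using Q Hb[of x] CQ(1) by (intro mult_mono) (auto simp: G_def)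
      have t2: "\<bar>d * ((k' x - k x) * Hd x)\<bar> \<le> d * ((C1 * d) * (c * ((1 + Cf) * G x + \<Gamma> (L v) (L v) x)))"
      proof -
        have "\<bar>k' x - k x\<bar> * \<bar>Hd x\<bar> \<le> (C1 * d) * (c * ((1 + Cf) * G x + \<Gamma> (L v) (L v) x))"
          using k1 Hd_b[of x] C1(1) d by (intro mult_mono) auto
        then show ?thesis using d by (simp add: abs_mult)
      qed
      have t3: "\<bar>k' x * E\<bar> \<le> Cu * (c * (\<Gamma> R R x / d\<^sup>2 + d\<^sup>2 * G x) + c * G x * (C2 * d\<^sup>2))"
        unfolding abs_mult using k'0 k'C Eb Cu(1) by (intro mult_mono) auto
      have "(CQ * d\<^sup>2) * (c * G x) + d * ((C1 * d) * (c * ((1 + Cf) * G x + \<Gamma> (L v) (L v) x)))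
          + Cu * (c * (\<Gamma> R R x / d\<^sup>2 + d\<^sup>2 * G x) + c * G x * (C2 * d\<^sup>2))
        = d\<^sup>2 * (B * G x + (c * C1) * \<Gamma> (L v) (L v) x) + (c * Cu) * (\<Gamma> R R x / d\<^sup>2)"
        unfolding B_def by (simp add: algebra_simps power2_eq_square)
      also have "\<dots> \<le> d\<^sup>2 * (B * G x + B * \<Gamma> (L v) (L v) x) + B * (\<Gamma> R R x / d\<^sup>2)"
      proof -
        have "c * C1 \<le> B" "c * Cu \<le> B"
          unfolding B_def using c CQ(1) C1(1) Cf(1) Cu(1) C2(1)
          by (auto intro!: mult_left_mono simp: algebra_simps)
        then show ?thesis using carre_nonneg[OF S(5), of x] carre_nonneg[OF S(6), of x] B
          by (intro add_mono mult_left_mono mult_right_mono) auto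
      qed
      also have "\<dots> = bd x" by (simp add: bd_def algebra_simps)
      finally show ?thesis using low t1 t2 t3 by (simp only: abs_le_iff) linarith
    qed
    have bd_i: "integrable M bd" unfolding bd_def using iG by simp
    have bd_int: "(\<integral>x. bd x \<partial>M) \<le> B * (K0 + K1 + K2) * d\<^sup>2"
    proof -
      have "(\<integral>x. bd x \<partial>M) = d\<^sup>2 * (B * ((\<integral>x. G x \<partial>M) + (\<integral>x. \<Gamma> (L v) (L v) x \<partial>M))) + B / d\<^sup>2 * (\<integral>x. \<Gamma> R R x \<partial>M)"
        unfolding bd_def using iG by simp
      also have "\<dots> \<le> d\<^sup>2 * (B * (K0 + K1)) + B / d\<^sup>2 * (K2 * d ^ 4)"
      proof (intro add_mono mult_left_mono)
        show "(\<integral>x. G x \<partial>M) \<le> K0" using K0(2)[OF times(1)] by (simp add: G_def v_def)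
        show "(\<integral>x. \<Gamma> (L v) (L v) x \<partial>M) \<le> K1" using K1(2)[OF times(1)] by (simp add: Lv)
        have "(T - b - (T - a)) ^ 4 = d ^ 4" by (simp add: d_def power4_eq_xxxx algebra_simps)
        then show "(\<integral>x. \<Gamma> R R x \<partial>M) \<le> K2 * d ^ 4" using K2(2)[OF times(1,2)] by (simp add: R_def)
      qed (use B in auto)
      also have "\<dots> = B * (K0 + K1 + K2) * d\<^sup>2"
        using d by (simp add: power4_eq_xxxx power2_eq_square field_simps)
      finally show ?thesis .
    qed
    have "d * (\<integral>x. q x \<partial>M) \<le> d * ((\<integral>x. k x * Hd x \<partial>M) + (\<integral>x. L k x * H x \<partial>M))"
      using main d by (intro mult_left_mono) auto
    also have "\<dots> = (\<integral>x. k x * H x + d * (k x * Hd x + L k x * H x) - bd x \<partial>M) - (\<integral>x. k x * H x \<partial>M) + (\<integral>x. bd x \<partial>M)"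
      using kH kHd LkH bd_i by simp
    also have "\<dots> \<le> (\<integral>x. k' x * H' x \<partial>M) - (\<integral>x. k x * H x \<partial>M) + B * (K0 + K1 + K2) * d\<^sup>2"
    proof -
      have "(\<integral>x. k x * H x + d * (k x * Hd x + L k x * H x) - bd x \<partial>M) \<le> (\<integral>x. k' x * H' x \<partial>M)"
        using kH kHd LkH bd_i tame_integrable_mult(1)[OF kt(2) H'] pt by (intro integral_mono) auto
      then show ?thesis using bd_int by linarith
    qed
    finally show "(b - a) * (\<integral>x. q x \<partial>M) - B * (K0 + K1 + K2) * (b - a)\<^sup>2
        \<le> (\<integral>x. P b u x * H' x \<partial>M) - (\<integral>x. P a u x * H x \<partial>M)"
      by (simp add: k_def k'_def d_def)
  qed
qed

end

section \<open>A uniform gradient bound\<close>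

context markov_diffusion_triple
begin

text \<open>
  The smooth extension of the logarithm makes \<open>exp (log r / 2)\<close> available as a smooth function on
  the line.
\<close>

lemma S_sqrt:
  assumes G: "G \<in> S" and pos: "\<And>x. 0 \<le> G x"
  shows "(\<lambda>x. sqrt (1 + G x)) \<in> S"
proof -
  have "elementary (\<lambda>r. exp (1 / 2 * ln (soft_clamp r)))" by (intro elementary.intros)
  from S_elementary[OF this S_add[OF S_const G, of 1]]
  have "(\<lambda>x. exp (1 / 2 * ln (soft_clamp (1 + G x)))) \<in> S" .
  moreover have "exp (1 / 2 * ln (soft_clamp (1 + G x))) = sqrt (1 + G x)" for x
    using pos[of x] by (simp add: soft_clamp_eq powr_half_sqrt[symmetric] powr_def)
  ultimately show ?thesis by simp
qed

lemma integrable_mult_le_squares: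
  fixes f A B :: "'a \<Rightarrow> real"
  assumes "f \<in> borel_measurable M" "integrable M A" "integrable M B"
    and "\<And>x. (f x)\<^sup>2 \<le> A x * B x" "\<And>x. 0 \<le> A x" "\<And>x. 0 \<le> B x"
  shows "integrable M f"
proof (rule Bochner_Integration.integrable_bound[OF _ assms(1)])
  show "integrable M (\<lambda>x. (A x + B x) / 2)" using assms by simp
  show "AE x in M. norm (f x) \<le> norm ((A x + B x) / 2)"
    using abs_le_mean_if_square_le[OF assms(4-6)] by (auto intro: order_trans[OF _ abs_ge_self])
qed

lemma integrable_dominated_S:
  assumes "f \<in> S" "integrable M g" "\<And>x. \<bar>f x\<bar> \<le> g x"
  shows "integrable M f"
  by (rule Bochner_Integration.integrable_bound[OF assms(2) S_meas[OF assms(1)]])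
     (use assms(3) in \<open>auto intro: order_trans[OF _ abs_ge_self]\<close>)

text \<open>
  The functional \<open>H = \<surd>(1 + \<Gamma>(v)) - 1\<close> is convex in the gradient and comparable to \<open>\<surd>\<Gamma>(v)\<close> where
  \<open>\<Gamma>(v)\<close> is large; this growth puts \<open>H\<close> in \<open>L^2\<close> and, by the improved curvature inequality, makes
  its energy at most \<open>\<Gamma>_2(v) - \<rho> \<Gamma>(v)\<close>, which is integrable.  So the integrations by parts need no
  prior bound on \<open>\<Gamma>(v)\<close>.  One gets \<open>(L + \<partial>_s) H \<ge> - 2 \<bar>\<rho>\<bar> H\<close>, and Gronwall's lemma transports the
  bound on \<open>\<Gamma>(f)\<close> from time \<open>s = t\<close> back to \<open>s = 0\<close>.
\<close>

lemma gradient_bound: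
  assumes CD: "curvature_dimension S L \<rho> n" and n: "n > 0" and f: "f \<in> A0"
    and G0: "\<And>x. \<Gamma> f f x \<le> G0" and t: "t \<ge> 0"
  shows "\<Gamma> (P t f) (P t f) x \<le> (1 + exp (2 * \<bar>\<rho>\<bar> * t) * G0)\<^sup>2"
proof -
  define v where "v s = P (t - s) f" for s
  define G where "G s = \<Gamma> (v s) (v s)" for s
  define W where "W s = (\<lambda>x. sqrt (1 + G s x))" for s
  define H where "H s = (\<lambda>x. W s x - 1)" for s
  define N where "N s = (\<lambda>x. Gamma2 L (v s) x - \<rho> * G s x)" for s
  have fS: "f \<in> S" by (rule A0_in_S[OF f])
  have G0n: "0 \<le> G0" using G0[of undefined] carre_nonneg[OF fS] order_trans by blast
  have vt: "v s \<in> tame" "L (v s) \<in> tame" "v s \<in> S" if "s \<le> t" for s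
    unfolding v_def using that by (auto intro!: tame_P tame_L_P P_A0_S f)
  have GS: "G s \<in> S" and Gp: "0 \<le> G s x" and Gi: "integrable M (G s)" if "s \<le> t" for s x
    unfolding G_def using vt[OF that] by (auto intro: \<Gamma>_S carre_nonneg tame_\<Gamma>_integrable)
  have W2: "W s x * W s x = 1 + G s x" and W1: "1 \<le> W s x" if "s \<le> t" for s x
    using Gp[OF that, of x] by (auto simp: W_def)
  have WS: "W s \<in> S" and HS: "H s \<in> S" if "s \<le> t" for s
    unfolding W_def H_def using S_sqrt[OF GS Gp] that by (auto intro!: S_diff S_const simp: W_def)
  have H0: "0 \<le> H s x" and HG: "H s x \<le> G s x" and HG2: "(H s x)\<^sup>2 \<le> G s x"
    and GH: "G s x \<le> 2 * (W s x * H s x)" if "s \<le> t" for s x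
  proof -
    note W = W1[OF that, of x] W2[OF that, of x]
    show h0: "0 \<le> H s x" using W by (simp add: H_def)
    have GW: "G s x = H s x * (W s x + 1)" using W by (simp add: H_def algebra_simps)
    have "H s x * 1 \<le> H s x * (W s x + 1)" using h0 W by (intro mult_left_mono) auto
    then show "H s x \<le> G s x" by (simp add: GW)
    have "H s x * H s x \<le> H s x * (W s x + 1)" using h0 W by (intro mult_left_mono) (auto simp: H_def)
    then show "(H s x)\<^sup>2 \<le> G s x" by (simp add: GW power2_eq_square)
    have "H s x * (W s x + 1) \<le> H s x * (2 * W s x)" using h0 W by (intro mult_left_mono) auto
    then show "G s x \<le> 2 * (W s x * H s x)" by (simp add: GW mult_ac)
  qed
  have Hi: "integrable M (H s)" if "s \<le> t" for s
    using H0[OF that] HG[OF that] by (intro integrable_dominated_S[OF HS[OF that] Gi[OF that]]) auto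
  have Ni: "integrable M (N s)" and N0: "0 \<le> N s x" if "s \<le> t" for s x
    unfolding N_def G_def using \<Gamma>2_integrable[OF CD n vt(1,2)[OF that]] by auto
  have \<Gamma>H: "\<Gamma> (H s) h = \<Gamma> (W s) h" if "s \<le> t" "h \<in> S" for s h
    unfolding H_def using WS[OF that(1)] that by (simp add: \<Gamma>_linear S_closed)
  have \<Gamma>W: "(W s x)\<^sup>2 * \<Gamma> (W s) (W s) x \<le> G s x * N s x" if s: "s \<le> t" for s x
  proof -
    note S = WS[OF s] GS[OF s]
    have "(\<lambda>y. W s y * W s y) = (\<lambda>y. 1 + G s y)" using W2[OF s] by auto
    then have eq: "\<Gamma> (\<lambda>y. W s y * W s y) (\<lambda>y. W s y * W s y) x = \<Gamma> (G s) (G s) x"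
      using S by (simp add: \<Gamma>_linear S_closed)
    obtain C where C: "\<And>x. \<bar>v s x\<bar> \<le> C" by (rule tameE[OF vt(1)[OF s]]) blast
    have "\<Gamma> (G s) (G s) x \<le> 4 * G s x * N s x"
      unfolding G_def N_def
      by (rule curvature_improved[OF CD n bounded_algebraI[OF vt(3)[OF s] C]])
    then show ?thesis
      using eq S by (simp add: \<Gamma>_mult_left \<Gamma>_mult_right S_closed power2_eq_square mult_ac)
  qed
  have \<Gamma>WN: "\<Gamma> (W s) (W s) x \<le> N s x" if s: "s \<le> t" for s x
  proof -
    have "(W s x)\<^sup>2 * \<Gamma> (W s) (W s) x \<le> (W s x)\<^sup>2 * N s x"
      using \<Gamma>W[OF s, of x] N0[OF s, of x] W2[OF s, of x]
      by (simp add: power2_eq_square distrib_right)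
    then show ?thesis by (rule mult_left_le_imp_le) (use W1[OF s, of x] in simp)
  qed
  \<comment> \<open>from \<open>2 W (L W) = L \<Gamma>(v) - 2 \<Gamma>(W)\<close>; the energy of \<open>W\<close> is paid for by \<open>\<Gamma>_2(v) - \<rho> \<Gamma>(v)\<close>\<close>
  have curv: "- 2 * \<bar>\<rho>\<bar> * H s x \<le> L (H s) x - \<Gamma> (L (v s)) (v s) x / W s x" if s: "s \<le> t" for s x
  proof -
    note S = WS[OF s] GS[OF s] vt(3)[OF s]
    have "(\<lambda>y. W s y * W s y) = (\<lambda>y. 1 + G s y)" using W2[OF s] by auto
    then have "L (\<lambda>y. W s y * W s y) x = L (G s) x" using S by (simp add: L_add L_const S_closed)
    then have LW: "2 * (W s x * L (W s) x) = L (G s) x - 2 * \<Gamma> (W s) (W s) x"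
      using S by (simp add: L_mult)
    have LH: "L (H s) x = L (W s) x" unfolding H_def using S by (simp add: L_diff L_const S_closed)
    have "W s x * (L (H s) x - \<Gamma> (L (v s)) (v s) x / W s x) = W s x * L (W s) x - \<Gamma> (L (v s)) (v s) x"
      unfolding LH using W1[OF s, of x] by (simp add: right_diff_distrib)
    also have "\<dots> = Gamma2 L (v s) x - \<Gamma> (W s) (W s) x"
      using LW \<Gamma>_commute[of "L (v s)" "v s"] by (simp add: Gamma2_def G_def field_simps)
    also have "\<dots> \<ge> \<rho> * G s x" using \<Gamma>WN[OF s, of x] by (simp add: N_def)
    also have "\<rho> * G s x \<ge> - (\<bar>\<rho>\<bar> * (2 * (W s x * H s x)))"
    proof -
      have "\<bar>\<rho>\<bar> * G s x \<le> \<bar>\<rho>\<bar> * (2 * (W s x * H s x))" using GH[OF s] by (intro mult_left_mono) auto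
      moreover have "- (\<bar>\<rho>\<bar> * G s x) \<le> \<rho> * G s x"
        using mult_right_mono[of "- \<bar>\<rho>\<bar>" \<rho> "G s x"] Gp[OF s, of x] by simp
      ultimately show ?thesis by linarith
    qed
    finally have "W s x * (- 2 * \<bar>\<rho>\<bar> * H s x) \<le> W s x * (L (H s) x - \<Gamma> (L (v s)) (v s) x / W s x)"
      by (simp add: mult_ac)
    then show ?thesis by (rule mult_left_le_imp_le) (use W1[OF s, of x] in linarith)
  qed
  have convex: "H b x \<ge> H a x + 2 * (1 / (2 * W a x)) * (\<Gamma> (v b) (v a) x - \<Gamma> (v a) (v a) x)"
    if "a \<le> t" "b \<le> t" for a b x
  proof -
    note A = vt(3)[OF that(1)] and B = vt(3)[OF that(2)]
    have "2 * \<Gamma> (v b) (v a) x \<le> G b x + G a x"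
      using abs_\<Gamma>_le[OF B A, of x] by (simp add: G_def abs_le_iff)
    then have "(1 + \<Gamma> (v b) (v a) x)\<^sup>2 \<le> (W b x * W a x)\<^sup>2"
      using \<Gamma>_Cauchy_Schwarz[OF B A, of x] W2[OF that(1), of x] W2[OF that(2), of x]
      by (simp add: power_mult_distrib) (simp add: power2_eq_square G_def algebra_simps)
    then have "1 + \<Gamma> (v b) (v a) x \<le> W b x * W a x"
      using W1[OF that(1), of x] W1[OF that(2), of x] by (smt (verit) mult_nonneg_nonneg power2_le_imp_le)
    then have "W a x * W a x + (\<Gamma> (v b) (v a) x - G a x) \<le> W b x * W a x" using W2[OF that(1), of x] by simp
    then have "W a x + (\<Gamma> (v b) (v a) x - G a x) / W a x \<le> W b x"
      using W1[OF that(1), of x] by (simp add: field_simps)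
    then show ?thesis by (simp add: H_def G_def)
  qed
  have "H 0 x \<le> exp (2 * \<bar>\<rho>\<bar> * t) * G0"
  proof (rule S_le_by_testing[OF HS[OF t] S_const])
    fix u assume u: "u \<in> A0" "\<And>x. 0 \<le> u x"
    obtain Cu where Cu: "Cu \<ge> 0" "\<And>x. \<bar>u x\<bar> \<le> Cu" using A0_boundedE[OF u(1)] by blast
    obtain C where C: "\<And>a b H H' \<alpha> \<beta> q. convex_subsolution u f t 1 a b H H' \<alpha> \<beta> q \<Longrightarrow>
        (\<integral>x. P b u x * H' x \<partial>M) - (\<integral>x. P a u x * H x \<partial>M) \<ge> (b - a) * (\<integral>x. q x \<partial>M) - C * (b - a)\<^sup>2"
      by (rule evolution_step[OF u f, of 1 t]) auto
    obtain K where K: "K \<ge> 0" "\<And>t. t \<ge> 0 \<Longrightarrow> (\<integral>x. \<Gamma> (P t f) (P t f) x \<partial>M) \<le> K"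
      by (rule uniform_energy[OF f]) blast
    define \<Phi> where "\<Phi> s = (\<integral>x. P s u x * H s x \<partial>M)" for s
    have kt: "P s u \<in> tame" and k0: "0 \<le> P s u x" and kC: "P s u x \<le> Cu" if "0 \<le> s" for s x
      using tame_P[OF that u(1)] P_ge[OF that S_meas[OF A0_in_S[OF u(1)]] Cu(2) u(2)]
        P_A0_bound[OF that u(1) Cu(2), of x] by (auto simp: abs_le_iff)
    have kHi: "integrable M (\<lambda>x. P s u x * H s x)" if "0 \<le> s" "s \<le> t" for s
      by (rule tame_integrable_mult(1)[OF kt[OF that(1)] Hi[OF that(2)]])
    have "\<Phi> 0 \<le> exp (2 * \<bar>\<rho>\<bar> * t) * \<Phi> t"
    proof (rule backward_gronwall[OF t, where B = "Cu * K" and C = C])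
      fix s assume s: "0 \<le> s" "s \<le> t"
      have "\<Phi> s \<le> (\<integral>x. Cu * G s x \<partial>M)" unfolding \<Phi>_def
        using kHi[OF s] Gi[OF s(2)] k0[OF s(1)] kC[OF s(1)] H0[OF s(2)] HG[OF s(2)] Cu(1)
        by (intro integral_mono mult_mono) auto
      also have "\<dots> \<le> Cu * K"
        using K(2)[of "t - s"] s Cu(1) by (simp add: G_def v_def mult_left_mono)
      finally show "0 \<le> \<Phi> s \<and> \<Phi> s \<le> Cu * K"
        unfolding \<Phi>_def using k0[OF s(1)] H0[OF s(2)] by auto
    next
      fix a b :: real assume ab: "0 \<le> a" "a < b" "b \<le> t"
      then have at: "a \<le> t" by simp
      note kta = kt[OF ab(1)]
      have "convex_subsolution u f t 1 a b (H a) (H b) (\<lambda>x. 1 / (2 * W a x)) (\<lambda>_. 0)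
          (\<lambda>x. - 2 * \<bar>\<rho>\<bar> * (P a u x * H a x))"
        unfolding convex_subsolution_def
      proof (intro conjI allI)
        show "(\<lambda>x. 1 / (2 * W a x)) \<in> borel_measurable M" using S_meas[OF WS[OF at]] by measurable
        show "\<bar>H a x\<bar> \<le> 1 * \<Gamma> (P (t - a) f) (P (t - a) f) x" for x
          using H0[OF at, of x] HG[OF at, of x] by (simp add: G_def v_def)
        show "\<bar>1 / (2 * W a x)\<bar> \<le> 1" for x using W1[OF at, of x] by (simp add: field_simps)
        show "\<bar>0\<bar> \<le> 1 * \<Gamma> (P (t - a) f) (P (t - a) f) x" for x
          using Gp[OF at, of x] by (simp add: G_def v_def)
        show "H b x \<ge> H a x + 2 * (1 / (2 * W a x)) * (\<Gamma> (P (t - b) f) (P (t - a) f) x - \<Gamma> (P (t - a) f) (P (t - a) f) x)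
            + 0 * (P (t - b) f x - P (t - a) f x)" for x
          using convex[OF at ab(3), of x] by (simp add: v_def)
        show "integrable M (\<lambda>x. P a u x * sqrt (\<Gamma> (H a) (H a) x))"
        proof (rule integrable_mult_le_squares[OF _ tame_square(1)[OF kta] Ni[OF at]])
          show "(\<lambda>x. P a u x * sqrt (\<Gamma> (H a) (H a) x)) \<in> borel_measurable M"
            using S_meas[OF tame_S[OF kta]] S_meas[OF \<Gamma>_S[OF HS[OF at] HS[OF at]]] by measurable
          fix x
          have "\<Gamma> (H a) (H a) x = \<Gamma> (W a) (W a) x"
            using \<Gamma>H[OF at HS[OF at]] \<Gamma>H[OF at WS[OF at]] \<Gamma>_commute[of "W a" "H a"] by simp
          then show "(P a u x * sqrt (\<Gamma> (H a) (H a) x))\<^sup>2 \<le> (P a u x)\<^sup>2 * N a x"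
            using \<Gamma>WN[OF at, of x] carre_nonneg[OF WS[OF at], of x]
            by (simp add: power_mult_distrib mult_left_mono)
        qed (use N0[OF at] in auto)
        show "integrable M (\<lambda>x. H a x * sqrt (\<Gamma> (P a u) (P a u) x))"
        proof (rule integrable_mult_le_squares[OF _ Gi[OF at] energy_bound(1)[OF kta]])
          show "(\<lambda>x. H a x * sqrt (\<Gamma> (P a u) (P a u) x)) \<in> borel_measurable M"
            using S_meas[OF HS[OF at]] S_meas[OF \<Gamma>_S[OF tame_S[OF kta] tame_S[OF kta]]] by measurable
          fix x
          show "(H a x * sqrt (\<Gamma> (P a u) (P a u) x))\<^sup>2 \<le> G a x * \<Gamma> (P a u) (P a u) x"
            using HG2[OF at, of x] carre_nonneg[OF tame_S[OF kta], of x]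
            by (simp add: power_mult_distrib mult_right_mono)
        qed (use Gp[OF at] carre_nonneg[OF tame_S[OF kta]] in auto)
        show "integrable M (\<lambda>x. - 2 * \<bar>\<rho>\<bar> * (P a u x * H a x))" using kHi[OF ab(1) at] by simp
        show "- 2 * \<bar>\<rho>\<bar> * (P a u x * H a x) \<le> P a u x * (L (H a) x
            - 2 * (1 / (2 * W a x)) * \<Gamma> (L (P (t - a) f)) (P (t - a) f) x - 0 * L (P (t - a) f) x)" for x
          using mult_left_mono[OF curv[OF at, of x] k0[OF ab(1), of x]] by (simp add: v_def mult_ac)
      qed (use ab HS[OF at] Hi[OF ab(3)] in simp_all)
      from C[OF this] show "\<Phi> b - \<Phi> a \<ge> (b - a) * (- (2 * \<bar>\<rho>\<bar>) * \<Phi> a) - C * (b - a)\<^sup>2"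
        by (simp add: \<Phi>_def)
    qed simp
    also have "\<Phi> t \<le> G0 * (\<integral>x. u x \<partial>M)"
    proof -
      have "\<Phi> t \<le> (\<integral>x. G0 * P t u x \<partial>M)" unfolding \<Phi>_def
      proof (rule integral_mono[OF kHi[OF t order_refl]])
        show "P t u x * H t x \<le> G0 * P t u x" for x
        proof -
          have "H t x \<le> G0" using HG[of t x] G0[of x] P_0[OF S_meas[OF fS]] by (simp add: G_def v_def)
          then have "P t u x * H t x \<le> P t u x * G0" using k0[OF t] by (rule mult_left_mono)
          then show ?thesis by (simp add: mult.commute)
        qed
      qed (use P_A0_integrable[OF t u(1)] in auto)
      also have "\<dots> = G0 * (\<integral>x. P t u x \<partial>M)" by simp
      also have "(\<integral>x. P t u x \<partial>M) \<le> (\<integral>x. u x \<partial>M)"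
        using P_A0_L1[OF t u(1)] k0[OF t] u(2) by simp
      finally show ?thesis using G0n by (simp add: mult_left_mono)
    qed
    finally have "\<Phi> 0 \<le> exp (2 * \<bar>\<rho>\<bar> * t) * (G0 * (\<integral>x. u x \<partial>M))" by simp
    then show "(\<integral>x. u x * H 0 x \<partial>M) \<le> (\<integral>x. u x * (exp (2 * \<bar>\<rho>\<bar> * t) * G0) \<partial>M)"
      by (simp add: \<Phi>_def P_0[OF S_meas[OF A0_in_S[OF u(1)]]] mult_ac)
  qed
  then have "W 0 x \<le> 1 + exp (2 * \<bar>\<rho>\<bar> * t) * G0" by (simp add: H_def)
  then have "(W 0 x)\<^sup>2 \<le> (1 + exp (2 * \<bar>\<rho>\<bar> * t) * G0)\<^sup>2" using W1[OF t, of x] by (intro power_mono) auto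
  then show ?thesis using W2[OF t, of x] by (simp add: power2_eq_square G_def v_def)
qed

end

section \<open>The Riccati inequality for the Fisher information\<close>

context markov_diffusion_triple
begin

lemma log_in_bounded_algebra:
  assumes g: "g \<in> S" and \<epsilon>: "0 < \<epsilon>" and lo: "\<And>x. \<epsilon> \<le> g x" and hi: "\<And>x. g x \<le> C"
  shows "(\<lambda>x. ln (g x)) \<in> bounded_algebra S"
proof (rule bounded_algebraI)
  have "elementary (\<lambda>r. ln \<epsilon> + ln (soft_clamp r))" by (intro elementary.intros)
  from S_elementary[OF this S_divide[OF g, of \<epsilon>]]
  have "(\<lambda>x. ln \<epsilon> + ln (soft_clamp (g x / \<epsilon>))) \<in> S" .
  moreover have "ln \<epsilon> + ln (soft_clamp (g x / \<epsilon>)) = ln (g x)" for x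
    using lo[of x] \<epsilon> by (simp add: soft_clamp_eq ln_div)
  ultimately show "(\<lambda>x. ln (g x)) \<in> S" by simp
  fix x
  have "0 < g x" using lo[of x] \<epsilon> by linarith
  moreover then have "0 < C" using hi[of x] by linarith
  ultimately have "ln \<epsilon> \<le> ln (g x)" "ln (g x) \<le> ln C" using lo[of x] hi[of x] \<epsilon> by simp_all
  then show "\<bar>ln (g x)\<bar> \<le> \<bar>ln \<epsilon>\<bar> + \<bar>ln C\<bar>" by linarith
qed

lemma log_calculus:
  assumes l: "l \<in> S" and g: "\<And>x. g x = exp (l x)"
  shows "g \<in> S" "L g = (\<lambda>x. g x * (L l x + \<Gamma> l l x))" "\<And>h. h \<in> S \<Longrightarrow> \<Gamma> g h = (\<lambda>x. g x * \<Gamma> l h x)"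
proof -
  have g': "g = (\<lambda>x. exp (l x))" using g by auto
  have el: "elementary exp" using elementary.exp[OF elementary.ident] by simp
  have d: "deriv exp = (exp :: real \<Rightarrow> real)" by (intro ext DERIV_imp_deriv DERIV_exp)
  show "g \<in> S" unfolding g' by (rule S_elementary[OF el l])
  show "L g = (\<lambda>x. g x * (L l x + \<Gamma> l l x))"
    using diffusion[OF elementary_smooth_real[OF el] l] unfolding g' d
    by (intro ext) (simp add: algebra_simps)
  show "\<Gamma> g h = (\<lambda>x. g x * \<Gamma> l h x)" if "h \<in> S" for h
    using \<Gamma>_chain[OF el l that] unfolding g' d by auto
qed

text \<open>
  With \<open>g = exp l\<close> one has \<open>\<Gamma>(g) / g = g \<Gamma>(l)\<close>, and the left-hand side is \<open>(L + \<partial>_s)\<close> applied to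
  it when \<open>\<partial>_s g = - L g\<close>.  The third-order terms cancel and the Bochner term remains.
\<close>

lemma entropy_production_identity:
  assumes l: "l \<in> S" and g: "\<And>x. g x = exp (l x)"
  shows "L (\<lambda>x. g x * \<Gamma> l l x) x - 2 * (1 / g x) * \<Gamma> (L g) g x - (- (\<Gamma> g g x / (g x)\<^sup>2)) * L g x
    = 2 * g x * Gamma2 L l x"
proof -
  note lc = log_calculus[OF l g]
  have gp: "g y > 0" for y by (simp add: g)
  have "\<Gamma> (L g) g x = g x * \<Gamma> l (L g) x"
    using lc(3)[OF L_S[OF lc(1)]] \<Gamma>_commute[of "L g" g] by simp
  also have "\<Gamma> l (L g) x = g x * (\<Gamma> l (L l) x + \<Gamma> l (\<Gamma> l l) x) + (L l x + \<Gamma> l l x) * (g x * \<Gamma> l l x)"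
    unfolding lc(2) using l lc(1,3) \<Gamma>_commute[of l g] by (simp add: \<Gamma>_mult_right \<Gamma>_linear S_closed)
  finally have a: "\<Gamma> (L g) g x / g x
      = g x * (\<Gamma> l (L l) x + \<Gamma> l (\<Gamma> l l) x) + (L l x + \<Gamma> l l x) * (g x * \<Gamma> l l x)"
    using gp[of x] by simp
  have "\<Gamma> g g x = g x * (g x * \<Gamma> l l x)"
    using lc(3)[OF lc(1)] lc(3)[OF l] \<Gamma>_commute[of l g] by simp
  then have b: "\<Gamma> g g x / (g x)\<^sup>2 = \<Gamma> l l x" using gp[of x] by (simp add: power2_eq_square)
  have c: "L (\<lambda>x. g x * \<Gamma> l l x) x
      = g x * L (\<Gamma> l l) x + \<Gamma> l l x * (g x * (L l x + \<Gamma> l l x)) + 2 * (g x * \<Gamma> l (\<Gamma> l l) x)"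
    using l lc(1) by (simp add: L_mult lc(2,3) S_closed)
  show ?thesis using a unfolding b c lc(2) by (simp add: Gamma2_def algebra_simps)
qed

text \<open>
  The curvature-dimension condition for \<open>l = log g\<close>, with \<open>(L l)^2\<close> replaced by its tangent line at
  a constant \<open>A\<close>.  The result is linear in \<open>L g\<close> and the Fisher information, so it can be integrated;
  optimizing \<open>A\<close> afterwards has the effect of the Cauchy--Schwarz inequality.
\<close>

lemma fisher_production_bound:
  assumes CD: "curvature_dimension S L \<rho> n" and n: "n > 0"
    and l: "l \<in> bounded_algebra S" and g: "\<And>x. g x = exp (l x)"
  shows "2 * \<rho> * (g x * \<Gamma> l l x) + 2 / n * (2 * A * (L g x - g x * \<Gamma> l l x) - A\<^sup>2 * g x)
    \<le> 2 * g x * Gamma2 L l x"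
proof -
  have lS: "l \<in> S" using l by (simp add: bounded_algebra_def)
  have gp: "g x > 0" by (simp add: g)
  have "Gamma2 L l x \<ge> \<rho> * \<Gamma> l l x + 1 / n * (L l x)\<^sup>2"
    using CD l by (auto simp: curvature_dimension_def)
  moreover have "1 / n * (2 * A * L l x - A\<^sup>2) \<le> 1 / n * (L l x)\<^sup>2"
  proof -
    have "(L l x)\<^sup>2 - (2 * A * L l x - A\<^sup>2) = (L l x - A)\<^sup>2" by (simp add: power2_eq_square algebra_simps)
    then have "2 * A * L l x - A\<^sup>2 \<le> (L l x)\<^sup>2" by (smt (verit) zero_le_power2)
    then show ?thesis using n by (intro mult_left_mono) auto
  qed
  ultimately have "\<rho> * \<Gamma> l l x + 1 / n * (2 * A * L l x - A\<^sup>2) \<le> Gamma2 L l x" by linarith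
  then have "2 * g x * (\<rho> * \<Gamma> l l x + 1 / n * (2 * A * L l x - A\<^sup>2)) \<le> 2 * g x * Gamma2 L l x"
    using gp by (intro mult_left_mono) auto
  moreover have "2 * g x * (\<rho> * \<Gamma> l l x + 1 / n * (2 * A * L l x - A\<^sup>2))
    = 2 * \<rho> * (g x * \<Gamma> l l x) + 2 / n * (2 * A * (L g x - g x * \<Gamma> l l x) - A\<^sup>2 * g x)"
    unfolding log_calculus(2)[OF lS g] by (simp add: algebra_simps)
  ultimately show ?thesis by simp
qed

text \<open>
  The perspective \<open>(c, w) \<mapsto> \<bar>w\<bar>^2 / c\<close> of a quadratic form is convex.  Its supporting hyperplane at
  \<open>(a, \<nabla>f)\<close> comes from \<open>\<Gamma>(g - (b/a) f) \<ge> 0\<close>.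
\<close>

lemma perspective_above_tangent:
  assumes "f \<in> S" "g \<in> S" "0 < a" "0 < b"
  shows "\<Gamma> f f x / a + 2 * (1 / a) * (\<Gamma> g f x - \<Gamma> f f x) + (- (\<Gamma> f f x / a\<^sup>2)) * (b - a) \<le> \<Gamma> g g x / b"
proof -
  have "0 \<le> 1\<^sup>2 * \<Gamma> g g x + 2 * (1 * (- (b / a)) * \<Gamma> g f x) + (- (b / a))\<^sup>2 * \<Gamma> f f x"
    by (rule \<Gamma>_quadratic[OF assms(2,1)])
  then have "0 \<le> (\<Gamma> g g x - 2 * (b / a) * \<Gamma> g f x + (b / a)\<^sup>2 * \<Gamma> f f x) / b"
    using assms(4) by simp
  also have "\<dots> = \<Gamma> g g x / b
      - (\<Gamma> f f x / a + 2 * (1 / a) * (\<Gamma> g f x - \<Gamma> f f x) + (- (\<Gamma> f f x / a\<^sup>2)) * (b - a))"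
    using assms(3,4) by (simp add: field_simps power2_eq_square)
  finally show ?thesis by simp
qed

lemma \<Gamma>_quotient_le:
  assumes S: "r \<in> S" "g \<in> S" "G \<in> S" and rg: "\<And>x. r x * g x = 1"
  shows "\<Gamma> (\<lambda>x. r x * G x) (\<lambda>x. r x * G x) x
    \<le> 2 * ((r x)\<^sup>2 * \<Gamma> G G x) + 2 * ((G x)\<^sup>2 * ((r x) ^ 4 * \<Gamma> g g x))"
proof -
  have inv: "\<Gamma> r h x = - (r x)\<^sup>2 * \<Gamma> g h x" if h: "h \<in> S" for h
  proof -
    have "\<Gamma> (\<lambda>x. r x * g x) h x = 0" using h by (simp add: rg \<Gamma>_linear)
    moreover have "\<Gamma> (\<lambda>x. r x * g x) h x = r x * \<Gamma> g h x + g x * \<Gamma> r h x"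
      using S h by (simp add: \<Gamma>_mult_left)
    ultimately have "g x * \<Gamma> r h x = - (r x * \<Gamma> g h x)" by linarith
    then have "r x * (g x * \<Gamma> r h x) = - (r x)\<^sup>2 * \<Gamma> g h x" by (simp add: power2_eq_square)
    then show ?thesis by (simp add: mult.assoc[symmetric] rg)
  qed
  have "\<Gamma> r r x = (r x) ^ 4 * \<Gamma> g g x"
    using inv[OF S(1)] inv[OF S(2)] \<Gamma>_commute[of g r] by (simp add: power4_eq_xxxx power2_eq_square)
  moreover have "2 * (r x * G x * \<Gamma> G r x) \<le> (r x)\<^sup>2 * \<Gamma> G G x + (G x)\<^sup>2 * \<Gamma> r r x"
    using \<Gamma>_quadratic[OF S(3,1), of "r x" x "- G x"] by simp
  moreover have "\<Gamma> (\<lambda>x. r x * G x) (\<lambda>x. r x * G x) x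
      = (r x)\<^sup>2 * \<Gamma> G G x + 2 * (r x * G x * \<Gamma> G r x) + (G x)\<^sup>2 * \<Gamma> r r x"
    using S \<Gamma>_commute[of r G]
    by (simp add: \<Gamma>_mult_left \<Gamma>_mult_right S_closed) (simp add: power2_eq_square algebra_simps)
  ultimately show ?thesis by (simp only:)
qed

lemma P_P_pairing:
  assumes "u \<in> A0" "h \<in> A0" "0 \<le> s" "s \<le> T"
  shows "(\<integral>x. P s u x * P (T - s) h x \<partial>M) = (\<integral>x. u x * P T h x \<partial>M)"
proof -
  obtain C where C: "\<And>x. \<bar>h x\<bar> \<le> C" using A0_boundedE[OF assms(2)] by blast
  have st: "0 \<le> T - s" using assms by simp
  note hm = S_meas[OF A0_in_S[OF assms(2)]]
  have "P T h = P s (P (T - s) h)" using P_comp[OF assms(3) st hm C] by simp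
  then show ?thesis
    using P_dual[OF assms(3,1) P_measurable[OF st hm] P_bound[OF st hm C]] by simp
qed

lemma P_invariant:
  assumes "u \<in> A0" "0 \<le> s" shows "(\<integral>x. P s u x \<partial>M) = (\<integral>x. u x \<partial>M)"
  using P_dual[OF assms(2,1), of "\<lambda>_. 1" 1] by (simp add: P_const[OF assms(2)])

text \<open>
  Here \<open>\<Phi>(s) = \<integral> P_s u \<Gamma>(g_s) / g_s\<close> with \<open>g_s = \<epsilon> + P_{T-s} f\<close>.  The integrals \<open>\<integral> P_s u g_s = Y\<close> and
  \<open>\<integral> P_s u L g_s = X\<close> do not depend on \<open>s\<close>.  Since \<open>g \<ge> \<epsilon>\<close> and \<open>\<Gamma>(g)\<close> is bounded,
  \<open>H = \<Gamma>(g) / g\<close> has finite energy and the evolution step applies.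
\<close>

lemma fisher_riccati_step:
  assumes CD: "curvature_dimension S L \<rho> n" and n: "n > 0"
    and f: "f \<in> A0" "\<And>x. 0 \<le> f x" and u: "u \<in> A0" "\<And>x. 0 \<le> u x" and \<epsilon>: "\<epsilon> > 0"
    and Y: "Y = \<epsilon> * (\<integral>x. u x \<partial>M) + (\<integral>x. u x * P T f x \<partial>M)" "Y > 0"
    and X: "X = (\<integral>x. u x * P T (L f) x \<partial>M)"
    and \<Phi>: "\<And>s. \<Phi> s = (\<integral>x. P s u x * (\<Gamma> (P (T - s) f) (P (T - s) f) x / (\<epsilon> + P (T - s) f x)) \<partial>M)"
  shows "\<exists>B. \<forall>s. 0 \<le> s \<longrightarrow> s \<le> T \<longrightarrow> 0 \<le> \<Phi> s \<and> \<Phi> s \<le> B"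
    and "\<exists>C. \<forall>a b. 0 \<le> a \<longrightarrow> a < b \<longrightarrow> b \<le> T \<longrightarrow>
      \<Phi> b - \<Phi> a \<ge> (b - a) * (2 * \<rho> * \<Phi> a + 2 / n * ((X - \<Phi> a)\<^sup>2 / Y)) - C * (b - a)\<^sup>2"
proof -
  define v where "v s = P (T - s) f" for s
  define g where "g s = (\<lambda>x. \<epsilon> + v s x)" for s
  define l where "l s = (\<lambda>x. ln (g s x))" for s
  define G where "G s = \<Gamma> (v s) (v s)" for s
  define H where "H s = (\<lambda>x. G s x / g s x)" for s
  define N where "N s = (\<lambda>x. Gamma2 L (v s) x - \<rho> * G s x)" for s
  have fS: "f \<in> S" by (rule A0_in_S[OF f(1)])
  obtain Cf where Cf: "Cf \<ge> 0" "\<And>x. \<bar>f x\<bar> \<le> Cf" using A0_boundedE[OF f(1)] by blast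
  obtain Cu where Cu: "Cu \<ge> 0" "\<And>x. \<bar>u x\<bar> \<le> Cu" using A0_boundedE[OF u(1)] by blast
  obtain G0 where G0: "G0 \<ge> 0" "\<And>x. \<bar>\<Gamma> f f x\<bar> \<le> G0" using A0_boundedE[OF A0_\<Gamma>(1)[OF fS f(1)]] by blast
  define B where "B = (1 + exp (2 * \<bar>\<rho>\<bar> * \<bar>T\<bar>) * G0)\<^sup>2"
  have vt: "v s \<in> tame" "L (v s) \<in> tame" "v s \<in> S" if "s \<le> T" for s
    unfolding v_def using that by (auto intro!: tame_P tame_L_P P_A0_S f(1))
  have v0: "0 \<le> v s x" and vC: "\<bar>v s x\<bar> \<le> Cf" if "s \<le> T" for s x
    unfolding v_def using that P_A0_nonneg[OF _ f, of "T - s"] P_A0_bound[OF _ f(1) Cf(2), of "T - s"] by auto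
  have gS: "g s \<in> S" if "s \<le> T" for s unfolding g_def by (intro S_add S_const vt that)
  have g\<epsilon>: "\<epsilon> \<le> g s x" and g0: "0 < g s x" and gC: "g s x \<le> \<epsilon> + Cf" if "s \<le> T" for s x
    using v0[OF that, of x] vC[OF that, of x] \<epsilon> by (auto simp: g_def)
  have lb: "l s \<in> bounded_algebra S" if "s \<le> T" for s
    unfolding l_def by (rule log_in_bounded_algebra[OF gS[OF that] \<epsilon> g\<epsilon>[OF that] gC[OF that]])
  have lS: "l s \<in> S" if "s \<le> T" for s using lb[OF that] by (simp add: bounded_algebra_def)
  have gl: "g s x = exp (l s x)" if "s \<le> T" for s x unfolding l_def using g0[OF that] by simp
  note lc = log_calculus[OF lS gl]
  have \<Gamma>g: "\<Gamma> (g s) h = \<Gamma> (v s) h" "\<Gamma> h (g s) = \<Gamma> h (v s)" if "s \<le> T" "h \<in> S" for s h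
    unfolding g_def using vt(3)[OF that(1)] that by (simp_all add: \<Gamma>_linear S_closed)
  have Lg: "L (g s) = L (v s)" if "s \<le> T" for s
    unfolding g_def using vt(3)[OF that] by (simp add: L_add L_const S_closed)
  have GS: "G s \<in> S" and Gp: "0 \<le> G s x" and Gi: "integrable M (G s)" if "s \<le> T" for s x
    unfolding G_def using vt[OF that] by (auto intro: \<Gamma>_S carre_nonneg tame_\<Gamma>_integrable)
  have Ggg: "\<Gamma> (g s) (g s) = G s" if "s \<le> T" for s
    using \<Gamma>g(1)[OF that gS[OF that]] \<Gamma>g(2)[OF that vt(3)[OF that]] by (simp add: G_def)
  have H_eq: "H s = (\<lambda>x. g s x * \<Gamma> (l s) (l s) x)" if s: "s \<le> T" for s
  proof
    fix x
    have "G s x = g s x * (g s x * \<Gamma> (l s) (l s) x)"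
      using lc(3)[OF s s gS[OF s]] lc(3)[OF s s lS[OF s]] \<Gamma>_commute[of "l s" "g s"] Ggg[OF s] by simp
    then show "H s x = g s x * \<Gamma> (l s) (l s) x" using g0[OF s, of x] by (simp add: H_def)
  qed
  have HS: "H s \<in> S" if "s \<le> T" for s
    unfolding H_eq[OF that] by (intro S_mult \<Gamma>_S gS lS that)
  have GB: "G s x \<le> B" if s: "0 \<le> s" "s \<le> T" for s x
  proof -
    have "G s x \<le> (1 + exp (2 * \<bar>\<rho>\<bar> * (T - s)) * G0)\<^sup>2"
      unfolding G_def v_def using G0(2) s by (intro gradient_bound[OF CD n f(1)]) (auto simp: abs_le_iff)
    also have "\<dots> \<le> B" unfolding B_def using s G0(1)
      by (intro power_mono add_left_mono mult_right_mono) (auto intro!: mult_left_mono)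
    finally show ?thesis .
  qed
  have H0: "0 \<le> H s x" and HG: "H s x \<le> 1 / \<epsilon> * G s x" if "s \<le> T" for s x
  proof -
    show "0 \<le> H s x" unfolding H_def using Gp[OF that] g0[OF that] by (simp add: less_imp_le)
    have "G s x / g s x \<le> G s x / \<epsilon>" using Gp[OF that] g\<epsilon>[OF that] g0[OF that] \<epsilon> by (intro divide_left_mono mult_pos_pos)
    then show "H s x \<le> 1 / \<epsilon> * G s x" by (simp add: H_def)
  qed
  have Hi: "integrable M (H s)" if "s \<le> T" for s
  proof (rule integrable_dominated_S[OF HS[OF that]])
    show "integrable M (\<lambda>x. 1 / \<epsilon> * G s x)" using Gi[OF that] by simp
  qed (use H0[OF that] HG[OF that] in auto)
  have Ni: "integrable M (N s)" and N0: "0 \<le> N s x" if "s \<le> T" for s x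
    unfolding N_def G_def using \<Gamma>2_integrable[OF CD n vt(1,2)[OF that]] by auto
  have \<Gamma>Hi: "integrable M (\<Gamma> (H s) (H s))" if s: "0 \<le> s" "s \<le> T" for s
  proof (rule integrable_dominated_S[OF \<Gamma>_S[OF HS[OF s(2)] HS[OF s(2)]]])
    define r where "r = (\<lambda>x. 1 / g s x)"
    have rS: "r \<in> S"
    proof -
      have "(\<lambda>x. exp (- l s x)) \<in> S" by (rule log_calculus(1)[OF S_minus[OF lS[OF s(2)]] refl])
      moreover have "(\<lambda>x. exp (- l s x)) = r" by (auto simp: r_def gl[OF s(2)] exp_minus inverse_eq_divide)
      ultimately show ?thesis by simp
    qed
    have r: "0 \<le> r x" "r x \<le> 1 / \<epsilon>" "r x * g s x = 1" for x
      unfolding r_def using g\<epsilon>[OF s(2), of x] g0[OF s(2), of x] \<epsilon> by (auto simp: frac_le)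
    have r2: "(r x)\<^sup>2 \<le> (1 / \<epsilon>)\<^sup>2" "(r x) ^ 4 \<le> (1 / \<epsilon>) ^ 4" for x
      using r[of x] by (auto intro!: power_mono)
    show "integrable M (\<lambda>x. 2 * ((1 / \<epsilon>)\<^sup>2 * (4 * B * N s x)) + 2 * (B\<^sup>2 * ((1 / \<epsilon>) ^ 4 * G s x)))"
      using Ni[OF s(2)] Gi[OF s(2)] by simp
    fix x
    have "H s = (\<lambda>x. r x * G s x)" by (auto simp: H_def r_def)
    then have "\<Gamma> (H s) (H s) x \<le> 2 * ((r x)\<^sup>2 * \<Gamma> (G s) (G s) x) + 2 * ((G s x)\<^sup>2 * ((r x) ^ 4 * G s x))"
      using \<Gamma>_quotient_le[OF rS gS[OF s(2)] GS[OF s(2)] r(3), of x] by (simp add: Ggg[OF s(2)])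
    also have "\<dots> \<le> 2 * ((1 / \<epsilon>)\<^sup>2 * (4 * B * N s x)) + 2 * (B\<^sup>2 * ((1 / \<epsilon>) ^ 4 * G s x))"
    proof (rule add_mono; rule mult_left_mono)
      have "\<Gamma> (G s) (G s) x \<le> 4 * G s x * N s x"
        unfolding G_def N_def
        by (rule curvature_improved[OF CD n bounded_algebraI[OF vt(3)[OF s(2)] vC[OF s(2)]]])
      also have "\<dots> \<le> 4 * B * N s x" using GB[OF s] N0[OF s(2)] by (intro mult_right_mono mult_left_mono) auto
      finally show "(r x)\<^sup>2 * \<Gamma> (G s) (G s) x \<le> (1 / \<epsilon>)\<^sup>2 * (4 * B * N s x)"
        using carre_nonneg[OF GS[OF s(2)]] by (intro mult_mono r2) auto
      have "(r x) ^ 4 * G s x \<le> (1 / \<epsilon>) ^ 4 * G s x" by (intro mult_right_mono r2 Gp s)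
      moreover have "(G s x)\<^sup>2 \<le> B\<^sup>2" using GB[OF s, of x] Gp[OF s(2), of x] by (intro power_mono) auto
      ultimately show "(G s x)\<^sup>2 * ((r x) ^ 4 * G s x) \<le> B\<^sup>2 * ((1 / \<epsilon>) ^ 4 * G s x)"
        using Gp[OF s(2), of x] by - (rule mult_mono, assumption+, simp_all)
    qed simp_all
    finally show "\<bar>\<Gamma> (H s) (H s) x\<bar> \<le> 2 * ((1 / \<epsilon>)\<^sup>2 * (4 * B * N s x)) + 2 * (B\<^sup>2 * ((1 / \<epsilon>) ^ 4 * G s x))"
      using carre_nonneg[OF HS[OF s(2)], of x] by simp
  qed
  have convex: "H b x \<ge> H a x + 2 * (1 / g a x) * (\<Gamma> (v b) (v a) x - \<Gamma> (v a) (v a) x)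
      + (- (G a x / (g a x)\<^sup>2)) * (v b x - v a x)" if "a \<le> T" "b \<le> T" for a b x
    using perspective_above_tangent[OF vt(3)[OF that(1)] vt(3)[OF that(2)] g0[OF that(1)] g0[OF that(2)], of x x x]
    by (simp add: H_def G_def g_def)
  have \<Phi>_eq: "\<Phi> s = (\<integral>x. P s u x * H s x \<partial>M)" for s
    by (simp add: \<Phi> H_def G_def g_def v_def)
  have kt: "P s u \<in> tame" and k0: "0 \<le> P s u x" and kC: "P s u x \<le> Cu" if "0 \<le> s" for s x
    using tame_P[OF that u(1)] P_A0_nonneg[OF that u] P_A0_bound[OF that u(1) Cu(2), of x]
    by (auto simp: abs_le_iff)
  have kHi: "integrable M (\<lambda>x. P s u x * H s x)" if "0 \<le> s" "s \<le> T" for s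
    by (rule tame_integrable_mult(1)[OF kt[OF that(1)] Hi[OF that(2)]])
  obtain K where K: "K \<ge> 0" "\<And>t. t \<ge> 0 \<Longrightarrow> (\<integral>x. \<Gamma> (P t f) (P t f) x \<partial>M) \<le> K"
    by (rule uniform_energy[OF f(1)]) blast
  show "\<exists>B. \<forall>s. 0 \<le> s \<longrightarrow> s \<le> T \<longrightarrow> 0 \<le> \<Phi> s \<and> \<Phi> s \<le> B"
  proof (intro exI[of _ "Cu / \<epsilon> * K"] allI impI)
    fix s assume s: "0 \<le> s" "s \<le> T"
    have "\<Phi> s \<le> (\<integral>x. Cu * (1 / \<epsilon> * G s x) \<partial>M)" unfolding \<Phi>_eq
      using kHi[OF s] Gi[OF s(2)] k0[OF s(1)] kC[OF s(1)] H0[OF s(2)] HG[OF s(2)] Cu(1)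
      by (intro integral_mono mult_mono) auto
    also have "\<dots> = Cu / \<epsilon> * (\<integral>x. G s x \<partial>M)" by simp
    also have "\<dots> \<le> Cu / \<epsilon> * K"
      using K(2)[of "T - s"] s Cu(1) \<epsilon> by (intro mult_left_mono) (auto simp: G_def v_def)
    finally show "0 \<le> \<Phi> s \<and> \<Phi> s \<le> Cu / \<epsilon> * K"
      unfolding \<Phi>_eq using k0[OF s(1)] H0[OF s(2)] by auto
  qed
  define c where "c = 1 / \<epsilon> + (1 / \<epsilon>)\<^sup>2"
  have c: "0 \<le> c" "1 / \<epsilon> \<le> c" "(1 / \<epsilon>)\<^sup>2 \<le> c" using \<epsilon> by (auto simp: c_def)
  obtain C where C: "\<And>a b H H' \<alpha> \<beta> q. convex_subsolution u f T c a b H H' \<alpha> \<beta> q \<Longrightarrow>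
      (\<integral>x. P b u x * H' x \<partial>M) - (\<integral>x. P a u x * H x \<partial>M) \<ge> (b - a) * (\<integral>x. q x \<partial>M) - C * (b - a)\<^sup>2"
    by (rule evolution_step[OF u f(1) c(1), of T]) auto
  show "\<exists>C. \<forall>a b. 0 \<le> a \<longrightarrow> a < b \<longrightarrow> b \<le> T \<longrightarrow>
      \<Phi> b - \<Phi> a \<ge> (b - a) * (2 * \<rho> * \<Phi> a + 2 / n * ((X - \<Phi> a)\<^sup>2 / Y)) - C * (b - a)\<^sup>2"
  proof (intro exI[of _ C] allI impI)
    fix a b :: real assume ab: "0 \<le> a" "a < b" "b \<le> T"
    then have at: "a \<le> T" by simp
    note kta = kt[OF ab(1)]
    \<comment> \<open>the maximizer of \<open>2 A (X - \<Phi> a) - A^2 Y\<close>\<close>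
    define A where "A = (X - \<Phi> a) / Y"
    define q where "q = (\<lambda>x. P a u x * (2 * \<rho> * H a x + 2 / n * (2 * A * (L (v a) x - H a x) - A\<^sup>2 * g a x)))"
    have q_eq: "q = (\<lambda>x. 2 * \<rho> * (P a u x * H a x) + 2 / n * (2 * A * (P a u x * L (v a) x - P a u x * H a x)
        - A\<^sup>2 * (\<epsilon> * P a u x + P a u x * v a x)))"
      by (auto simp: q_def g_def algebra_simps)
    note i = kHi[OF ab(1) at] tame_integrable_mult(1)[OF kta tame_integrable(2)[OF vt(1)[OF at]]]
      tame_integrable_mult(1)[OF kta tame_integrable(1)[OF vt(1)[OF at]]] tame_integrable(1)[OF kta]
    have qi: "integrable M q" unfolding q_eq using i by simp
    have Lv: "L (v a) = P (T - a) (L f)" unfolding v_def using at by (intro L_P_commute f) auto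
    have "(\<integral>x. q x \<partial>M) = 2 * \<rho> * \<Phi> a + 2 / n * (2 * A * ((\<integral>x. P a u x * L (v a) x \<partial>M) - \<Phi> a)
        - A\<^sup>2 * (\<epsilon> * (\<integral>x. P a u x \<partial>M) + (\<integral>x. P a u x * v a x \<partial>M)))"
      unfolding q_eq \<Phi>_eq using i by simp
    also have "(\<integral>x. P a u x * L (v a) x \<partial>M) = X"
      unfolding Lv X by (rule P_P_pairing[OF u(1) A0_L[OF f(1)] ab(1) at])
    also have "\<epsilon> * (\<integral>x. P a u x \<partial>M) + (\<integral>x. P a u x * v a x \<partial>M) = Y"
      unfolding Y(1) v_def P_invariant[OF u(1) ab(1)] P_P_pairing[OF u(1) f(1) ab(1) at] ..
    also have "2 * A * (X - \<Phi> a) - A\<^sup>2 * Y = (X - \<Phi> a)\<^sup>2 / Y"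
      unfolding A_def using Y(2) by (simp add: power2_eq_square field_simps)
    finally have q_int: "(\<integral>x. q x \<partial>M) = 2 * \<rho> * \<Phi> a + 2 / n * ((X - \<Phi> a)\<^sup>2 / Y)" .
    have "convex_subsolution u f T c a b (H a) (H b) (\<lambda>x. 1 / g a x) (\<lambda>x. - (G a x / (g a x)\<^sup>2)) q"
      unfolding convex_subsolution_def
    proof (intro conjI allI)
      note [measurable] = S_meas[OF gS[OF at]] S_meas[OF GS[OF at]]
      show "(\<lambda>x. 1 / g a x) \<in> borel_measurable M" "(\<lambda>x. - (G a x / (g a x)\<^sup>2)) \<in> borel_measurable M"
        by measurable
      show "\<bar>H a x\<bar> \<le> c * \<Gamma> (P (T - a) f) (P (T - a) f) x" for x
        using H0[OF at, of x] HG[OF at, of x] mult_right_mono[OF c(2) Gp[OF at, of x]] by (simp add: G_def v_def)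
      have r: "1 / g a x \<le> 1 / \<epsilon>" "0 \<le> 1 / g a x" for x
        using g\<epsilon>[OF at, of x] g0[OF at, of x] \<epsilon> by (auto simp: frac_le)
      show "\<bar>1 / g a x\<bar> \<le> c" for x using r[of x] c(2) by simp
      show "\<bar>- (G a x / (g a x)\<^sup>2)\<bar> \<le> c * \<Gamma> (P (T - a) f) (P (T - a) f) x" for x
      proof -
        have "(1 / g a x)\<^sup>2 \<le> c" using power_mono[OF r(1) r(2), of x 2] c(3) by linarith
        then have "(1 / g a x)\<^sup>2 * G a x \<le> c * G a x" using Gp[OF at] by (intro mult_right_mono) auto
        then show ?thesis using Gp[OF at, of x] by (simp add: G_def v_def power_divide)
      qed
      show "H b x \<ge> H a x + 2 * (1 / g a x) * (\<Gamma> (P (T - b) f) (P (T - a) f) x - \<Gamma> (P (T - a) f) (P (T - a) f) x)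
            + - (G a x / (g a x)\<^sup>2) * (P (T - b) f x - P (T - a) f x)" for x
        using convex[OF at ab(3), of x] by (simp add: v_def)
      show "integrable M (\<lambda>x. P a u x * sqrt (\<Gamma> (H a) (H a) x))"
      proof (rule integrable_mult_le_squares[OF _ tame_square(1)[OF kta] \<Gamma>Hi[OF ab(1) at]])
        show "(\<lambda>x. P a u x * sqrt (\<Gamma> (H a) (H a) x)) \<in> borel_measurable M"
          using S_meas[OF tame_S[OF kta]] S_meas[OF \<Gamma>_S[OF HS[OF at] HS[OF at]]] by measurable
      qed (use carre_nonneg[OF HS[OF at]] in \<open>auto simp: power_mult_distrib\<close>)
      show "integrable M (\<lambda>x. H a x * sqrt (\<Gamma> (P a u) (P a u) x))"
      proof (rule integrable_mult_le_squares[OF _ _ energy_bound(1)[OF kta], of _ "\<lambda>x. (1 / \<epsilon>)\<^sup>2 * (B * G a x)"])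
        show "(\<lambda>x. H a x * sqrt (\<Gamma> (P a u) (P a u) x)) \<in> borel_measurable M"
          using S_meas[OF HS[OF at]] S_meas[OF \<Gamma>_S[OF tame_S[OF kta] tame_S[OF kta]]] by measurable
        show "integrable M (\<lambda>x. (1 / \<epsilon>)\<^sup>2 * (B * G a x))" using Gi[OF at] by simp
        have B0: "0 \<le> B" by (simp add: B_def)
        fix x
        have "(H a x)\<^sup>2 \<le> (1 / \<epsilon> * G a x)\<^sup>2" using H0[OF at] HG[OF at] by (intro power_mono) auto
        also have "\<dots> = (1 / \<epsilon>)\<^sup>2 * (G a x * G a x)" by (simp add: power2_eq_square)
        also have "\<dots> \<le> (1 / \<epsilon>)\<^sup>2 * (B * G a x)"
          using GB[OF ab(1) at, of x] Gp[OF at, of x] by (intro mult_left_mono mult_right_mono) auto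
        finally show "(H a x * sqrt (\<Gamma> (P a u) (P a u) x))\<^sup>2 \<le> (1 / \<epsilon>)\<^sup>2 * (B * G a x) * \<Gamma> (P a u) (P a u) x"
          using carre_nonneg[OF tame_S[OF kta], of x] by (simp add: power_mult_distrib mult_right_mono)
        show "0 \<le> (1 / \<epsilon>)\<^sup>2 * (B * G a x)" "0 \<le> \<Gamma> (P a u) (P a u) x"
          using Gp[OF at] B0 carre_nonneg[OF tame_S[OF kta]] by auto
      qed
      show "q x \<le> P a u x * (L (H a) x - 2 * (1 / g a x) * \<Gamma> (L (P (T - a) f)) (P (T - a) f) x
            - - (G a x / (g a x)\<^sup>2) * L (P (T - a) f) x)" for x
      proof -
        have "\<Gamma> (L (g a)) (g a) x = \<Gamma> (L (v a)) (v a) x"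
          using \<Gamma>g(2)[OF at L_S[OF gS[OF at]]] Lg[OF at] by simp
        then have id: "L (H a) x - 2 * (1 / g a x) * \<Gamma> (L (v a)) (v a) x - - (G a x / (g a x)\<^sup>2) * L (v a) x
            = 2 * g a x * Gamma2 L (l a) x"
          using entropy_production_identity[OF lS[OF at] gl[OF at], of x]
          by (simp only: Ggg[OF at] Lg[OF at] H_eq[OF at])
        have "2 * \<rho> * H a x + 2 / n * (2 * A * (L (v a) x - H a x) - A\<^sup>2 * g a x) \<le> 2 * g a x * Gamma2 L (l a) x"
          using fisher_production_bound[OF CD n lb[OF at] gl[OF at], of x A]
          by (simp only: Lg[OF at] H_eq[OF at])
        from mult_left_mono[OF this k0[OF ab(1), of x]] show ?thesis
          unfolding q_def id[symmetric] by (simp add: v_def)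
      qed
    qed (use ab HS[OF at] Hi[OF ab(3)] qi in simp_all)
    from C[OF this] show "(b - a) * (2 * \<rho> * \<Phi> a + 2 / n * ((X - \<Phi> a)\<^sup>2 / Y)) - C * (b - a)\<^sup>2 \<le> \<Phi> b - \<Phi> a"
      unfolding q_int \<Phi>_eq[symmetric] .
  qed
qed

text \<open>
  If \<open>Y = 0\<close> then \<open>u\<close> has mass \<open>0\<close> and \<open>X = 0\<close>; otherwise the Riccati inequality bounds
  \<open>D + 1 = 4 X / (n \<rho> Y)\<close>, unless \<open>D \<le> 0\<close>, where \<open>\<kappa> \<ge> 1\<close> is enough.
\<close>

lemma li_yau_core:
  assumes CD: "curvature_dimension S L \<rho> n" and n: "n > 0" and \<rho>: "\<rho> \<noteq> 0" and T: "T > 0"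
    and \<kappa>1: "1 \<le> \<kappa>"
    and \<kappa>: "\<And>D. D > 0 \<Longrightarrow> \<bar>\<rho>\<bar> * sqrt D * T \<le> pi / 2 + arctan (\<bar>D - 1\<bar> / (2 * sqrt D)) \<Longrightarrow> D + 1 \<le> \<kappa>"
    and f: "f \<in> A0" "\<And>x. 0 \<le> f x" and u: "u \<in> A0" "\<And>x. 0 \<le> u x" and \<epsilon>: "\<epsilon> > 0"
  shows "4 / (n * \<rho>) * (\<integral>x. u x * P T (L f) x \<partial>M)
    \<le> \<kappa> * (\<epsilon> * (\<integral>x. u x \<partial>M) + (\<integral>x. u x * P T f x \<partial>M))"
proof -
  define Y where "Y = \<epsilon> * (\<integral>x. u x \<partial>M) + (\<integral>x. u x * P T f x \<partial>M)"
  define X where "X = (\<integral>x. u x * P T (L f) x \<partial>M)"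
  have PTf: "0 \<le> P T f x" for x using P_A0_nonneg[OF _ f] T by simp
  have I: "0 \<le> (\<integral>x. u x \<partial>M)" "0 \<le> (\<integral>x. u x * P T f x \<partial>M)" using u(2) PTf by simp_all
  have Y0: "0 \<le> Y" unfolding Y_def using I \<epsilon> by simp
  have "4 / (n * \<rho>) * X \<le> \<kappa> * Y"
  proof (cases "Y = 0")
    case True
    then have u0: "(\<integral>x. u x \<partial>M) = 0" using I \<epsilon> unfolding Y_def
      by (smt (verit) mult_pos_pos)
    obtain C where C: "\<And>x. \<bar>L f x\<bar> \<le> C" using A0_boundedE[OF A0_L[OF f(1)]] by blast
    have "\<bar>X\<bar> \<le> C * (\<integral>x. \<bar>u x\<bar> \<partial>M)"
      unfolding X_def using T by (intro weak_pairing_bound u A0_L f C) auto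
    then have "X = 0" using u0 u(2) by simp
    then show ?thesis using True by simp
  next
    case False
    then have Y: "Y > 0" using Y0 by simp
    define D where "D = 4 * X / (n * \<rho> * Y) - 1"
    have XD: "4 / (n * \<rho>) * X = (D + 1) * Y" using Y n \<rho> by (simp add: D_def field_simps)
    show ?thesis
    proof (cases "D > 0")
      case True
      define \<Phi> where "\<Phi> s = (\<integral>x. P s u x * (\<Gamma> (P (T - s) f) (P (T - s) f) x / (\<epsilon> + P (T - s) f x)) \<partial>M)" for s
      note step = fisher_riccati_step[OF CD n f u \<epsilon> Y_def Y X_def \<Phi>_def]
      obtain B where B: "\<And>s. 0 \<le> s \<Longrightarrow> s \<le> T \<Longrightarrow> 0 \<le> \<Phi> s \<and> \<Phi> s \<le> B" using step(1) by blast
      obtain C where C: "\<And>a b. 0 \<le> a \<Longrightarrow> a < b \<Longrightarrow> b \<le> T \<Longrightarrow>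
        \<Phi> b - \<Phi> a \<ge> (b - a) * (2 * \<rho> * \<Phi> a + 2 / n * ((X - \<Phi> a)\<^sup>2 / Y)) - C * (b - a)\<^sup>2" using step(2) by blast
      have "\<bar>\<rho>\<bar> * sqrt D * T \<le> pi / 2 + arctan (\<bar>D - 1\<bar> / (2 * sqrt D))"
      proof (rule riccati_lifetime[OF \<rho> n Y T B _ D_def True])
        fix a b :: real assume "0 \<le> a" "a \<le> b" "b \<le> T"
        then show "\<Phi> b - \<Phi> a \<ge> (b - a) * (2 * \<rho> * \<Phi> a + 2 / n * ((X - \<Phi> a)\<^sup>2 / Y)) - C * (b - a)\<^sup>2"
          using C[of a b] by (cases "a = b") auto
      qed
      from \<kappa>[OF True this] show ?thesis unfolding XD using Y by (intro mult_right_mono) auto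
    next
      case False
      then show ?thesis unfolding XD using Y \<kappa>1 by (intro mult_right_mono) auto
    qed
  qed
  then show ?thesis by (simp add: X_def Y_def)
qed

text \<open>
  After moving \<open>L\<close> and \<open>P_T\<close> to the test function, the bound for \<open>\<epsilon> + \<zeta>_k f\<close> passes to the limit
  \<open>k \<rightarrow> \<infinity>\<close>, with \<open>\<epsilon> = 1/(k+1)\<close> chosen along the way.
\<close>

lemma li_yau_uniform:
  assumes CD: "curvature_dimension S L \<rho> n" and n: "n > 0" and \<rho>: "\<rho> \<noteq> 0" and T: "T > 0"
    and \<kappa>1: "1 \<le> \<kappa>"
    and \<kappa>: "\<And>D. D > 0 \<Longrightarrow> \<bar>\<rho>\<bar> * sqrt D * T \<le> pi / 2 + arctan (\<bar>D - 1\<bar> / (2 * sqrt D)) \<Longrightarrow> D + 1 \<le> \<kappa>"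
    and f: "f \<in> bounded_algebra S" "\<And>x. 0 \<le> f x"
  shows "4 / (n * \<rho>) * L (P T f) x \<le> \<kappa> * P T f x"
proof -
  obtain C where fS: "f \<in> S" and C: "\<And>x. \<bar>f x\<bar> \<le> C" by (rule bounded_algebraE[OF f(1)]) blast
  have T0: "0 \<le> T" using T by simp
  have PS: "P T f \<in> S" by (rule semigroup_S[OF T0 f(1)])
  show ?thesis
  proof (rule S_le_by_testing[of "\<lambda>x. 4 / (n * \<rho>) * L (P T f) x" "\<lambda>x. \<kappa> * P T f x"])
    show "(\<lambda>x. 4 / (n * \<rho>) * L (P T f) x) \<in> S" "(\<lambda>x. \<kappa> * P T f x) \<in> S" by (intro S_scale L_S PS)+
    fix u assume u: "u \<in> A0" "\<And>x. 0 \<le> u x"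
    define fk where "fk k = (\<lambda>x. f x * cutoff k x)" for k
    have fk: "fk k \<in> A0" "0 \<le> fk k x" for k x
      unfolding fk_def using f(2) cutoff_nonneg by (auto intro: A0_ideal[OF fS cutoff_A0])
    have pair: "(\<integral>x. w x * P T (fk k) x \<partial>M) = (\<integral>x. cutoff k x * (P T w x * f x) \<partial>M)" if "w \<in> A0" for w k
    proof -
      obtain D where D: "\<And>x. \<bar>fk k x\<bar> \<le> D" using A0_boundedE[OF fk(1)] by blast
      show ?thesis
        using P_dual[OF T0 that S_meas[OF A0_in_S[OF fk(1)]] D] by (simp add: fk_def mult_ac)
    qed
    have lim: "(\<lambda>k. \<integral>x. w x * P T (fk k) x \<partial>M) \<longlonglongrightarrow> (\<integral>x. w x * P T f x \<partial>M)" if w: "w \<in> A0" for w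
    proof -
      have "integrable M (\<lambda>x. f x * P T w x)"
        by (rule integrable_bounded_mult[OF S_meas[OF fS] C P_A0_integrable[OF T0 w]])
      then have "integrable M (\<lambda>x. P T w x * f x)" by (simp add: mult.commute)
      from cutoff_limit[OF this] show ?thesis
        unfolding pair[OF w] P_dual[OF T0 w S_meas[OF fS] C] .
    qed
    have Luk: "(\<integral>x. u x * P T (L (fk k)) x \<partial>M) = (\<integral>x. L u x * P T (fk k) x \<partial>M)" for k
      using L_symmetric[OF P_A0_S[OF T0 fk(1)] u(1)] by (simp add: L_P_commute[OF fk(1) T0])
    have "4 / (n * \<rho>) * (\<integral>x. L u x * P T f x \<partial>M) \<le> \<kappa> * (0 * (\<integral>x. u x \<partial>M) + (\<integral>x. u x * P T f x \<partial>M))"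
    proof (rule LIMSEQ_le)
      show "(\<lambda>k. 4 / (n * \<rho>) * (\<integral>x. L u x * P T (fk k) x \<partial>M)) \<longlonglongrightarrow> 4 / (n * \<rho>) * (\<integral>x. L u x * P T f x \<partial>M)"
        by (intro tendsto_intros lim A0_L u)
      show "(\<lambda>k. \<kappa> * (inverse (real (Suc k)) * (\<integral>x. u x \<partial>M) + (\<integral>x. u x * P T (fk k) x \<partial>M)))
          \<longlonglongrightarrow> \<kappa> * (0 * (\<integral>x. u x \<partial>M) + (\<integral>x. u x * P T f x \<partial>M))"
        by (intro tendsto_intros lim u LIMSEQ_inverse_real_of_nat)
      show "\<exists>N. \<forall>k\<ge>N. 4 / (n * \<rho>) * (\<integral>x. L u x * P T (fk k) x \<partial>M)
          \<le> \<kappa> * (inverse (real (Suc k)) * (\<integral>x. u x \<partial>M) + (\<integral>x. u x * P T (fk k) x \<partial>M))"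
        unfolding Luk[symmetric]
        by (intro exI[of _ 0] allI impI li_yau_core[OF CD n \<rho> T \<kappa>1 \<kappa> fk u]) simp_all
    qed
    then show "(\<integral>x. u x * (4 / (n * \<rho>) * L (P T f) x) \<partial>M) \<le> (\<integral>x. u x * (\<kappa> * P T f x) \<partial>M)"
      using L_symmetric[OF PS u(1)] by (simp add: mult.left_commute[of "u _"])
  qed
qed

end

section \<open>The theorem\<close>

theorem corollary2p3:
  fixes M :: "'a measure" and p :: "real \<Rightarrow> 'a \<Rightarrow> 'a measure"
    and A0 S :: "('a \<Rightarrow> real) set" and L :: "('a \<Rightarrow> real) \<Rightarrow> 'a \<Rightarrow> real"
    and \<rho> n t :: real and f :: "'a \<Rightarrow> real" and x :: 'a
  assumes "markov_diffusion_triple M p A0 S L"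
    and "curvature_dimension S L \<rho> n"
    and "\<rho> \<noteq> 0" and "n \<ge> 1"
    and "f \<in> bounded_algebra S" and "\<And>y. f y > 0"
    and "t > 0"
  shows "4 / (n * \<rho>) * (L (semigroup_op p t f) x / semigroup_op p t f x) < 1 + pi\<^sup>2 / (\<rho>\<^sup>2 * t\<^sup>2)"
proof -
  interpret markov_diffusion_triple M p A0 S L by fact
  obtain \<kappa> where \<kappa>: "1 \<le> \<kappa>" "\<kappa> < 1 + pi\<^sup>2 / (\<rho>\<^sup>2 * t\<^sup>2)"
    "\<And>D. D > 0 \<Longrightarrow> \<bar>\<rho>\<bar> * sqrt D * t \<le> pi / 2 + arctan (\<bar>D - 1\<bar> / (2 * sqrt D)) \<Longrightarrow> D + 1 \<le> \<kappa>"
    by (rule lifetime_gap[OF assms(3,7)]) blast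
  obtain C where fS: "f \<in> S" and C: "\<And>x. \<bar>f x\<bar> \<le> C" by (rule bounded_algebraE[OF assms(5)]) blast
  have pos: "0 < P t f x"
    using assms(6,7) by (intro P_pos[OF _ S_meas[OF fS] C]) auto
  have "4 / (n * \<rho>) * L (P t f) x \<le> \<kappa> * P t f x"
    using assms(4,6) by (intro li_yau_uniform[OF assms(2) _ assms(3,7) \<kappa>(1,3) assms(5)]) (auto intro: less_imp_le)
  then have "4 / (n * \<rho>) * (L (P t f) x / P t f x) \<le> \<kappa>"
    using pos by (simp only: times_divide_eq_right pos_divide_le_eq)
  with \<kappa>(2) show ?thesis by linarith
qed

end
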